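(* Let $n\ge 0$ be an integer, and if $\operatorname{char}(K)=p>0$ assume moreover $n\le p-1$. Then: (1) The set $\{\gamma_r^{\,n-j}(x-r)^j\chi_r(x)\mid r\in\mathcal{R},\ 0\le j\le n\}$ is an orthonormal basis of $C^n(R,K)$, where $C^0(R,K)=C(R,K)$ carries the supremum norm and, for $n\ge1$, $C^n(R,K)$ carries the norm $|\cdot|_n$. (2) If $f\in C^n(R,K)$ has the representation $f(x)=\sum_{r\in\mathcal{R}}\sum_{j=0}^n b_r^{n,j}(f)\gamma_r^{\,n-j}(x-r)^j\chi_r(x)$, then for each $0\le j\le n$, $b_r^{n,j}(f)=D_jf(0)$ if $r=0$, and $b_r^{n,j}(f)=\gamma_r\,\psi_{n-j}D_jf(r,r_-)$ if $r\in\mathcal{R}_+$. (3) Let $f\in C^n(R,K)$ with coefficients $b_r^{n,j}(f)$ as in (2). Then $f\in C^{n+1}(R,K)$ if and only if for every $a\in R$ and every $0\le j\le n$ the limit $\lim_{r\to a,\ a\ne r\in\mathcal{R}_+} b_r^{n,j}(f)\gamma_r^{-1}$ exists and $\lim_{r\to a,\ a\ne r\in\mathcal{R}_+} b_r^{n,j}(f)\gamma_r^{-1}=\binom{n+1}{j}\lim_{r\to a,\ a\ne r\in\mathcal{R}_+} b_r^{n,0}(f)\gamma_r^{-1}$. (4) For $f\in C^{n+1}(R,K)$ with coefficients $b_r^{n,j}(f)$ as in (2), the quantity $|f|_{n+1}=\sup_{r\in\mathcal{R},\,0\le j\le n}|b_r^{n,j}(f)\gamma_r^{-1}|$ is finite,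 $|\cdot|_{n+1}$ is a norm on $C^{n+1}(R,K)$, and $C^{n+1}(R,K)$ is a $K$-Banach space with respect to it.
   Context: $K$ is a local field: the fraction field of a complete discrete valuation ring $R$ with finite residue field $\kappa$ of cardinality $q$. Fix a uniformizer $\pi$, normalize $|\pi|=q^{-1}$, and fix a set $\mathcal{T}\subset R$ of representatives of $\kappa$ containing $0$; every $x\in R$ has a unique expansion $x=\sum_{i\ge0}a_i\pi^i$, $a_i\in\mathcal{T}$. Let $\mathcal{R}_0=\{0\}$, $\mathcal{R}_m=\{\sum_{i=0}^{m-1}a_i\pi^i: a_i\in\mathcal{T}\}$ ($m\ge1$), $\mathcal{R}=\bigcup_{m\ge0}\mathcal{R}_m$, $\mathcal{R}_+=\bigcup_{m\ge1}\mathcal{R}_m$. The length $l(r)$ of $r\in\mathcal{R}$ is the $m$ with $r\in\mathcal{R}_m\setminus\mathcal{R}_{m-1}$ ($l(0)=0$). For $r\in\mathcal{R}_+$ written $r=\sum_{i=0}^{m}a_i\pi^i$ with $a_i\in\mathcal{T}$, $a_m\neq0$, put $r_-=\sum_{i=0}^{m-1}a_i\pi^i$. Put $\gamma_0=1$ and $\gamma_r=r-r_-$ for $r\in\mathcal{R}_+$. $\chi_r$ is the characteristic function of $\{x\in R:|x-r|\le q^{-l(r)}\}$. Difference quotients: $\nabla^kR=\{(x_1,\dots,x_k)\in R^k: x_i\ne x_j\text{ for }i\neq j\}$; for $f:R\to K$, $\Phi_0f=f$ and $\Phi_kf:\nabla^{k+1}R\to K$, $\Phi_kf(x_1,\dots,x_{k+1})=\frac{\Phi_{k-1}f(x_1,x_3,\dots,x_{k+1})-\Phi_{k-1}f(x_2,x_3,\dots,x_{k+1})}{x_1-x_2}$.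 $f$ is $C^k$ if $\Phi_kf$ extends to a continuous function on $R^{k+1}$; $C^k(R,K)$ denotes the set of these, $C^0(R,K)=C(R,K)$ (continuous functions, sup norm). For $f\in C^k$ and $j\le k$, $D_jf(x)=\Phi_jf(x,\dots,x)$ (continuous extension); $D_jf\in C^{k-j}(R,K)$. For $f\in C^k$ and $0\le j\le k$, define $\psi_jf:\nabla^2R\to K$ by $\psi_0f=\Phi_1f$ and $\psi_jf(x,y)=\frac{f(x)-f(y)-\sum_{l=1}^j(x-y)^lD_lf(y)}{(x-y)^{j+1}}$. Norm: for $m\ge1$ and $f\in C^m(R,K)$, $|f|_m=\sup\big(\{|D_jf(0)|:0\le j\le m-1\}\cup\{|\psi_{m-1-j}D_jf(r,r_-)|: r\in\mathcal{R}_+,\,0\le j\le m-1\}\big)$. Limits: $\lim_{r\to a,\ a\ne r\in\mathcal{R}_+}x_r=L$ means: for every $\varepsilon>0$ there is $\delta>0$ with $|x_r-L|<\varepsilon$ for all $r\in\mathcal{R}_+$ with $0<|r-a|<\delta$. Orthonormal basis of a $K$-Banach space $(B,\|\cdot\|)$: a family $(x_i)$ with $\|x_i\|=1$ such that every $x\in B$ is a convergent sum $\sum c_ix_i$ with $c_i\in K$, and $\|\sum c_ix_i\|=\sup|c_i|$ for every family $c_i\to0$. *)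

theory Defs
  imports "HOL-Analysis.Analysis"
begin

section \<open>Local fields\<close>

text \<open>
  A field with a normalised discrete valuation; \<open>val 0\<close> is irrelevant (it plays the role of
  \<open>\<infinity>\<close>).
\<close>

class discrete_valued_field = field +
  fixes val :: "'a \<Rightarrow> int"
  assumes val_mult: "x \<noteq> 0 \<Longrightarrow> y \<noteq> 0 \<Longrightarrow> val (x * y) = val x + val y"
    and val_add: "x \<noteq> 0 \<Longrightarrow> y \<noteq> 0 \<Longrightarrow> x + y \<noteq> 0 \<Longrightarrow> min (val x) (val y) \<le> val (x + y)"
    and val_surj: "\<exists>x. x \<noteq> 0 \<and> val x = k"
begin

definition integers :: "'a set" (\<open>\<O>\<close>) where
  "\<O> = {x. x = 0 \<or> 0 \<le> val x}"

definition val_ideal :: "'a set" where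
  "val_ideal = {x. x = 0 \<or> 0 < val x}"

definition residue_field :: "'a set set" where
  "residue_field = \<O> // {(x, y). x \<in> \<O> \<and> y \<in> \<O> \<and> x - y \<in> val_ideal}"

definition lf_abs :: "'a \<Rightarrow> real" where
  "lf_abs x = (if x = 0 then 0 else real (card residue_field) powi (- val x))"

end

text \<open>
  The fraction field of a complete discrete valuation ring with finite residue field.  The metric
  of the type is required to be the one induced by the normalised absolute value, so that the
  topological notions of the library are those of the local field.
\<close>

class local_field = discrete_valued_field + metric_space +
  assumes finite_residue_field: "finite residue_field"
    and dist_lf_abs: "dist x y = lf_abs (x - y)"
    and complete_integers: "complete \<O>"

definition uniformizer :: "'k::local_field \<Rightarrow> bool" where
  "uniformizer \<pi> \<longleftrightarrow> \<pi> \<noteq> 0 \<and> val \<pi> = 1"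

definition residue_reps :: "'k::local_field set \<Rightarrow> bool" where
  "residue_reps T \<longleftrightarrow> T \<subseteq> \<O> \<and> 0 \<in> T \<and> (\<forall>x\<in>\<O>. \<exists>!t. t \<in> T \<and> x - t \<in> val_ideal)"


section \<open>Finite expansions\<close>

text \<open>\<open>\<pi>\<close> is a uniformizer and \<open>T\<close> a set of representatives of the residue field.\<close>

definition digits :: "'k::local_field \<Rightarrow> 'k set \<Rightarrow> nat \<Rightarrow> 'k set" where
  "digits \<pi> T m = {(\<Sum>i<m. a i * \<pi> ^ i) | a. \<forall>i<m. a i \<in> T}"

definition fin_exp :: "'k::local_field \<Rightarrow> 'k set \<Rightarrow> 'k set" where
  "fin_exp \<pi> T = (\<Union>m. digits \<pi> T m)"

text \<open>
  The index set of the elements \<open>r\<close> having a last nonzero digit, i.e. \<open>r \<noteq> 0\<close> (note that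
  \<open>0\<close> does belong to \<open>digits \<pi> T m\<close> for every \<open>m\<close>).
\<close>

definition fin_exp_plus :: "'k::local_field \<Rightarrow> 'k set \<Rightarrow> 'k set" where
  "fin_exp_plus \<pi> T = (\<Union>m\<in>{1..}. digits \<pi> T m) - {0}"

text \<open>Since \<open>0 \<in> T\<close>, the sets \<open>digits \<pi> T m\<close> increase with \<open>m\<close>.\<close>

definition len :: "'k::local_field \<Rightarrow> 'k set \<Rightarrow> 'k \<Rightarrow> nat" where
  "len \<pi> T r = (LEAST m. r \<in> digits \<pi> T m)"

definition pred :: "'k::local_field \<Rightarrow> 'k set \<Rightarrow> 'k \<Rightarrow> 'k" where
  "pred \<pi> T r = (THE s. \<exists>m a. (\<forall>i\<le>m. a i \<in> T) \<and> a m \<noteq> 0 \<and>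
      r = (\<Sum>i\<le>m. a i * \<pi> ^ i) \<and> s = (\<Sum>i<m. a i * \<pi> ^ i))"

definition gam :: "'k::local_field \<Rightarrow> 'k set \<Rightarrow> 'k \<Rightarrow> 'k" where
  "gam \<pi> T r = (if r = 0 then 1 else r - pred \<pi> T r)"

definition chi :: "'k::local_field \<Rightarrow> 'k set \<Rightarrow> 'k \<Rightarrow> 'k \<Rightarrow> 'k" where
  "chi \<pi> T r x = (if x \<in> \<O> \<and>
      lf_abs (x - r) \<le> real (card (residue_field :: 'k set set)) powi (- int (len \<pi> T r))
     then 1 else 0)"

definition wavelet :: "'k::local_field \<Rightarrow> 'k set \<Rightarrow> nat \<Rightarrow> 'k \<Rightarrow> nat \<Rightarrow> 'k \<Rightarrow> 'k" where
  "wavelet \<pi> T n r j = (\<lambda>x. gam \<pi> T r ^ (n - j) * (x - r) ^ j * chi \<pi> T r x)"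


section \<open>Functions of class \<open>C\<^sup>k\<close>\<close>

text \<open>
  \<open>Phi f [x\<^sub>1, \<dots>, x\<^sub>k\<^sub>+\<^sub>1]\<close> is the \<open>k\<close>-th difference quotient
  (the value at the empty list is irrelevant).
\<close>

fun Phi :: "('k::local_field \<Rightarrow> 'k) \<Rightarrow> 'k list \<Rightarrow> 'k" where
  "Phi f [] = 0"
| "Phi f [x] = f x"
| "Phi f (x # y # zs) = (Phi f (x # zs) - Phi f (y # zs)) / (x - y)"

text \<open>
  Points of \<open>\<O>\<^sup>k\<^sup>+\<^sup>1\<close> are extensional functions on the index set \<open>{..k}\<close>, and
  \<open>\<O>\<^sup>k\<^sup>+\<^sup>1\<close> carries the product topology.  The following relation says that \<open>g\<close> is a
  continuous extension of the \<open>k\<close>-th difference quotient of \<open>f\<close>.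
\<close>

definition nabla :: "nat \<Rightarrow> (nat \<Rightarrow> 'k::local_field) set" where
  "nabla k = {x \<in> (\<Pi>\<^sub>E i\<in>{..k}. \<O>). inj_on x {..k}}"

definition Phi_extension :: "nat \<Rightarrow> ('k::local_field \<Rightarrow> 'k) \<Rightarrow> ((nat \<Rightarrow> 'k) \<Rightarrow> 'k) \<Rightarrow> bool" where
  "Phi_extension k f g \<longleftrightarrow>
     continuous_map (product_topology (\<lambda>_. top_of_set \<O>) {..k}) euclidean g \<and>
     (\<forall>x\<in>nabla k. g x = Phi f (map x [0..<Suc k]))"

text \<open>
  A function from \<open>\<O>\<close> to the field is represented by its extension by \<open>0\<close> to the whole type.
\<close>

definition Cspace :: "nat \<Rightarrow> ('k::local_field \<Rightarrow> 'k) set" where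
  "Cspace k = {f. (\<forall>x. x \<notin> \<O> \<longrightarrow> f x = 0) \<and> (\<exists>g. Phi_extension k f g)}"

text \<open>
  Tuples with distinct entries are dense in \<open>\<O>\<^sup>j\<^sup>+\<^sup>1\<close>, so the continuous extension is unique there.
\<close>

definition Dq :: "nat \<Rightarrow> ('k::local_field \<Rightarrow> 'k) \<Rightarrow> 'k \<Rightarrow> 'k" where
  "Dq j f x = (if x \<in> \<O> then (SOME g. Phi_extension j f g) (\<lambda>i\<in>{..j}. x) else 0)"

text \<open>For \<open>j = 0\<close> the sum is empty and this is the first difference quotient.\<close>

definition psi :: "nat \<Rightarrow> ('k::local_field \<Rightarrow> 'k) \<Rightarrow> 'k \<Rightarrow> 'k \<Rightarrow> 'k" where
  "psi j f x y = (f x - f y - (\<Sum>l=1..j. (x - y) ^ l * Dq l f y)) / (x - y) ^ Suc j"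

text \<open>
  Norms take extended values, so that each supremum is the true one and finiteness is part of
  being a norm.
\<close>

definition Cnorm :: "'k::local_field \<Rightarrow> 'k set \<Rightarrow> nat \<Rightarrow> ('k \<Rightarrow> 'k) \<Rightarrow> ennreal" where
  "Cnorm \<pi> T m f =
     (if m = 0 then (SUP x\<in>\<O>. ennreal (lf_abs (f x)))
      else Sup ({ennreal (lf_abs (Dq j f 0)) | j. j \<le> m - 1} \<union>
                {ennreal (lf_abs (psi (m - 1 - j) (Dq j f) r (pred \<pi> T r))) | r j.
                   r \<in> fin_exp_plus \<pi> T \<and> j \<le> m - 1}))"


section \<open>Banach spaces of functions over a local field\<close>

definition fun_subspace :: "('k::local_field \<Rightarrow> 'k) set \<Rightarrow> bool" where
  "fun_subspace B \<longleftrightarrow> (\<lambda>_. 0) \<in> B \<and> (\<forall>f\<in>B. \<forall>g\<in>B. (\<lambda>x. f x + g x) \<in> B) \<and>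
     (\<forall>c. \<forall>f\<in>B. (\<lambda>x. c * f x) \<in> B)"

text \<open>Norms over a non-archimedean field satisfy the strong triangle inequality.\<close>

definition is_norm :: "('k::local_field \<Rightarrow> 'k) set \<Rightarrow> (('k \<Rightarrow> 'k) \<Rightarrow> ennreal) \<Rightarrow> bool" where
  "is_norm B N \<longleftrightarrow>
     fun_subspace B \<and>
     (\<forall>f\<in>B. N f < \<infinity>) \<and>
     (\<forall>f\<in>B. N f = 0 \<longleftrightarrow> f = (\<lambda>_. 0)) \<and>
     (\<forall>c. \<forall>f\<in>B. N (\<lambda>x. c * f x) = ennreal (lf_abs c) * N f) \<and>
     (\<forall>f\<in>B. \<forall>g\<in>B. N (\<lambda>x. f x + g x) \<le> max (N f) (N g))"

definition is_Banach :: "('k::local_field \<Rightarrow> 'k) set \<Rightarrow> (('k \<Rightarrow> 'k) \<Rightarrow> ennreal) \<Rightarrow> bool" where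
  "is_Banach B N \<longleftrightarrow>
     is_norm B N \<and>
     (\<forall>s :: nat \<Rightarrow> 'k \<Rightarrow> 'k. (\<forall>i. s i \<in> B) \<and>
        (\<forall>\<epsilon>>0. \<exists>M. \<forall>i\<ge>M. \<forall>j\<ge>M. N (\<lambda>x. s i x - s j x) < \<epsilon>) \<longrightarrow>
        (\<exists>f\<in>B. (\<lambda>i. N (\<lambda>x. s i x - f x)) \<longlonglongrightarrow> 0))"

text \<open>
  \<open>norm_has_sum N I e c f\<close>: the family \<open>(c i e i)\<close>, \<open>i \<in> I\<close>, is (unconditionally) summable
  with sum \<open>f\<close> with respect to the norm \<open>N\<close>.
\<close>

definition norm_has_sum ::
  "(('k::local_field \<Rightarrow> 'k) \<Rightarrow> ennreal) \<Rightarrow> 'i set \<Rightarrow> ('i \<Rightarrow> 'k \<Rightarrow> 'k) \<Rightarrow> ('i \<Rightarrow> 'k) \<Rightarrow> ('k \<Rightarrow> 'k) \<Rightarrow> bool"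
where
  "norm_has_sum N I e c f \<longleftrightarrow>
     ((\<lambda>F. N (\<lambda>x. f x - (\<Sum>i\<in>F. c i * e i x))) \<longlongrightarrow> 0) (finite_subsets_at_top I)"

definition null_family :: "'i set \<Rightarrow> ('i \<Rightarrow> 'k::local_field) \<Rightarrow> bool" where
  "null_family I c \<longleftrightarrow> (\<forall>\<epsilon>>0. finite {i\<in>I. lf_abs (c i) \<ge> \<epsilon>})"

definition orthonormal_basis ::
  "('k::local_field \<Rightarrow> 'k) set \<Rightarrow> (('k \<Rightarrow> 'k) \<Rightarrow> ennreal) \<Rightarrow> 'i set \<Rightarrow> ('i \<Rightarrow> 'k \<Rightarrow> 'k) \<Rightarrow> bool"
where
  "orthonormal_basis B N I e \<longleftrightarrow>
     is_Banach B N \<and>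
     (\<forall>i\<in>I. e i \<in> B \<and> N (e i) = 1) \<and>
     (\<forall>f\<in>B. \<exists>c. norm_has_sum N I e c f) \<and>
     (\<forall>c. null_family I c \<longrightarrow>
        (\<exists>f\<in>B. norm_has_sum N I e c f \<and> N f = (SUP i\<in>I. ennreal (lf_abs (c i)))))"

definition wavelet_expansion ::
  "'k::local_field \<Rightarrow> 'k set \<Rightarrow> nat \<Rightarrow> ('k \<Rightarrow> 'k) \<Rightarrow> ('k \<Rightarrow> nat \<Rightarrow> 'k) \<Rightarrow> bool"
where
  "wavelet_expansion \<pi> T n f b \<longleftrightarrow>
     norm_has_sum (Cnorm \<pi> T n) (fin_exp \<pi> T \<times> {..n})
       (\<lambda>(r, j). wavelet \<pi> T n r j) (\<lambda>(r, j). b r j) f"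

end

theory Submission
  imports Defs
begin

text \<open>
  A difference quotient of order \<open>n\<close> extends continuously as soon as it has limits along the diagonal,
  so \<open>C\<^sup>n\<close> is described by limits of \<open>Phi f xs\<close> as all entries of \<open>xs\<close> tend to one point. If
  \<open>\<bar>Phi f xs\<bar> \<le> M\<close> for all \<open>xs\<close> of order \<open>n\<close> in a ball, the same bound holds for the difference quotients of
  order \<open>n - j\<close> of \<open>Dq j f\<close> and for the Taylor remainders; applied to \<open>f - L (x - a)\<^sup>n\<close> this gives the
  composition rule for the \<open>Dq j\<close> and the limits of \<open>psi\<close> on the diagonal.

  The partial sum of the wavelet expansion over the expansions of length at most \<open>m\<close> is, on each ball
  of radius \<open>\<bar>\<pi>\<bar>\<^sup>m\<close>, the Taylor polynomial of \<open>f\<close> at its centre, so the expansion converges to \<open>f\<close>, and its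
  coefficients tend to zero because the ring of integers is compact. Since every wavelet has
  difference quotients of absolute value at most 1, the norm of \<open>C\<^sup>n\<close> equals both the supremum of the coefficients
  and that of all difference quotients of order at most \<open>n\<close>; completeness and the orthonormal basis follow.
\<close>

subsection \<open>The absolute value\<close>

text \<open>Difference quotients need distinct nodes, whereas \<open>Dq\<close> and
  \<open>psi\<close> live on the diagonal. The bridge is a perturbation: a point is replaced by its
  translates by high powers of a uniformizer, an inequality is proved at these distinct nodes, and
  non-strict ultrametric bounds survive the limit. Subtracting \<open>L (x - a)^n\<close> turns a
  limit \<open>L\<close> into a bound, because the quotient of order \<open>n\<close> of this power
  is exactly 1.

  The factor \<open>\<gamma> r ^ (n - j)\<close> balances the orders: a quotient of order
  \<open>k\<close> of a wavelet is at most \<open>|\<gamma> r|^(n - k)\<close>. For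
  \<open>k \<le> n\<close> this is at most 1; for \<open>k = n + 1\<close> it is
  \<open>1 / |\<gamma> r|\<close>, which is why membership in \<open>C^(n+1)\<close> is read off
  from the coefficients divided by \<open>\<gamma> r\<close>.

  For \<open>n \<ge> 1\<close> the norm of \<open>C^n\<close> contains only \<open>Dq j f 0\<close>
  with \<open>j < n\<close> and remainders. The missing \<open>Dq n f a\<close> is recovered as the
  limit of \<open>psi (n - 1) f r (pr r)\<close> for \<open>r\<close> tending to \<open>a\<close>,
  since the expansions accumulate at every integer \<open>a\<close>; in this way the norm bounds all
  coefficients.\<close>

lemma val_one [simp]: "val (1::'k::discrete_valued_field) = 0"
  using val_mult[of "1::'k" 1] by simp

lemma val_minus [simp]: "val (- x) = val (x::'k::discrete_valued_field)"
proof (cases "x = 0")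
  case False
  have "val (- 1::'k) + val (- 1::'k) = 0"
    using val_mult[of "- 1::'k" "- 1"] by simp
  then show ?thesis
    using val_mult[of "- 1" x] False by simp
qed simp

text \<open>The classes of 0 and 1 differ because \<open>val 1 = 0\<close>, and finiteness gives
  \<open>card\<close> its meaning. With a base above 1, \<open>lf_abs\<close> is definite and
  decreases as the valuation grows.\<close>

lemma residue_card_gt_1: "1 < real (card (residue_field :: 'k::local_field set set))"
proof -
  define R where "R = {(x, y). x \<in> \<O> \<and> y \<in> \<O> \<and> x - y \<in> (val_ideal :: 'k set)}"
  have 1: "R `` {0} \<in> residue_field" "R `` {1} \<in> residue_field"
    unfolding residue_field_def R_def by (intro quotientI; simp add: integers_def)+
  have 2: "1 \<in> R `` {1}" "1 \<notin> R `` {0}"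
    by (auto simp: R_def integers_def val_ideal_def)
  then have "card {R `` {0}, R `` {1}} = 2"
    by (metis card_2_iff)
  moreover have "card {R `` {0}, R `` {1}} \<le> card (residue_field :: 'k set set)"
    by (rule card_mono) (use 1 finite_residue_field in auto)
  ultimately show ?thesis by linarith
qed

lemma residue_card_pos [simp]: "0 < card (residue_field :: 'k::local_field set set)"
  using residue_card_gt_1[where 'k='k] by simp

context
  fixes x y :: "'k::local_field"
begin

lemma lf_abs_nonneg [simp]: "0 \<le> lf_abs x"
  by (simp add: lf_abs_def)

lemma lf_abs_eq_0 [simp]: "lf_abs x = 0 \<longleftrightarrow> x = 0"
  using residue_card_pos[where 'k='k] by (simp add: lf_abs_def)

lemma lf_abs_pos [simp]: "0 < lf_abs x \<longleftrightarrow> x \<noteq> 0"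
  using lf_abs_nonneg lf_abs_eq_0 by linarith

lemma lf_abs_minus [simp]: "lf_abs (- x) = lf_abs x"
  by (simp add: lf_abs_def)

lemma lf_abs_mult: "lf_abs (x * y) = lf_abs x * lf_abs y"
  using residue_card_pos[where 'k='k]
  by (simp add: lf_abs_def val_mult power_int_diff power_int_minus field_simps power_int_add)

lemma lf_abs_add_le: "lf_abs (x + y) \<le> max (lf_abs x) (lf_abs y)"
proof (cases "x = 0 \<or> y = 0 \<or> x + y = 0")
  case True
  then show ?thesis
    using lf_abs_nonneg by (auto simp: max_def lf_abs_def)
next
  case False
  then have "min (val x) (val y) \<le> val (x + y)"
    by (intro val_add) auto
  then have "- val (x + y) \<le> - val x \<or> - val (x + y) \<le> - val y"
    by linarith
  then have "lf_abs (x + y) \<le> lf_abs x \<or> lf_abs (x + y) \<le> lf_abs y"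
    using False residue_card_gt_1[where 'k='k] by (auto simp: lf_abs_def intro: power_int_increasing)
  then show ?thesis by auto
qed

end

lemma lf_abs_0 [simp]: "lf_abs (0::'k::local_field) = 0"
  by simp

lemma lf_abs_1 [simp]: "lf_abs (1::'k::local_field) = 1"
  by (simp add: lf_abs_def)

lemma lf_abs_commute: "lf_abs (x - y) = lf_abs (y - x :: 'k::local_field)"
  by (metis lf_abs_minus minus_diff_eq)

lemma lf_abs_inverse: "lf_abs (inverse x) = inverse (lf_abs (x :: 'k::local_field))"
proof (cases "x = 0")
  case False
  then show ?thesis
    using lf_abs_mult[of x "inverse x"] by (simp add: field_simps)
qed simp

lemma lf_abs_divide: "lf_abs (x / y) = lf_abs x / lf_abs (y :: 'k::local_field)"
  by (simp add: divide_inverse lf_abs_mult lf_abs_inverse)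

lemma lf_abs_power: "lf_abs (x ^ n) = lf_abs (x :: 'k::local_field) ^ n"
  by (induction n) (auto simp: lf_abs_mult)

lemma lf_abs_add_leI:
  "lf_abs x \<le> e \<Longrightarrow> lf_abs y \<le> e \<Longrightarrow> lf_abs (x + y :: 'k::local_field) \<le> e"
  using lf_abs_add_le[of x y] by auto

lemma lf_abs_diff_leI:
  "lf_abs x \<le> e \<Longrightarrow> lf_abs y \<le> e \<Longrightarrow> lf_abs (x - y :: 'k::local_field) \<le> e"
  using lf_abs_add_leI[of x e "- y"] by simp

lemma lf_abs_diff_trans:
  "lf_abs (x - y) \<le> e \<Longrightarrow> lf_abs (y - z) \<le> e \<Longrightarrow> lf_abs (x - z :: 'k::local_field) \<le> e"
  using lf_abs_add_leI[of "x - y" e "y - z"] by simp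

lemma lf_abs_sum_leI:
  "0 \<le> e \<Longrightarrow> (\<And>i. i \<in> A \<Longrightarrow> lf_abs (f i :: 'k::local_field) \<le> e) \<Longrightarrow> lf_abs (sum f A) \<le> e"
  by (induction A rule: infinite_finite_induct) (auto intro: lf_abs_add_leI)

lemma lf_abs_of_nat_le: "lf_abs (of_nat n :: 'k::local_field) \<le> 1"
  by (induction n) (auto intro: lf_abs_add_leI)

text \<open>The isosceles property: a perturbation smaller than \<open>y\<close> leaves its absolute
  value unchanged. It keeps denominators and products at constant size in the limit
  arguments.\<close>

lemma lf_abs_dominated:
  assumes "lf_abs (x - y) < lf_abs (y :: 'k::local_field)"
  shows "lf_abs x = lf_abs y"
proof (rule antisym)
  show "lf_abs x \<le> lf_abs y"
    using lf_abs_add_leI[of "x - y" "lf_abs y" y] assms by simp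
  show "lf_abs y \<le> lf_abs x"
    using lf_abs_add_le[of "y - x" x] assms by (auto simp: lf_abs_commute max_def split: if_splits)
qed

lemma in_integers_iff: "x \<in> \<O> \<longleftrightarrow> lf_abs (x :: 'k::local_field) \<le> 1"
proof (cases "x = 0")
  case False
  have "real (card (residue_field :: 'k set set)) powi (- val x) \<le>
          real (card (residue_field :: 'k set set)) powi 0 \<longleftrightarrow> - val x \<le> 0"
    using residue_card_gt_1[where 'k='k]
      by (smt (verit) power_int_increasing power_int_strict_increasing)
  then show ?thesis
    using False by (simp add: integers_def lf_abs_def)
qed (simp add: integers_def)

lemma in_val_ideal_iff: "x \<in> val_ideal \<longleftrightarrow> lf_abs (x :: 'k::local_field) < 1"
proof (cases "x = 0")
  case False
  have "real (card (residue_field :: 'k set set)) powi (- val x) <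
          real (card (residue_field :: 'k set set)) powi 0 \<longleftrightarrow> - val x < 0"
    using residue_card_gt_1[where 'k='k]
    by (smt (verit) power_int_increasing power_int_strict_increasing)
  then show ?thesis
    using False by (simp add: val_ideal_def lf_abs_def)
qed (simp add: val_ideal_def)

lemma zero_in_integers [simp]: "(0::'k::local_field) \<in> \<O>"
  by (simp add: in_integers_iff)

lemma integers_diff: "x \<in> \<O> \<Longrightarrow> y \<in> \<O> \<Longrightarrow> x - y \<in> (\<O> :: 'k::local_field set)"
  by (auto simp: in_integers_iff intro: lf_abs_diff_leI)

lemma integers_mult: "x \<in> \<O> \<Longrightarrow> y \<in> \<O> \<Longrightarrow> x * y \<in> (\<O> :: 'k::local_field set)"
  by (auto simp: in_integers_iff lf_abs_mult intro: mult_le_one)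

lemma integers_power: "x \<in> \<O> \<Longrightarrow> x ^ n \<in> (\<O> :: 'k::local_field set)"
  by (auto simp: in_integers_iff lf_abs_power power_le_one)

lemma integers_sum: "(\<And>i. i \<in> A \<Longrightarrow> f i \<in> \<O>) \<Longrightarrow> sum f A \<in> (\<O> :: 'k::local_field set)"
  by (auto simp: in_integers_iff intro: lf_abs_sum_leI)


subsection \<open>Limits\<close>

text \<open>Membership in the topological classes makes the general limit rules applicable. By the
  ultrametric inequality the radius \<open>e\<close> for both summands also serves the sum.\<close>

instance local_field \<subseteq> topological_ab_group_add
proof
  show "((\<lambda>x. fst x + snd x) \<longlongrightarrow> a + b) (nhds a \<times>\<^sub>F nhds b)" for a b :: "'a::local_field"
    unfolding tendsto_iff eventually_prod_filter
  proof (intro allI impI)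
    fix e :: real assume "0 < e"
    show "\<exists>Pf Pg. eventually Pf (nhds a) \<and> eventually Pg (nhds b) \<and>
        (\<forall>x y. Pf x \<longrightarrow> Pg y \<longrightarrow> dist (fst (x, y) + snd (x, y)) (a + b) < e)"
    proof (intro exI conjI allI impI)
      show "\<forall>\<^sub>F x in nhds a. dist x a < e" "\<forall>\<^sub>F x in nhds b. dist x b < e"
        using \<open>0 < e\<close> by (auto simp: eventually_nhds_metric)
      show "dist (fst (x, y) + snd (x, y)) (a + b) < e" if "dist x a < e" "dist y b < e" for x y
        using that lf_abs_add_le[of "x - a" "y - b"] by (simp add: dist_lf_abs algebra_simps)
    qed
  qed
  show "(uminus \<longlongrightarrow> - a) (nhds a)" for a :: "'a::local_field"
    unfolding tendsto_iff eventually_nhds_metric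
    by (metis dist_lf_abs lf_abs_minus minus_diff_minus)
qed

instance local_field \<subseteq> topological_comm_monoid_mult
proof
  show "((\<lambda>x. fst x * snd x) \<longlongrightarrow> a * b) (nhds a \<times>\<^sub>F nhds b)" for a b :: "'a::local_field"
    unfolding tendsto_iff eventually_prod_filter
  proof (intro allI impI)
    fix e :: real assume e: "0 < e"
    \<comment> \<open>\<open>d \<le> 1\<close> and \<open>d \<le> e\<close> control the term
      \<open>(x - a) * (y - b)\<close>; the denominator makes \<open>d * lf_abs a\<close> and
      \<open>d * lf_abs b\<close> at most \<open>e\<close>, which controls the two mixed
      terms.\<close>
    define d where "d = min 1 (e / (1 + lf_abs a + lf_abs b))"
    have pos: "0 < 1 + lf_abs a + lf_abs b"
      by (simp add: add_pos_nonneg)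
    have d: "0 < d" "d \<le> 1" "d * (1 + lf_abs a + lf_abs b) \<le> e"
      using e pos mult_right_mono[of d "e / (1 + lf_abs a + lf_abs b)" "1 + lf_abs a + lf_abs b"]
      by (auto simp: d_def)
    have d': "d * 1 \<le> e" "d * lf_abs a \<le> e" "d * lf_abs b \<le> e"
      using d(1) mult_left_mono[of 1 "1 + lf_abs a + lf_abs b" d]
        mult_left_mono[of "lf_abs a" "1 + lf_abs a + lf_abs b" d]
        mult_left_mono[of "lf_abs b" "1 + lf_abs a + lf_abs b" d] d(3)
      by (smt (verit) lf_abs_nonneg)+
    show "\<exists>Pf Pg. eventually Pf (nhds a) \<and> eventually Pg (nhds b) \<and>
        (\<forall>x y. Pf x \<longrightarrow> Pg y \<longrightarrow> dist (fst (x, y) * snd (x, y)) (a * b) < e)"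
    proof (intro exI conjI allI impI)
      show "\<forall>\<^sub>F x in nhds a. dist x a < d" "\<forall>\<^sub>F x in nhds b. dist x b < d"
        using \<open>0 < d\<close> by (auto simp: eventually_nhds_metric)
      fix x y assume xy: "dist x a < d" "dist y b < d"
      have *: "x * y - a * b = ((x - a) * (y - b) + a * (y - b)) + b * (x - a)"
        by (simp add: algebra_simps)
      have 1: "lf_abs ((x - a) * (y - b)) < e"
      proof -
        have "lf_abs (x - a) * lf_abs (y - b) \<le> 1 * lf_abs (y - b)"
          using xy d(2) by (intro mult_right_mono) (auto simp: dist_lf_abs)
        then show ?thesis
          using xy d'(1) by (simp add: lf_abs_mult dist_lf_abs)
      qed
      have 2: "lf_abs (c * z) < e" if "d * lf_abs c \<le> e" "lf_abs z < d" for c z :: 'a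
      proof (cases "c = 0")
        case False
        then have "lf_abs z * lf_abs c < d * lf_abs c"
          using that by (intro mult_strict_right_mono) auto
        then show ?thesis
          using that by (simp add: lf_abs_mult mult.commute)
      qed (use e in simp)
      show "dist (fst (x, y) * snd (x, y)) (a * b) < e"
        unfolding dist_lf_abs fst_conv snd_conv *
        using 1 2[OF d'(2), of "y - b"] 2[OF d'(3), of "x - a"] xy
          lf_abs_add_le[of "(x - a) * (y - b) + a * (y - b)" "b * (x - a)"]
          lf_abs_add_le[of "(x - a) * (y - b)" "a * (y - b)"]
        by (auto simp: dist_lf_abs)
    qed
  qed
qed

text \<open>Non-strict bounds are the convenient form: the ultrametric inequality passes them on
  without splitting \<open>e\<close>, and they survive limits.\<close>

lemma tendsto_lf_abs_iff:
  "(f \<longlongrightarrow> (L::'k::local_field)) F \<longleftrightarrow> (\<forall>e>0. \<forall>\<^sub>F x in F. lf_abs (f x - L) \<le> e)"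
  unfolding tendsto_iff dist_lf_abs
proof safe
  fix e :: real assume "\<forall>e>0. \<forall>\<^sub>F x in F. lf_abs (f x - L) \<le> e" "0 < e"
  then have "\<forall>\<^sub>F x in F. lf_abs (f x - L) \<le> e / 2" by (meson half_gt_zero)
  then show "\<forall>\<^sub>F x in F. lf_abs (f x - L) < e"
    by eventually_elim (use \<open>0 < e\<close> in simp)
qed (meson eventually_mono less_imp_le)

lemma tendsto_lf_abs:
  assumes "(f \<longlongrightarrow> (L::'k::local_field)) F"
  shows "((\<lambda>x. lf_abs (f x)) \<longlongrightarrow> lf_abs L) F"
  using tendsto_dist[OF assms tendsto_const[of 0]] by (simp add: dist_lf_abs)

lemma tendsto_lf_inverse:
  assumes f: "(f \<longlongrightarrow> (L::'k::local_field)) F" and "L \<noteq> 0"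
  shows "((\<lambda>x. inverse (f x)) \<longlongrightarrow> inverse L) F"
  unfolding tendsto_lf_abs_iff
proof (intro allI impI)
  fix e :: real assume "0 < e"
  \<comment> \<open>The first bound forces \<open>lf_abs (f x) = lf_abs L\<close>, so the inverses
    differ by \<open>lf_abs (f x - L) / lf_abs L ^ 2\<close> in absolute value; the second makes
    this at most \<open>e\<close>.\<close>
  define d where "d = min (lf_abs L / 2) (e * (lf_abs L)\<^sup>2)"
  have "0 < d"
    using assms \<open>0 < e\<close> by (simp add: d_def)
  then have "\<forall>\<^sub>F x in F. lf_abs (f x - L) \<le> d"
    using f by (simp add: tendsto_lf_abs_iff)
  then show "\<forall>\<^sub>F x in F. lf_abs (inverse (f x) - inverse L) \<le> e"
  proof eventually_elim
    case (elim x)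
    have "lf_abs (f x - L) < lf_abs L"
    proof -
      have "0 < lf_abs L" using assms by simp
      moreover have "d \<le> lf_abs L / 2" by (simp add: d_def)
      ultimately show ?thesis using elim by linarith
    qed
    then have eq: "lf_abs (f x) = lf_abs L"
      by (rule lf_abs_dominated)
    then have "f x \<noteq> 0"
      using assms by (metis lf_abs_eq_0)
    then have "inverse (f x) - inverse L = (L - f x) / (f x * L)"
      using assms by (simp add: field_simps)
    then have "lf_abs (inverse (f x) - inverse L) = lf_abs (f x - L) / (lf_abs L)\<^sup>2"
      by (simp add: lf_abs_divide lf_abs_mult lf_abs_commute eq power2_eq_square)
    also have "\<dots> \<le> e"
      using elim assms lf_abs_pos[of L] by (simp add: d_def field_simps)
    finally show ?case .
  qed
qed

lemma tendsto_lf_divide: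
  "(f \<longlongrightarrow> (a::'k::local_field)) F \<Longrightarrow> (g \<longlongrightarrow> b) F \<Longrightarrow> b \<noteq> 0 \<Longrightarrow> ((\<lambda>x. f x / g x) \<longlongrightarrow> a / b) F"
  unfolding divide_inverse by (intro tendsto_mult tendsto_lf_inverse)

lemma lf_abs_lim_le:
  assumes "(f \<longlongrightarrow> (L::'k::local_field)) F" "F \<noteq> bot" "\<forall>\<^sub>F x in F. lf_abs (f x) \<le> M"
  shows "lf_abs L \<le> M"
  using tendsto_upperbound[OF tendsto_lf_abs[OF assms(1)] assms(3,2)] .

lemma Cauchy_lf_iff:
  "Cauchy (s::nat \<Rightarrow> 'k::local_field) \<longleftrightarrow> (\<forall>e>0. \<exists>M. \<forall>i\<ge>M. \<forall>j\<ge>M. lf_abs (s i - s j) < e)"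
  by (simp add: Cauchy_def dist_lf_abs)

text \<open>Only the ring of integers is assumed complete. From some index on, a Cauchy sequence
  stays within distance 1 of one of its members, hence in a translate of that ring.\<close>

lemma Cauchy_imp_tendsto:
  assumes "Cauchy (s::nat \<Rightarrow> 'k::local_field)"
  obtains l where "s \<longlonglongrightarrow> l"
proof -
  obtain M where M: "\<And>i j. i \<ge> M \<Longrightarrow> j \<ge> M \<Longrightarrow> lf_abs (s i - s j) < 1"
    using assms unfolding Cauchy_lf_iff by (metis zero_less_one)
  have "Cauchy (\<lambda>i. s (i + M) - s M)"
    unfolding Cauchy_lf_iff
  proof (intro allI impI)
    fix e :: real assume "0 < e"
    then obtain M' where "\<And>i j. i \<ge> M' \<Longrightarrow> j \<ge> M' \<Longrightarrow> lf_abs (s i - s j) < e"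
      using assms unfolding Cauchy_lf_iff by metis
    then show "\<exists>M'. \<forall>i\<ge>M'. \<forall>j\<ge>M'. lf_abs (s (i + M) - s M - (s (j + M) - s M)) < e"
      by (intro exI[of _ M']) auto
  qed
  moreover have "\<forall>i. s (i + M) - s M \<in> \<O>"
    using M by (auto simp: in_integers_iff intro!: less_imp_le)
  ultimately obtain l where "(\<lambda>i. s (i + M) - s M) \<longlonglongrightarrow> l"
    using complete_integers unfolding complete_def by (metis (no_types, lifting))
  then have "(\<lambda>i. s (i + M) - s M + s M) \<longlonglongrightarrow> l + s M"
    by (intro tendsto_intros)
  then have "s \<longlonglongrightarrow> l + s M"
    by (simp add: LIMSEQ_offset)
  then show ?thesis by (rule that)
qed


subsection \<open>Difference quotients\<close>

text \<open>The Lagrange form of the divided difference. Its right-hand side depends on the set of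
  nodes alone, which gives the symmetry that the recursion hides.\<close>

lemma Phi_eq_sum:
  assumes "distinct xs" "xs \<noteq> []"
  shows "Phi f xs = (\<Sum>x\<in>set xs. f x / (\<Prod>y\<in>set xs - {x}. x - y))"
  using assms
proof (induction f xs rule: Phi.induct)
  case (3 f x y zs)
  define S where "S = set zs"
  define P where "P u = (\<Prod>v\<in>S - {u}. u - v)" for u
  have S: "finite S" "x \<notin> S" "y \<notin> S" "x \<noteq> y"
    using 3 by (auto simp: S_def)
  have one: "(\<Sum>u\<in>insert w S. f u / (\<Prod>v\<in>insert w S - {u}. u - v)) =
      f w / P w + (\<Sum>u\<in>S. f u / ((u - w) * P u))" if "w \<notin> S" for w
  proof -
    have "(\<Prod>v\<in>insert w S - {u}. u - v) = (u - w) * P u" if "u \<in> S" for u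
    proof -
      have "insert w S - {u} = insert w (S - {u})"
        using that \<open>w \<notin> S\<close> by auto
      then show ?thesis
        using S \<open>w \<notin> S\<close> by (simp add: P_def)
    qed
    then show ?thesis
      using S that by (simp add: P_def)
  qed
  have "(\<Sum>u\<in>insert x (insert y S). f u / (\<Prod>v\<in>insert x (insert y S) - {u}. u - v)) =
      f x / ((x - y) * P x) + (f y / ((y - x) * P y) + (\<Sum>u\<in>S. f u / ((u - x) * ((u - y) * P u))))"
  proof -
    have "(\<Prod>v\<in>insert x (insert y S) - {u}. u - v) = (u - x) * ((u - y) * P u)" if "u \<in> S" for u
    proof -
      have "insert x (insert y S) - {u} = insert x (insert y (S - {u}))"
        using that S by auto
      then show ?thesis
        using S by (simp add: P_def)
    qed
    moreover have "insert x (insert y S) - {x} = insert y S" "insert x (insert y S) - {y} = insert x S"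
      using S by auto
    ultimately show ?thesis
      using S by (simp add: P_def)
  qed
  also have "\<dots> = (f x / P x - f y / P y + (\<Sum>u\<in>S. f u / ((u - x) * P u) - f u / ((u - y) * P u))) / (x - y)"
  proof -
    \<comment> \<open>Partial fractions: \<open>1 / (u - x) - 1 / (u - y)\<close> is
      \<open>x - y\<close> divided by \<open>(u - x) * (u - y)\<close>.\<close>
    have "f u / ((u - x) * ((u - y) * P u)) = (f u / ((u - x) * P u) - f u / ((u - y) * P u)) / (x - y)"
      if "u \<in> S" for u
    proof -
      have "u \<noteq> x" "u \<noteq> y" "P u \<noteq> 0"
        using that S by (auto simp: P_def)
      then show ?thesis
        using S(4) by (simp add: divide_simps) (simp add: algebra_simps)
    qed
    moreover have "P x \<noteq> 0" "P y \<noteq> 0"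
      using S by (auto simp: P_def)
    moreover have "f y / ((y - x) * P y) = - (f y / P y) / (x - y)"
      by (metis minus_diff_eq minus_divide_divide minus_mult_left divide_divide_eq_left' mult.commute)
    ultimately show ?thesis
      by (simp add: add_divide_distrib diff_divide_distrib sum_divide_distrib)
  qed
  also have "\<dots> = (Phi f (x # zs) - Phi f (y # zs)) / (x - y)"
    using "3.IH" 3 one[OF S(2)] one[OF S(3)] by (simp add: S_def[symmetric] sum_subtractf)
  finally show ?case
    by (simp add: S_def)
qed auto

lemma Phi_set_eq:
  assumes "distinct xs" "distinct ys" "set xs = set ys"
  shows "Phi f xs = Phi f ys"
  using assms by (cases "xs = []"; cases "ys = []") (auto simp: Phi_eq_sum)

lemma Phi_cong: "(\<And>x. x \<in> set xs \<Longrightarrow> f x = g x) \<Longrightarrow> Phi f xs = Phi g xs"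
  by (induction f xs rule: Phi.induct) auto

text \<open>The defining recursion keeps the function and splits the list at its front. Peeling off
  the last node changes the function instead and shortens the list, which suits inductions over a
  whole family of functions such as the powers.\<close>

lemma Phi_snoc: "xs \<noteq> [] \<Longrightarrow> Phi f (xs @ [z]) = Phi (\<lambda>x. (f x - f z) / (x - z)) xs"
  by (induction f xs rule: Phi.induct) auto

lemma Phi_add: "Phi (\<lambda>x. f x + g x) xs = Phi f xs + Phi g xs"
  by (induction f xs rule: Phi.induct) (auto simp: algebra_simps add_divide_distrib diff_divide_distrib)

lemma Phi_cmult: "Phi (\<lambda>x. c * f x) xs = c * Phi f xs"
  by (induction f xs rule: Phi.induct) (auto simp: algebra_simps diff_divide_distrib)

lemma Phi_diff: "Phi (\<lambda>x. f x - g x) xs = Phi f xs - Phi g xs"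
  using Phi_add[of f "\<lambda>x. - 1 * g x" xs] Phi_cmult[of "- 1" g xs] by simp

lemma Phi_zero [simp]: "Phi (\<lambda>x. 0) xs = 0"
  using Phi_cmult[of 0 "\<lambda>x. 0" xs] by simp

lemma Phi_sum: "Phi (\<lambda>x. \<Sum>i\<in>A. f i x) xs = (\<Sum>i\<in>A. Phi (f i) xs)"
  by (induction A rule: infinite_finite_induct) (auto simp: Phi_add)

lemma tendsto_Phi:
  "(\<And>x. x \<in> set xs \<Longrightarrow> ((\<lambda>i. F i x) \<longlongrightarrow> f x) G) \<Longrightarrow> ((\<lambda>i. Phi (F i) xs) \<longlongrightarrow> Phi f xs) G"
  by (induction f xs rule: Phi.induct) (auto simp: divide_inverse intro!: tendsto_intros)

text \<open>The difference of two \<open>j\<close>-th powers divided by \<open>x - z\<close> is a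
  geometric sum of lower powers of \<open>x - c\<close> with constant factors, so an induction over
  the nodes can run for all exponents at once.\<close>

lemma Phi_snoc_power:
  assumes "distinct (xs @ [z])" "xs \<noteq> []"
  shows "Phi (\<lambda>x. (x - c) ^ j) (xs @ [z]) =
    (\<Sum>i<j. (z - c) ^ (j - Suc i) * Phi (\<lambda>x. (x - c) ^ i) xs)"
proof -
  have "((x - c) ^ j - (z - c) ^ j) / (x - z) = (\<Sum>i<j. (z - c) ^ (j - Suc i) * (x - c) ^ i)"
    if "x \<in> set xs" for x
  proof -
    have "(x - c) ^ j - (z - c) ^ j = (x - z) * (\<Sum>i<j. (z - c) ^ (j - Suc i) * (x - c) ^ i)"
      using diff_power_eq_sum power_diff_sumr2[of "x - c" j "z - c"] by simp
    moreover have "x \<noteq> z"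
      using that assms by auto
    ultimately show ?thesis by simp
  qed
  then show ?thesis
    using assms(2) by (simp add: Phi_snoc Phi_sum Phi_cmult cong: Phi_cong)
qed

text \<open>The order is \<open>length xs - 1\<close>, so the hypothesis says that it exceeds the
  degree; every node peeled off lowers the degree.\<close>

lemma Phi_power_high:
  "distinct xs \<Longrightarrow> Suc j < length xs \<Longrightarrow> Phi (\<lambda>x. (x - c) ^ j) xs = 0"
proof (induction xs arbitrary: j rule: rev_induct)
  case (snoc z xs)
  then have "xs \<noteq> []" by auto
  moreover have "Phi (\<lambda>x. (x - c) ^ i) xs = 0" if "i < j" for i
    using snoc that by auto
  ultimately show ?case
    unfolding Phi_snoc_power[OF snoc.prems(1) \<open>xs \<noteq> []\<close>] by simp
qed auto

lemma Phi_power_top: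
  "distinct xs \<Longrightarrow> length xs = Suc j \<Longrightarrow> Phi (\<lambda>x. (x - c) ^ j) xs = 1"
proof (induction xs arbitrary: j rule: rev_induct)
  case (snoc z xs)
  show ?case
  proof (cases "xs = []")
    case False
    then obtain j' where j: "j = Suc j'"
      using snoc.prems by (cases j) auto
    have "Phi (\<lambda>x. (x - c) ^ i) xs = 0" if "i < j'" for i
      using snoc.prems that j by (intro Phi_power_high) auto
    then show ?thesis
      unfolding Phi_snoc_power[OF snoc.prems(1) False] using snoc by (simp add: j)
  qed (use snoc in simp)
qed auto

text \<open>The quotient of a power is the complete homogeneous symmetric polynomial of degree
  \<open>Suc j - length xs\<close> in the differences \<open>x - c\<close>. Its coefficients are
  integers, so only the size of its arguments counts.\<close>

lemma Phi_power_le: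
  fixes c :: "'k::local_field"
  shows "distinct xs \<Longrightarrow> xs \<noteq> [] \<Longrightarrow> length xs \<le> Suc j \<Longrightarrow> (\<And>x. x \<in> set xs \<Longrightarrow> lf_abs (x - c) \<le> \<rho>) \<Longrightarrow>
    lf_abs (Phi (\<lambda>x. (x - c) ^ j) xs) \<le> \<rho> ^ (Suc j - length xs)"
proof (induction xs arbitrary: j rule: rev_induct)
  case (snoc z xs)
  have \<rho>: "lf_abs (z - c) \<le> \<rho>" "0 \<le> \<rho>"
    using snoc.prems(4)[of z] lf_abs_nonneg[of "z - c"] by (auto simp del: lf_abs_nonneg)
  show ?case
  proof (cases "xs = []")
    case True
    then show ?thesis
      using \<rho> by (auto simp: lf_abs_power intro: power_mono)
  next
    case False
    have "lf_abs ((z - c) ^ (j - Suc i) * Phi (\<lambda>x. (x - c) ^ i) xs) \<le> \<rho> ^ (Suc j - length (xs @ [z]))"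
      if "i < j" for i
    proof (cases "Suc i < length xs")
      case True
      then show ?thesis
        using snoc.prems \<rho> by (simp add: Phi_power_high)
    next
      case i: False
      have "lf_abs ((z - c) ^ (j - Suc i)) * lf_abs (Phi (\<lambda>x. (x - c) ^ i) xs) \<le>
          \<rho> ^ (j - Suc i) * \<rho> ^ (Suc i - length xs)"
        using snoc.prems False i \<rho>
        by (intro mult_mono snoc.IH) (auto simp: lf_abs_power intro!: power_mono)
      also have "\<dots> = \<rho> ^ (Suc j - length (xs @ [z]))"
        using i that by (simp flip: power_add)
      finally show ?thesis by (simp add: lf_abs_mult)
    qed
    then show ?thesis
      unfolding Phi_snoc_power[OF snoc.prems(1) False] using \<rho> by (intro lf_abs_sum_leI) auto
  qed
qed auto

text \<open>Newton interpolation at the nodes \<open>ys\<close> with exact remainder. When all these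
  nodes tend to one point it becomes Taylor's formula, which is its use in
  \<open>Taylor_le\<close>.\<close>

lemma Phi_Newton:
  "distinct (x # ys) \<Longrightarrow> f x = (\<Sum>l<length ys. Phi f (take (Suc l) ys) * (\<Prod>m<l. x - ys ! m)) +
     Phi f (x # ys) * (\<Prod>m<length ys. x - ys ! m)"
proof (induction ys rule: rev_induct)
  case (snoc z ys)
  have "Phi f (x # ys @ [z]) = Phi f (x # z # ys)" "Phi f (z # ys) = Phi f (ys @ [z])"
    by (rule Phi_set_eq; use snoc.prems in auto)+
  moreover have "x \<noteq> z"
    using snoc.prems by auto
  ultimately have step: "Phi f (x # ys) = Phi f (ys @ [z]) + (x - z) * Phi f (x # ys @ [z])"
    by (simp only: Phi.simps) simp
  have prod: "(\<Prod>m<l. x - (ys @ [z]) ! m) = (\<Prod>m<l. x - ys ! m)" if "l \<le> length ys" for l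
    using that by (intro prod.cong) (auto simp: nth_append)
  have "f x = (\<Sum>l<length ys. Phi f (take (Suc l) ys) * (\<Prod>m<l. x - ys ! m)) +
      Phi f (x # ys) * (\<Prod>m<length ys. x - ys ! m)"
    using snoc by simp
  then show ?case
    unfolding step distrib_right by (simp add: prod)
qed simp

text \<open>The nodes \<open>ys\<close> are replaced by \<open>xs\<close> one at a time. Exchanging
  number \<open>c\<close> costs the factor \<open>xs ! c - ys ! c\<close> and a quotient of the next
  order that contains both of these nodes.\<close>

lemma Phi_telescope:
  "length xs = length ys \<Longrightarrow> distinct (xs @ ys @ zs) \<Longrightarrow> xs \<noteq> [] \<Longrightarrow>
    Phi f (xs @ zs) - Phi f (ys @ zs) =
      (\<Sum>c<length xs. (xs ! c - ys ! c) * Phi f (take (Suc c) xs @ drop c ys @ zs))"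
proof (induction xs ys arbitrary: zs rule: list_induct2)
  case (Cons x xs y ys)
  have "x \<noteq> y" using Cons by auto
  then have 1: "Phi f (x # ys @ zs) - Phi f (y # ys @ zs) = (x - y) * Phi f (x # y # ys @ zs)"
    by simp
  have 2: "Phi f (x # xs @ zs) - Phi f (x # ys @ zs) =
      (\<Sum>c<length xs. (xs ! c - ys ! c) * Phi f (x # take (Suc c) xs @ drop c ys @ zs))"
  proof (cases "xs = []")
    case False
    have "Phi f (x # xs @ zs) = Phi f (xs @ x # zs)" "Phi f (x # ys @ zs) = Phi f (ys @ x # zs)"
      using Cons.prems by (auto intro!: Phi_set_eq)
    moreover have "Phi f (x # take (Suc c) xs @ drop c ys @ zs) = Phi f (take (Suc c) xs @ drop c ys @ x # zs)"
      for c
      using Cons.prems by (auto intro!: Phi_set_eq dest!: in_set_takeD in_set_dropD)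
    moreover have "distinct (xs @ ys @ (x # zs))"
      using Cons.prems by auto
    ultimately show ?thesis
      using Cons.IH[of "x # zs"] False by simp
  qed (use Cons in auto)
  have "Phi f ((x # xs) @ zs) - Phi f ((y # ys) @ zs) =
      (x - y) * Phi f (x # y # ys @ zs) +
      (\<Sum>c<length xs. (xs ! c - ys ! c) * Phi f (x # take (Suc c) xs @ drop c ys @ zs))"
    using 1 2 by (simp add: algebra_simps)
  then show ?case
    by (simp del: sum.lessThan_Suc add: sum.lessThan_Suc_shift)
qed auto


subsection \<open>Limits of difference quotients on the diagonal\<close>

definition uball :: "'k::local_field \<Rightarrow> real \<Rightarrow> 'k set" where
  "uball a d = {x \<in> \<O>. lf_abs (x - a) \<le> d}"

text \<open>Indexed by the order \<open>k\<close> of the quotient, hence the \<open>k + 1\<close>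
  entries; they are distinct because \<open>Phi\<close> divides by their differences.\<close>

definition dlists :: "nat \<Rightarrow> 'k set \<Rightarrow> 'k list set" where
  "dlists k A = {xs. length xs = Suc k \<and> distinct xs \<and> set xs \<subseteq> A}"

text \<open>The point \<open>a\<close> itself is allowed as a node. For \<open>k = 0\<close> and an
  integer \<open>a\<close> this forces \<open>L = f a\<close>, so order 0 means continuity at
  \<open>a\<close> and not merely a limit.\<close>

definition Phi_tendsto :: "nat \<Rightarrow> ('k::local_field \<Rightarrow> 'k) \<Rightarrow> 'k \<Rightarrow> 'k \<Rightarrow> bool" where
  "Phi_tendsto k f a L \<longleftrightarrow> (\<forall>e>0. \<exists>d>0. \<forall>xs\<in>dlists k (uball a d). lf_abs (Phi f xs - L) \<le> e)"

text \<open>The powers of an arbitrary uniformizer provide infinitely many small shifts.\<close>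

definition some_unif :: "'k::local_field" where
  "some_unif = (SOME x. x \<noteq> 0 \<and> val x = 1)"

definition shifts :: "nat \<Rightarrow> nat \<Rightarrow> 'k::local_field list" where
  "shifts N m = map (\<lambda>k. some_unif ^ (N + k)) [0..<m]"

lemma uniformizer_some_unif: "uniformizer some_unif"
  unfolding uniformizer_def some_unif_def by (rule someI_ex) (rule val_surj)

lemma lf_abs_uniformizer:
  "uniformizer p \<Longrightarrow> lf_abs p = inverse (real (card (residue_field :: 'k set set)))"
  for p :: "'k::local_field"
  by (simp add: uniformizer_def lf_abs_def power_int_minus)

lemma lf_abs_uniformizer_bounds:
  "uniformizer p \<Longrightarrow> 0 < lf_abs p \<and> lf_abs p < 1"
  for p :: "'k::local_field"
  using residue_card_gt_1[where 'k='k] by (auto simp: lf_abs_uniformizer uniformizer_def inverse_less_1_iff)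

lemma uniformizer_power_small:
  fixes p :: "'k::local_field"
  assumes "uniformizer p" "0 < e"
  shows "\<exists>N0. \<forall>N\<ge>N0. lf_abs p ^ N \<le> e"
proof -
  obtain N0 where N0: "lf_abs p ^ N0 < e"
    using lf_abs_uniformizer_bounds[OF assms(1)] assms(2) real_arch_pow_inv by blast
  have "lf_abs p ^ N \<le> e" if "N \<ge> N0" for N
    using power_decreasing[OF that, of "lf_abs p"] lf_abs_uniformizer_bounds[OF assms(1)] N0 by linarith
  then show ?thesis by auto
qed

lemma length_shifts [simp]: "length (shifts N m) = m"
  by (simp add: shifts_def)

lemma nth_shifts: "k < m \<Longrightarrow> shifts N m ! k = some_unif ^ (N + k)"
  by (simp add: shifts_def)

text \<open>Initial segments of shift lists are shift lists with the same \<open>N\<close>, so the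
  quotients of lower order in Newton's formula are again taken at shifted copies of one
  point.\<close>

lemma take_shifts: "k \<le> m \<Longrightarrow> take k (shifts N m) = shifts N k"
  by (simp add: shifts_def take_map)

lemma some_unif_power_inj: "(some_unif::'k::local_field) ^ m = some_unif ^ k \<longleftrightarrow> m = k"
proof
  assume "(some_unif::'k) ^ m = some_unif ^ k"
  then have "lf_abs (some_unif::'k) ^ m = lf_abs (some_unif::'k) ^ k"
    by (simp flip: lf_abs_power)
  moreover have "0 < lf_abs (some_unif::'k)" "lf_abs (some_unif::'k) < 1"
    using lf_abs_uniformizer_bounds[OF uniformizer_some_unif] by auto
  ultimately show "m = k"
    by (metis power_inject_exp' less_irrefl)
qed simp

lemma distinct_shifts: "distinct (shifts N m :: 'k::local_field list)"
  by (auto simp: shifts_def distinct_map inj_on_def some_unif_power_inj)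

lemma shifts_small:
  assumes "h \<in> set (shifts N m)"
  shows "h \<noteq> (0::'k::local_field)" "lf_abs h \<le> lf_abs (some_unif::'k) ^ N"
proof -
  have b: "0 < lf_abs (some_unif::'k)" "lf_abs (some_unif::'k) < 1"
    using lf_abs_uniformizer_bounds[OF uniformizer_some_unif] by auto
  obtain k where h: "h = some_unif ^ (N + k)"
    using assms by (auto simp: shifts_def)
  then show "lf_abs h \<le> lf_abs (some_unif::'k) ^ N"
    using b by (auto simp: lf_abs_power intro!: power_decreasing)
  show "h \<noteq> 0"
    using b(1) unfolding h by (metis lf_abs_pos power_eq_0_iff)
qed

lemma uball_mono: "d \<le> d' \<Longrightarrow> uball a d \<subseteq> uball a d'"
  by (auto simp: uball_def)

lemma uball_0_1: "uball 0 1 = \<O>"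
  by (auto simp: uball_def in_integers_iff)

lemma dlists_mono: "A \<subseteq> B \<Longrightarrow> xs \<in> dlists k A \<Longrightarrow> xs \<in> dlists k B"
  by (auto simp: dlists_def)

lemma uball_add:
  "y \<in> uball a d \<Longrightarrow> lf_abs h \<le> d \<Longrightarrow> lf_abs h \<le> 1 \<Longrightarrow> y + h \<in> uball a d"
  using lf_abs_add_leI[of "y - a" d h]
  by (auto simp: uball_def in_integers_iff algebra_simps intro: lf_abs_add_leI)

lemma eventually_shifts:
  assumes "0 < d"
  shows "\<forall>\<^sub>F N in sequentially. \<forall>m. \<forall>h\<in>set (shifts N m). lf_abs (h::'k::local_field) \<le> d"
proof -
  obtain N0 where "\<And>N. N \<ge> N0 \<Longrightarrow> lf_abs (some_unif::'k) ^ N \<le> d"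
    using uniformizer_power_small[OF uniformizer_some_unif assms] by blast
  then show ?thesis
    unfolding eventually_sequentially by (metis order_trans shifts_small(2))
qed

lemma eventually_shifted_dlists:
  fixes y :: "'k::local_field"
  assumes "y \<in> uball a d" "0 < d"
  shows "\<forall>\<^sub>F N in sequentially. \<forall>m. map ((+) y) (shifts N (Suc m)) \<in> dlists m (uball a d)"
proof -
  have "\<forall>\<^sub>F N in sequentially. \<forall>m. \<forall>h\<in>set (shifts N m). lf_abs (h::'k) \<le> min d 1"
    using assms by (intro eventually_shifts) auto
  then show ?thesis
    by eventually_elim
      (use assms in \<open>auto simp: dlists_def distinct_map distinct_shifts intro!: uball_add\<close>)
qed

text \<open>Turns the limit over all node lists into the limit of one sequence, to which uniqueness,
  limit rules and the preservation of bounds apply.\<close>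

lemma Phi_tendsto_shifts:
  assumes "Phi_tendsto j f y L" "y \<in> \<O>"
  shows "(\<lambda>N. Phi f (map ((+) y) (shifts N (Suc j)))) \<longlonglongrightarrow> L"
  unfolding tendsto_lf_abs_iff
proof (intro allI impI)
  fix e :: real assume "0 < e"
  then obtain d where d: "0 < d" "\<And>xs. xs \<in> dlists j (uball y d) \<Longrightarrow> lf_abs (Phi f xs - L) \<le> e"
    using assms unfolding Phi_tendsto_def by metis
  then have "y \<in> uball y d"
    using assms by (simp add: uball_def)
  from eventually_shifted_dlists[OF this d(1)]
  show "\<forall>\<^sub>F N in sequentially. lf_abs (Phi f (map ((+) y) (shifts N (Suc j))) - L) \<le> e"
    by eventually_elim (use d in auto)
qed

lemma Phi_tendsto_unique:
  "Phi_tendsto j f y L \<Longrightarrow> Phi_tendsto j f y L' \<Longrightarrow> y \<in> \<O> \<Longrightarrow> L = L'"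
  using Phi_tendsto_shifts LIMSEQ_unique by blast

lemma Phi_tendsto_bound:
  assumes "Phi_tendsto k f y L" "y \<in> uball a d" "0 < d"
    "\<And>xs. xs \<in> dlists k (uball a d) \<Longrightarrow> lf_abs (Phi f xs) \<le> M"
  shows "lf_abs L \<le> M"
proof (rule lf_abs_lim_le[OF Phi_tendsto_shifts[OF assms(1)]])
  show "y \<in> \<O>" using assms by (auto simp: uball_def)
  show "\<forall>\<^sub>F N in sequentially. lf_abs (Phi f (map ((+) y) (shifts N (Suc k)))) \<le> M"
    using eventually_shifted_dlists[OF assms(2,3)] by eventually_elim (use assms(4) in auto)
qed auto

lemma Phi_tendsto_add:
  assumes "Phi_tendsto k f a L" "Phi_tendsto k g a L'"
  shows "Phi_tendsto k (\<lambda>x. f x + g x) a (L + L')"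
  unfolding Phi_tendsto_def
proof (intro allI impI)
  fix e :: real assume "0 < e"
  then obtain d d' where d: "0 < d" "\<And>xs. xs \<in> dlists k (uball a d) \<Longrightarrow> lf_abs (Phi f xs - L) \<le> e"
    "0 < d'" "\<And>xs. xs \<in> dlists k (uball a d') \<Longrightarrow> lf_abs (Phi g xs - L') \<le> e"
    using assms unfolding Phi_tendsto_def by metis
  have "lf_abs (Phi (\<lambda>x. f x + g x) xs - (L + L')) \<le> e" if "xs \<in> dlists k (uball a (min d d'))" for xs
  proof -
    have "xs \<in> dlists k (uball a d)" "xs \<in> dlists k (uball a d')"
      using that by (auto elim!: dlists_mono[rotated] simp: uball_def)
    then have "lf_abs ((Phi f xs - L) + (Phi g xs - L')) \<le> e"
      using d by (intro lf_abs_add_leI) auto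
    then show ?thesis
      by (simp add: Phi_add algebra_simps)
  qed
  then show "\<exists>d>0. \<forall>xs\<in>dlists k (uball a d). lf_abs (Phi (\<lambda>x. f x + g x) xs - (L + L')) \<le> e"
    using d by (intro exI[of _ "min d d'"]) auto
qed

lemma Phi_tendsto_zero: "Phi_tendsto k (\<lambda>x. 0) a 0"
  by (auto simp: Phi_tendsto_def intro: exI[of _ 1])

lemma Phi_tendsto_cmult:
  assumes "Phi_tendsto k f a L"
  shows "Phi_tendsto k (\<lambda>x. c * f x) a (c * L)"
proof (cases "c = 0")
  case True
  then show ?thesis by (simp add: Phi_tendsto_zero)
next
  case False
  show ?thesis
    unfolding Phi_tendsto_def
  proof (intro allI impI)
    fix e :: real assume "0 < e"
    then have "0 < e / lf_abs c" using False by simp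
    then obtain d where d: "0 < d" "\<And>xs. xs \<in> dlists k (uball a d) \<Longrightarrow> lf_abs (Phi f xs - L) \<le> e / lf_abs c"
      using assms unfolding Phi_tendsto_def by metis
    then show "\<exists>d>0. \<forall>xs\<in>dlists k (uball a d). lf_abs (Phi (\<lambda>x. c * f x) xs - c * L) \<le> e"
      using False unfolding Phi_cmult right_diff_distrib[symmetric] lf_abs_mult
      by (intro exI[of _ d]) (auto simp: field_simps)
  qed
qed

lemma Phi_tendsto_diff:
  assumes "Phi_tendsto k f a L" "Phi_tendsto k g a L'"
  shows "Phi_tendsto k (\<lambda>x. f x - g x) a (L - L')"
  using Phi_tendsto_add[OF assms(1) Phi_tendsto_cmult[OF assms(2), of "- 1"]] by simp

lemma Phi_tendsto_sum:
  "(\<And>i. i \<in> I \<Longrightarrow> Phi_tendsto k (f i) a (L i)) \<Longrightarrow> Phi_tendsto k (\<lambda>x. \<Sum>i\<in>I. f i x) a (\<Sum>i\<in>I. L i)"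
  by (induction I rule: infinite_finite_induct) (auto simp: Phi_tendsto_zero Phi_tendsto_add)

lemma Phi_tendsto_local:
  assumes "Phi_tendsto k f a L" "0 < d" "\<And>x. x \<in> uball a d \<Longrightarrow> f x = g x"
  shows "Phi_tendsto k g a L"
  unfolding Phi_tendsto_def
proof (intro allI impI)
  fix e :: real assume "0 < e"
  then obtain d' where d': "0 < d'" "\<And>xs. xs \<in> dlists k (uball a d') \<Longrightarrow> lf_abs (Phi f xs - L) \<le> e"
    using assms unfolding Phi_tendsto_def by metis
  have "lf_abs (Phi g xs - L) \<le> e" if xs: "xs \<in> dlists k (uball a (min d d'))" for xs
  proof -
    have "xs \<in> dlists k (uball a d)" "xs \<in> dlists k (uball a d')"
      using xs by (auto elim!: dlists_mono[rotated] simp: uball_def)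
    moreover from this have "Phi g xs = Phi f xs"
      using assms(3) by (auto intro!: Phi_cong simp: dlists_def)
    ultimately show ?thesis using d' by auto
  qed
  then show "\<exists>d>0. \<forall>xs\<in>dlists k (uball a d). lf_abs (Phi g xs - L) \<le> e"
    using assms d' by (intro exI[of _ "min d d'"]) auto
qed

lemma Phi_tendsto_centered_power:
  "Phi_tendsto j (\<lambda>x. (x - a) ^ i) a (if i = j then 1 else 0)"
proof (cases "j < i")
  case True
  show ?thesis
    unfolding Phi_tendsto_def
  proof (intro allI impI)
    fix e :: real assume "0 < e"
    have "lf_abs (Phi (\<lambda>x. (x - a) ^ i) xs - (if i = j then 1 else 0)) \<le> e"
      if "xs \<in> dlists j (uball a (min 1 e))" for xs
    proof -
      have "lf_abs (Phi (\<lambda>x. (x - a) ^ i) xs) \<le> (min 1 e) ^ (Suc i - length xs)"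
        using that True by (intro Phi_power_le) (auto simp: dlists_def uball_def)
      also have "\<dots> \<le> (min 1 e) ^ 1"
        using that True \<open>0 < e\<close> by (intro power_decreasing) (auto simp: dlists_def)
      finally show ?thesis using True by auto
    qed
    then show "\<exists>d>0. \<forall>xs\<in>dlists j (uball a d). lf_abs (Phi (\<lambda>x. (x - a) ^ i) xs - (if i = j then 1 else 0)) \<le> e"
      using \<open>0 < e\<close> by (intro exI[of _ "min 1 e"]) auto
  qed
next
  case False
  have "Phi (\<lambda>x. (x - a) ^ i) xs = (if i = j then 1 else 0)" if "xs \<in> dlists j (uball a 1)" for xs
    using that False by (auto simp: dlists_def Phi_power_top Phi_power_high)
  then show ?thesis
    unfolding Phi_tendsto_def by (intro allI impI exI[of _ 1]) auto
qed

text \<open>Expanding \<open>x - c\<close> about \<open>a\<close> leaves only the term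
  \<open>i = j\<close> in the limit; the value is the Hasse derivative of the power.\<close>

lemma Phi_tendsto_power:
  "Phi_tendsto j (\<lambda>x. (x - c) ^ n) a (of_nat (n choose j) * (a - c) ^ (n - j))"
proof -
  have "(x - c) ^ n = (\<Sum>i\<le>n. of_nat (n choose i) * (a - c) ^ (n - i) * (x - a) ^ i)" for x
    using binomial_ring[of "x - a" "a - c" n] by (simp add: mult_ac)
  moreover have "Phi_tendsto j (\<lambda>x. \<Sum>i\<le>n. of_nat (n choose i) * (a - c) ^ (n - i) * (x - a) ^ i) a
      (\<Sum>i\<le>n. of_nat (n choose i) * (a - c) ^ (n - i) * (if i = j then 1 else 0))"
    by (intro Phi_tendsto_sum Phi_tendsto_cmult Phi_tendsto_centered_power)
  moreover have "(\<Sum>i\<le>n. of_nat (n choose i) * (a - c) ^ (n - i) * (if i = j then 1 else 0)) =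
      of_nat (n choose j) * (a - c) ^ (n - j)"
    by (cases "j \<le> n") (auto simp: if_distrib binomial_eq_0 cong: if_cong)
  ultimately show ?thesis by simp
qed


section \<open>Diagonal limits of lower order exist along with those of higher order\<close>

lemma infinite_uball:
  assumes "0 < d" "a \<in> (\<O> :: 'k::local_field set)"
  shows "infinite (uball a d)"
proof
  assume fin: "finite (uball a d)"
  have "a \<in> uball a d"
    using assms by (simp add: uball_def)
  from eventually_shifted_dlists[OF this assms(1)]
  obtain N where "map ((+) a) (shifts N (Suc (card (uball a d)))) \<in> dlists (card (uball a d)) (uball a d)"
    using eventually_happens'[OF sequentially_bot] by blast
  then obtain xs where xs: "distinct xs" "set xs \<subseteq> uball a d" "length xs = Suc (card (uball a d))"
    unfolding dlists_def by blast
  then show False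
    using card_mono[OF fin xs(2)] distinct_card[OF xs(1)] by simp
qed

lemma dlists_avoiding:
  assumes "0 < d" "a \<in> (\<O> :: 'k::local_field set)" "finite S"
  obtains zs where "zs \<in> dlists k (uball a d)" "set zs \<inter> S = {}"
proof -
  have "infinite (uball a d - S)"
    using infinite_uball[OF assms(1,2)] assms(3) by simp
  then obtain B where B: "finite B" "card B = Suc k" "B \<subseteq> uball a d - S"
    by (meson infinite_arbitrarily_large)
  moreover obtain zs where zs: "set zs = B" "distinct zs"
    using finite_distinct_list[OF B(1)] by blast
  ultimately have "zs \<in> dlists k (uball a d)" "set zs \<inter> S = {}"
    using distinct_card[OF zs(2)] by (auto simp: dlists_def)
  then show ?thesis by (rule that)
qed

lemma finite_separation:
  assumes "finite (S :: 'k::local_field set)"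
  obtains r where "0 < r" "\<And>x y. x \<in> S \<Longrightarrow> y \<in> S \<Longrightarrow> x \<noteq> y \<Longrightarrow> r < lf_abs (x - y)"
proof -
  define E where "E = (\<lambda>(x, y). lf_abs (x - y)) ` (S \<times> S - Id)"
  have E: "finite E" "\<And>e. e \<in> E \<Longrightarrow> 0 < e"
    using assms by (auto simp: E_def)
  \<comment> \<open>The inserted 1 covers sets with fewer than two points; halving makes the
    separation strict.\<close>
  define r where "r = Min (insert 1 E) / 2"
  have "0 < r"
    using E by (auto simp: r_def)
  moreover have "r < lf_abs (x - y)" if "x \<in> S" "y \<in> S" "x \<noteq> y" for x y
  proof -
    have "lf_abs (x - y) \<in> insert 1 E"
      using that by (force simp: E_def)
    then have "Min (insert 1 E) \<le> lf_abs (x - y)"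
      using E by (intro Min_le) auto
    then show ?thesis
      using \<open>0 < r\<close> by (simp add: r_def)
  qed
  ultimately show ?thesis by (rule that)
qed

lemma Phi_tendsto_0D:
  assumes "Phi_tendsto 0 f a L" "a \<in> \<O>"
  shows "L = f a"
proof -
  have "lf_abs (f a - L) \<le> e" if e: "0 < e" for e
  proof -
    obtain d where "0 < d" "\<And>xs. xs \<in> dlists 0 (uball a d) \<Longrightarrow> lf_abs (Phi f xs - L) \<le> e"
      using assms(1) e unfolding Phi_tendsto_def by metis
    moreover have "[a] \<in> dlists 0 (uball a d)"
      using assms \<open>0 < d\<close> by (auto simp: dlists_def uball_def)
    ultimately show ?thesis by fastforce
  qed
  then have "lf_abs (f a - L) \<le> 0"
    using field_le_epsilon[of "lf_abs (f a - L)" 0] by simp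
  then show ?thesis
    using lf_abs_nonneg[of "f a - L"] by (simp add: order_antisym)
qed

text \<open>The quotients at shifted copies of \<open>a\<close> form a Cauchy sequence; completeness
  supplies a limit, and the Cauchy condition carries it over to all node lists.\<close>

lemma Phi_tendsto_CauchyI:
  assumes a: "a \<in> \<O>"
    and C: "\<And>e. 0 < e \<Longrightarrow> \<exists>d>0. \<forall>xs\<in>dlists n (uball a d). \<forall>ys\<in>dlists n (uball a d).
      lf_abs (Phi f xs - Phi f ys) \<le> e"
  shows "\<exists>L. Phi_tendsto n f a L"
proof -
  define s where "s N = Phi f (map ((+) a) (shifts N (Suc n)))" for N
  have ev: "\<forall>\<^sub>F N in sequentially. map ((+) a) (shifts N (Suc n)) \<in> dlists n (uball a d)" if "0 < d" for d
    using eventually_shifted_dlists[of a a d] that a by (auto simp: uball_def elim: eventually_mono)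
  have "Cauchy s"
    unfolding Cauchy_lf_iff
  proof (intro allI impI)
    fix e :: real assume "0 < e"
    then obtain d where d: "d > 0" "\<forall>xs\<in>dlists n (uball a d). \<forall>ys\<in>dlists n (uball a d).
      lf_abs (Phi f xs - Phi f ys) \<le> e / 2"
      using C[of "e / 2"] by auto
    obtain M where M: "\<And>N. N \<ge> M \<Longrightarrow> map ((+) a) (shifts N (Suc n)) \<in> dlists n (uball a d)"
      using ev[OF d(1)] unfolding eventually_sequentially by blast
    have "lf_abs (s i - s j) < e" if "i \<ge> M" "j \<ge> M" for i j
    proof -
      have "lf_abs (s i - s j) \<le> e / 2"
        unfolding s_def using d(2) M that by blast
      then show ?thesis using \<open>0 < e\<close> by linarith
    qed
    then show "\<exists>M. \<forall>i\<ge>M. \<forall>j\<ge>M. lf_abs (s i - s j) < e"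
      by blast
  qed
  then obtain L where L: "s \<longlonglongrightarrow> L"
    by (rule Cauchy_imp_tendsto)
  have "Phi_tendsto n f a L"
    unfolding Phi_tendsto_def
  proof (intro allI impI)
    fix e :: real assume "0 < e"
    then obtain d where d: "d > 0" "\<forall>xs\<in>dlists n (uball a d). \<forall>ys\<in>dlists n (uball a d).
      lf_abs (Phi f xs - Phi f ys) \<le> e"
      using C by blast
    have "lf_abs (Phi f xs - L) \<le> e" if "xs \<in> dlists n (uball a d)" for xs
    proof (rule lf_abs_lim_le)
      show "(\<lambda>N. Phi f xs - s N) \<longlonglongrightarrow> Phi f xs - L"
        by (intro tendsto_intros L)
      show "\<forall>\<^sub>F N in sequentially. lf_abs (Phi f xs - s N) \<le> e"
        using ev[OF d(1)] by eventually_elim (use d that in \<open>auto simp: s_def\<close>)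
    qed auto
    then show "\<exists>d>0. \<forall>xs\<in>dlists n (uball a d). lf_abs (Phi f xs - L) \<le> e"
      using d(1) by blast
  qed
  then show ?thesis ..
qed

text \<open>Near \<open>a\<close> the quotients of order \<open>n + 1\<close> are bounded by some
  \<open>M\<close>, so exchanging one node changes a quotient of order \<open>n\<close> by at most
  \<open>M\<close> times the distance of the nodes. On a ball of radius \<open>e / M\<close> this is
  at most \<open>e\<close>, and the ultrametric inequality keeps this bound over all
  exchanges.\<close>

lemma Phi_tendsto_Suc_imp:
  assumes "Phi_tendsto (Suc n) f a L" "a \<in> \<O>"
  shows "\<exists>L. Phi_tendsto n f a L"
proof (rule Phi_tendsto_CauchyI[OF assms(2)])
  fix e :: real assume "0 < e"
  obtain d0 where d0: "0 < d0" "\<And>xs. xs \<in> dlists (Suc n) (uball a d0) \<Longrightarrow> lf_abs (Phi f xs - L) \<le> 1"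
    using assms(1) unfolding Phi_tendsto_def by (metis zero_less_one)
  define M where "M = max 1 (lf_abs L)"
  have M: "0 < M" "\<And>xs. xs \<in> dlists (Suc n) (uball a d0) \<Longrightarrow> lf_abs (Phi f xs) \<le> M"
  proof -
    fix xs assume "xs \<in> dlists (Suc n) (uball a d0)"
    then have "lf_abs (Phi f xs - L) \<le> M" "lf_abs L \<le> M"
      using d0(2)[of xs] by (auto simp: M_def)
    then have "lf_abs ((Phi f xs - L) + L) \<le> M"
      by (rule lf_abs_add_leI)
    then show "lf_abs (Phi f xs) \<le> M" by simp
  qed (simp add: M_def)
  define d where "d = min d0 (e / M)"
  have d: "0 < d" "d \<le> d0" "d * M \<le> e"
    using M(1) d0 \<open>0 < e\<close> by (auto simp: d_def min_def field_simps)
  have disj: "lf_abs (Phi f xs - Phi f ys) \<le> e"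
    if xy: "xs \<in> dlists n (uball a d)" "ys \<in> dlists n (uball a d)" "set xs \<inter> set ys = {}" for xs ys
  proof -
    have len: "length xs = Suc n" "length ys = Suc n" "distinct xs" "distinct ys"
      and sub: "set xs \<subseteq> uball a d" "set ys \<subseteq> uball a d"
      using xy by (auto simp: dlists_def)
    have "Phi f (xs @ []) - Phi f (ys @ []) =
      (\<Sum>c<length xs. (xs ! c - ys ! c) * Phi f (take (Suc c) xs @ drop c ys @ []))"
      using len xy(3) by (intro Phi_telescope) auto
    moreover have "lf_abs ((xs ! c - ys ! c) * Phi f (take (Suc c) xs @ drop c ys @ [])) \<le> e"
      if c: "c < length xs" for c
    proof -
      have "xs ! c \<in> uball a d" "ys ! c \<in> uball a d"
        using c len sub by (metis nth_mem subsetD)+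
      then have 1: "lf_abs (xs ! c - ys ! c) \<le> d"
        using lf_abs_diff_leI[of "xs ! c - a" d "ys ! c - a"] by (auto simp: uball_def)
      have "take (Suc c) xs @ drop c ys \<in> dlists (Suc n) (uball a d0)"
        using len c sub xy(3) uball_mono[OF d(2), of a] set_take_subset[of "Suc c" xs] set_drop_subset[of c ys]
        by (auto simp: dlists_def)
      then have "lf_abs (Phi f (take (Suc c) xs @ drop c ys)) \<le> M"
        by (rule M)
      then have "lf_abs ((xs ! c - ys ! c) * Phi f (take (Suc c) xs @ drop c ys)) \<le> d * M"
        using 1 d(1) by (auto simp: lf_abs_mult intro!: mult_mono)
      then show ?thesis using d(3) by simp
    qed
    ultimately show ?thesis
      using \<open>0 < e\<close> by (auto intro!: lf_abs_sum_leI)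
  qed
  have "lf_abs (Phi f xs - Phi f ys) \<le> e"
    if xy: "xs \<in> dlists n (uball a d)" "ys \<in> dlists n (uball a d)" for xs ys
  proof -
    \<comment> \<open>The telescoping sum mixes nodes of both lists and so needs them disjoint. A
      third list that avoids both reduces the general case to two disjoint pairs.\<close>
    obtain zs where zs: "zs \<in> dlists n (uball a d)" "set zs \<inter> (set xs \<union> set ys) = {}"
      by (rule dlists_avoiding[OF d(1) assms(2), of "set xs \<union> set ys"]) auto
    then have "lf_abs (Phi f xs - Phi f zs) \<le> e" "lf_abs (Phi f zs - Phi f ys) \<le> e"
      using disj xy by blast+
    then show ?thesis by (rule lf_abs_diff_trans)
  qed
  then show "\<exists>d>0. \<forall>xs\<in>dlists n (uball a d). \<forall>ys\<in>dlists n (uball a d). lf_abs (Phi f xs - Phi f ys) \<le> e"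
    using d(1) by blast
qed

lemma Phi_tendsto_le_imp:
  assumes "\<exists>L. Phi_tendsto n f a L" "a \<in> \<O>" "k \<le> n"
  shows "\<exists>L. Phi_tendsto k f a L"
  using assms(3,1) by (induction k rule: inc_induct) (use assms(2) Phi_tendsto_Suc_imp in blast)+

text \<open>
  The double difference quotient of \<open>f (y + h)\<close> in \<open>y\<close> and \<open>h\<close> is a sum of difference quotients
  of \<open>f\<close>; the additional points \<open>zs\<close> carry the induction.
\<close>

lemma Phi_shifted_le:
  fixes f :: "'k::local_field \<Rightarrow> 'k"
  assumes "ys \<noteq> []" "hs \<noteq> []" "distinct ys" "distinct hs" "distinct zs"
    "\<And>y h. y \<in> set ys \<Longrightarrow> h \<in> set hs \<Longrightarrow> y + h \<in> A - set zs" "set zs \<subseteq> A"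
    "\<And>y y' h h'. y \<in> set ys \<Longrightarrow> y' \<in> set ys \<Longrightarrow> h \<in> set hs \<Longrightarrow> h' \<in> set hs \<Longrightarrow> y + h = y' + h' \<Longrightarrow> y = y'"
    "\<And>xs. xs \<in> dlists (length ys + length hs + length zs - 2) A \<Longrightarrow> lf_abs (Phi f xs) \<le> M" "0 \<le> M"
  shows "lf_abs (Phi (\<lambda>y. Phi f (map ((+) y) hs @ zs)) ys) \<le> M"
  using assms
proof (induction ys arbitrary: hs zs rule: rev_induct)
  case (snoc z ys)
  show ?case
  proof (cases "ys = []")
    case True
    have "map ((+) z) hs @ zs \<in> dlists (length hs + length zs - 1) A"
      using snoc.prems True by (cases hs) (auto simp: dlists_def distinct_map)
    then show ?thesis
      using True snoc.prems by simp
  next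
    case False
    \<comment> \<open>The intermediate quotients when the copies of \<open>y\<close> are exchanged
      for those of \<open>z\<close>. Corresponding nodes \<open>y + h\<close> and
      \<open>z + h\<close> all differ by \<open>y - z\<close>, so this factor cancels against the
      denominator.\<close>
    define G where "G c y = Phi f (map ((+) y) (take (Suc c) hs) @ map ((+) z) (drop c hs) @ zs)" for c y
    have quot: "(Phi f (map ((+) y) hs @ zs) - Phi f (map ((+) z) hs @ zs)) / (y - z) = (\<Sum>c<length hs. G c y)"
      if y: "y \<in> set ys" for y
    proof -
      have "y \<noteq> z" using y snoc.prems by auto
      have "map ((+) y) hs ! c - map ((+) z) hs ! c = y - z" if "c < length hs" for c
        using that by simp
      moreover have "distinct (map ((+) y) hs @ map ((+) z) hs @ zs)"
      proof -
        have "y + h \<noteq> z + h'" if "h \<in> set hs" "h' \<in> set hs" for h h'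
          using snoc.prems(8)[of y z h h'] y that \<open>y \<noteq> z\<close> by auto
        moreover have "y + h \<notin> set zs" "z + h \<notin> set zs" if "h \<in> set hs" for h
          using snoc.prems(6)[of _ h] y that by auto
        ultimately show ?thesis
          using snoc.prems by (auto simp: distinct_map)
      qed
      ultimately have "Phi f (map ((+) y) hs @ zs) - Phi f (map ((+) z) hs @ zs) = (\<Sum>c<length hs. (y - z) * G c y)"
        using Phi_telescope[of "map ((+) y) hs" "map ((+) z) hs" zs f] snoc.prems
        by (simp add: G_def take_map drop_map)
      then show ?thesis
        using \<open>y \<noteq> z\<close> by (simp flip: sum_distrib_left)
    qed
    \<comment> \<open>For the remaining \<open>ys\<close> the nodes attached to \<open>z\<close> are
      constants and join \<open>zs\<close>. The total number of nodes, hence the order of the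
      quotients of \<open>f\<close>, stays the same.\<close>
    have "lf_abs (Phi (G c) ys) \<le> M" if c: "c < length hs" for c
      unfolding G_def
    proof (rule snoc.IH)
      show "ys \<noteq> []" "take (Suc c) hs \<noteq> []" "distinct ys" "distinct (take (Suc c) hs)" "0 \<le> M"
        using False snoc.prems by auto
      have sub: "set (take (Suc c) hs) \<subseteq> set hs" "set (drop c hs) \<subseteq> set hs"
        by (auto dest: in_set_takeD in_set_dropD)
      show "distinct (map ((+) z) (drop c hs) @ zs)"
        using snoc.prems(4,5) snoc.prems(6)[of z] sub by (auto simp: distinct_map)
      show "set (map ((+) z) (drop c hs) @ zs) \<subseteq> A"
        using snoc.prems(6)[of z] snoc.prems(7) sub by auto
      show "y + h \<in> A - set (map ((+) z) (drop c hs) @ zs)" if "y \<in> set ys" "h \<in> set (take (Suc c) hs)" for y h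
      proof -
        have "y \<noteq> z" using that snoc.prems by auto
        then have "y + h \<noteq> z + h'" if "h' \<in> set hs" for h'
          using snoc.prems(8)[of y z h h'] that \<open>y \<in> set ys\<close> \<open>h \<in> _\<close> sub by auto
        then show ?thesis
          using snoc.prems(6)[of y h] that sub by auto
      qed
      show "y = y'" if "y \<in> set ys" "y' \<in> set ys" "h \<in> set (take (Suc c) hs)" "h' \<in> set (take (Suc c) hs)"
        "y + h = y' + h'" for y y' h h'
        using snoc.prems(8)[of y y' h h'] that sub by auto
      show "lf_abs (Phi f xs) \<le> M"
        if "xs \<in> dlists (length ys + length (take (Suc c) hs) + length (map ((+) z) (drop c hs) @ zs) - 2) A" for xs
        using that snoc.prems(9)[of xs] c by (cases ys) (auto simp: algebra_simps)
    qed
    then show ?thesis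
      unfolding Phi_snoc[OF False] using quot snoc.prems(10)
      by (auto simp: Phi_sum cong: Phi_cong intro!: lf_abs_sum_leI)
  qed
qed simp

text \<open>\<open>D y\<close> is the limit of quotients at shifted copies of \<open>y\<close>, and
  \<open>Phi_shifted_le\<close> bounds the quotients of these approximations by \<open>M\<close> for
  all large \<open>N\<close>.\<close>

lemma Phi_derivative_le:
  fixes f :: "'k::local_field \<Rightarrow> 'k"
  assumes "0 < d" "\<And>y. y \<in> uball a d \<Longrightarrow> Phi_tendsto j f y (D y)"
    and M: "\<And>xs. xs \<in> dlists (i + j) (uball a d) \<Longrightarrow> lf_abs (Phi f xs) \<le> M" "0 \<le> M"
    and ys: "ys \<in> dlists i (uball a d)"
  shows "lf_abs (Phi D ys) \<le> M"
proof (rule lf_abs_lim_le)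
  show "(\<lambda>N. Phi (\<lambda>y. Phi f (map ((+) y) (shifts N (Suc j)))) ys) \<longlonglongrightarrow> Phi D ys"
    using assms(2) ys by (intro tendsto_Phi Phi_tendsto_shifts) (auto simp: dlists_def uball_def)
  \<comment> \<open>Shifts no larger than the separation of the nodes cannot make copies of two
    different nodes collide.\<close>
  obtain r where r: "0 < r" "\<And>x y. x \<in> set ys \<Longrightarrow> y \<in> set ys \<Longrightarrow> x \<noteq> y \<Longrightarrow> r < lf_abs (x - y)"
    by (rule finite_separation[of "set ys"]) auto
  have "\<forall>\<^sub>F N in sequentially. \<forall>m. \<forall>h\<in>set (shifts N m). lf_abs (h::'k) \<le> min r (min d 1)"
    using assms r by (intro eventually_shifts) auto
  then show "\<forall>\<^sub>F N in sequentially. lf_abs (Phi (\<lambda>y. Phi f (map ((+) y) (shifts N (Suc j)))) ys) \<le> M"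
  proof eventually_elim
    case (elim N)
    have "lf_abs (Phi (\<lambda>y. Phi f (map ((+) y) (shifts N (Suc j)) @ [])) ys) \<le> M"
    proof (rule Phi_shifted_le)
      show "ys \<noteq> []" "distinct ys" "distinct (shifts N (Suc j) :: 'k list)" "shifts N (Suc j) \<noteq> []"
        using ys by (auto simp: dlists_def distinct_shifts simp flip: length_0_conv)
      show "y + h \<in> uball a d - set []" if "y \<in> set ys" "h \<in> set (shifts N (Suc j))" for y h
        using that ys elim by (auto simp: dlists_def intro!: uball_add)
      show "y = y'" if "y \<in> set ys" "y' \<in> set ys" "h \<in> set (shifts N (Suc j))" "h' \<in> set (shifts N (Suc j))"
        "y + h = y' + h'" for y y' h h'
      proof (rule ccontr)
        assume "y \<noteq> y'"
        then have "r < lf_abs (y - y')" using r that by blast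
        moreover have "y - y' = h' - h" using that(5) by (simp add: algebra_simps)
        moreover have "lf_abs (h' - h) \<le> r"
          using elim that by (intro lf_abs_diff_leI) auto
        ultimately show False by simp
      qed
      show "lf_abs (Phi f xs) \<le> M"
        if "xs \<in> dlists (length ys + length (shifts N (Suc j) :: 'k list) + length [] - 2) (uball a d)" for xs
        using M that ys by (auto simp: dlists_def)
    qed (use M in auto)
    then show ?case by simp
  qed
qed auto

text \<open>With \<open>L (x - a)^(i + j)\<close> subtracted, the assumption becomes the bound
  \<open>e\<close> that \<open>Phi_derivative_le\<close> takes. The \<open>j\<close>-th derivative
  of this power is \<open>((i + j) choose j) (y - a)^i\<close>, whose quotient of order
  \<open>i\<close> is the binomial coefficient.\<close>

lemma Phi_tendsto_derivative:
  fixes f :: "'k::local_field \<Rightarrow> 'k"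
  assumes "\<And>y. y \<in> \<O> \<Longrightarrow> Phi_tendsto j f y (D y)" "Phi_tendsto (i + j) f a L"
  shows "Phi_tendsto i D a (of_nat ((i + j) choose j) * L)"
  unfolding Phi_tendsto_def
proof (intro allI impI)
  fix e :: real assume e: "0 < e"
  then obtain d where d: "d > 0" "\<And>xs. xs \<in> dlists (i + j) (uball a d) \<Longrightarrow> lf_abs (Phi f xs - L) \<le> e"
    using assms(2) unfolding Phi_tendsto_def by metis
  define g where "g x = f x - L * (x - a) ^ (i + j)" for x
  define D' where "D' y = D y - L * (of_nat ((i + j) choose j) * (y - a) ^ i)" for y
  have "lf_abs (Phi D ys - of_nat ((i + j) choose j) * L) \<le> e" if ys: "ys \<in> dlists i (uball a d)" for ys
  proof -
    have "lf_abs (Phi D' ys) \<le> e"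
    proof (rule Phi_derivative_le[OF d(1) _ _ _ ys])
      show "Phi_tendsto j g y (D' y)" if "y \<in> uball a d" for y
        using that unfolding g_def D'_def
        by (intro Phi_tendsto_diff Phi_tendsto_cmult assms(1)
            Phi_tendsto_power[of j a "i + j" y, simplified]) (auto simp: uball_def)
      show "lf_abs (Phi g xs) \<le> e" if "xs \<in> dlists (i + j) (uball a d)" for xs
        using d(2)[OF that] that unfolding g_def
        by (simp add: Phi_diff Phi_cmult Phi_power_top dlists_def)
    qed (use e in auto)
    also have "Phi D' ys = Phi D ys - of_nat ((i + j) choose j) * L"
      using ys unfolding D'_def by (simp add: Phi_diff Phi_cmult Phi_power_top dlists_def)
    finally show ?thesis .
  qed
  then show "\<exists>d>0. \<forall>ys\<in>dlists i (uball a d). lf_abs (Phi D ys - of_nat ((i + j) choose j) * L) \<le> e"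
    using d(1) by blast
qed

text \<open>Newton's formula with \<open>k\<close> shifted copies of \<open>y\<close> as nodes. As
  the shifts tend to zero the lower quotients tend to the \<open>D l\<close>, and the remainder
  stays below \<open>M\<close> times the product of the distances to \<open>x\<close>.\<close>

lemma Taylor_le:
  fixes f :: "'k::local_field \<Rightarrow> 'k"
  assumes "0 < d" and xy: "x \<in> uball a d" "y \<in> uball a d"
    and D: "\<And>l. l < k \<Longrightarrow> Phi_tendsto l f y (D l)"
    and M: "\<And>xs. xs \<in> dlists k (uball a d) \<Longrightarrow> lf_abs (Phi f xs) \<le> M" "0 \<le> M"
  shows "lf_abs (f x - (\<Sum>l<k. (x - y) ^ l * D l)) \<le> M * lf_abs (x - y) ^ k"
proof (cases "x = y")
  case True
  have yO: "y \<in> \<O>" using xy by (auto simp: uball_def)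
  \<comment> \<open>Newton's formula needs \<open>x\<close> apart from the other nodes. For
    \<open>x = y\<close> the bound is \<open>M\<close> itself if \<open>k = 0\<close>; otherwise the
    sum reduces to \<open>D 0 = f y\<close> and the left side vanishes.\<close>
  show ?thesis
  proof (cases k)
    case 0
    have "[x] \<in> dlists 0 (uball a d)" using xy by (auto simp: dlists_def)
    then show ?thesis using M 0 by fastforce
  next
    case (Suc k')
    have "D 0 = f y" using D[of 0] Suc yO Phi_tendsto_0D by auto
    moreover have "(\<Sum>l<k. 0 ^ l * D l) = (\<Sum>l<k. if l = 0 then D 0 else 0)"
      by (intro sum.cong) auto
    ultimately show ?thesis using True Suc M by simp
  qed
next
  case False
  define ys where "ys N = map ((+) y) (shifts N k)" for N
  define P where "P N l = (\<Prod>m<l. x - (y + some_unif ^ (N + m)))" for N l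
  have yO: "y \<in> \<O>" using xy by (auto simp: uball_def)
  define R where "R N = f x - (\<Sum>l<k. P N l * Phi f (map ((+) y) (shifts N (Suc l))))" for N
  have unif0: "(\<lambda>N. some_unif ^ (N + m) :: 'k) \<longlonglongrightarrow> 0" for m
    unfolding tendsto_lf_abs_iff
  proof (intro allI impI)
    fix e :: real assume "0 < e"
    from eventually_shifts[OF this, where 'k = 'k]
    show "\<forall>\<^sub>F N in sequentially. lf_abs (some_unif ^ (N + m) - 0 :: 'k) \<le> e"
    proof eventually_elim
      case (elim N)
      have "some_unif ^ (N + m) \<in> set (shifts N (Suc m) :: 'k list)"
        by (simp add: shifts_def)
      then show ?case
        using elim by (metis diff_zero)
    qed
  qed
  have P: "(\<lambda>N. P N l) \<longlonglongrightarrow> (x - y) ^ l" for l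
  proof -
    have "(\<lambda>N. P N l) \<longlonglongrightarrow> (\<Prod>m<l. x - (y + 0))"
      unfolding P_def by (intro tendsto_intros unif0)
    then show ?thesis by simp
  qed
  show ?thesis
  proof (rule lf_abs_lim_le)
    show "R \<longlonglongrightarrow> f x - (\<Sum>l<k. (x - y) ^ l * D l)"
      unfolding R_def by (intro tendsto_intros P Phi_tendsto_shifts D yO) auto
    have "\<forall>\<^sub>F N in sequentially. \<forall>m. \<forall>h\<in>set (shifts N m). lf_abs (h::'k) \<le> min (lf_abs (x - y) / 2) (min d 1)"
      using assms(1) False by (intro eventually_shifts) auto
    then show "\<forall>\<^sub>F N in sequentially. lf_abs (R N) \<le> M * lf_abs (x - y) ^ k"
    proof eventually_elim
      case (elim N)
      \<comment> \<open>Shifts below \<open>lf_abs (x - y)\<close> keep \<open>x\<close> off the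
        other nodes and leave every factor \<open>x - (y + h)\<close> at absolute value
        \<open>lf_abs (x - y)\<close>; the other two bounds keep the nodes in the ball.\<close>
      have small: "lf_abs h < lf_abs (x - y)" "lf_abs h \<le> d" "lf_abs h \<le> 1"
        if "h \<in> set (shifts N k)" for h :: 'k
      proof -
        have "lf_abs h \<le> min (lf_abs (x - y) / 2) (min d 1)" "0 < lf_abs (x - y)"
          using elim that False by auto
        then show "lf_abs h < lf_abs (x - y)" "lf_abs h \<le> d" "lf_abs h \<le> 1" by linarith+
      qed
      have "y + h \<in> uball a d" "x \<noteq> y + h" if "h \<in> set (shifts N k)" for h
        using small[OF that] xy by (auto intro!: uball_add)
      then have dl: "x # ys N \<in> dlists k (uball a d)"
        using xy by (auto simp: dlists_def ys_def distinct_map distinct_shifts)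
      have prodP: "(\<Prod>m<l. x - ys N ! m) = P N l" if "l \<le> k" for l
        using that unfolding P_def ys_def by (intro prod.cong) (auto simp: nth_shifts)
      have "take (Suc l) (ys N) = map ((+) y) (shifts N (Suc l))" if "l < k" for l
        using that by (simp add: ys_def take_map take_shifts)
      then have "R N = Phi f (x # ys N) * P N k"
        using Phi_Newton[of x "ys N" f] dl by (simp add: R_def prodP dlists_def mult.commute)
      moreover have "lf_abs (P N k) = lf_abs (x - y) ^ k"
      proof -
        have "lf_abs (x - (y + some_unif ^ (N + m))) = lf_abs (x - y)" if "m < k" for m
        proof (rule lf_abs_dominated)
          have "some_unif ^ (N + m) \<in> set (shifts N k :: 'k list)"
            using that by (auto simp: shifts_def)
          from small(1)[OF this] show "lf_abs (x - (y + some_unif ^ (N + m)) - (x - y)) < lf_abs (x - y)"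
            by simp
        qed
        then have "lf_abs (P N l) = lf_abs (x - y) ^ l" if "l \<le> k" for l
          using that by (induction l) (auto simp: P_def lf_abs_mult)
        then show ?thesis by simp
      qed
      ultimately show ?case
        using M(1)[OF dl] by (simp add: lf_abs_mult mult_right_mono)
    qed
  qed auto
qed


subsection \<open>The spaces of functions of class \<open>C\<^sup>n\<close>\<close>

abbreviation tuple_topology :: "nat \<Rightarrow> (nat \<Rightarrow> 'k::local_field) topology" where
  "tuple_topology n \<equiv> product_topology (\<lambda>_. top_of_set \<O>) {..n}"

lemma topspace_tuple: "topspace (tuple_topology n) = (\<Pi>\<^sub>E i\<in>{..n}. \<O>)"
  by (simp add: topspace_product_topology)

text \<open>In an ultrametric space every point of a ball is a centre of it, so even balls given by
  a non-strict inequality are open.\<close>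

lemma openin_uball: "0 < d \<Longrightarrow> openin (top_of_set \<O>) (uball a d)"
  unfolding openin_contains_ball
proof safe
  fix y assume "0 < d" "y \<in> uball a d"
  moreover have "x \<in> uball a d" if "x \<in> ball y d" "x \<in> \<O>" for x
    using that lf_abs_diff_trans[of x y d a] \<open>y \<in> uball a d\<close>
    by (auto simp: uball_def dist_lf_abs lf_abs_commute)
  ultimately show "\<exists>e>0. ball y e \<inter> \<O> \<subseteq> uball a d" by blast
qed (auto simp: uball_def)

lemma openin_tuple_box: "0 < d \<Longrightarrow> openin (tuple_topology n) (\<Pi>\<^sub>E i\<in>{..n}. uball (p i) d)"
  by (auto simp: openin_PiE_gen openin_uball)

lemma openin_tuple_contains_box:
  assumes "openin (tuple_topology n) T" "p \<in> T"
  obtains d where "0 < d" "(\<Pi>\<^sub>E i\<in>{..n}. uball (p i) d) \<subseteq> T"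
proof -
  obtain U where U: "\<And>i. i \<le> n \<Longrightarrow> openin (top_of_set \<O>) (U i)" "p \<in> Pi\<^sub>E {..n} U" "Pi\<^sub>E {..n} U \<subseteq> T"
    using bspec[OF iffD1[OF openin_product_topology_alt assms(1)] assms(2)] by (metis atMost_iff)
  have "\<exists>d>0. uball (p i) d \<subseteq> U i" if i: "i \<le> n" for i
  proof -
    obtain e where e: "0 < e" "ball (p i) e \<inter> \<O> \<subseteq> U i"
      using U(1)[OF i] PiE_mem[OF U(2), of i] i unfolding openin_contains_ball by auto
    then have "uball (p i) (e / 2) \<subseteq> U i"
      by (auto simp: uball_def dist_lf_abs lf_abs_commute)
    then show ?thesis using e by (intro exI[of _ "e / 2"]) auto
  qed
  then obtain D where D: "\<And>i. i \<le> n \<Longrightarrow> 0 < D i \<and> uball (p i) (D i) \<subseteq> U i"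
    by metis
  define d where "d = Min (D ` {..n})"
  have "0 < d" using D by (auto simp: d_def)
  moreover have "uball (p i) d \<subseteq> U i" if "i \<le> n" for i
  proof -
    have "d \<le> D i" using that by (auto simp: d_def)
    then show ?thesis using uball_mono D[OF that] by blast
  qed
  then have "(\<Pi>\<^sub>E i\<in>{..n}. uball (p i) d) \<subseteq> T"
    using U(3) PiE_mono[of "{..n}" "\<lambda>i. uball (p i) d" U] by fastforce
  ultimately show ?thesis by (rule that)
qed

lemma eventually_tuple_close:
  assumes "0 < d"
  shows "\<forall>\<^sub>F x in atin_within (tuple_topology n) p S. x \<in> S \<and> x \<in> (\<Pi>\<^sub>E i\<in>{..n}. \<O>) \<and> (\<forall>i\<le>n. x i \<in> uball (p i) d)"
  unfolding eventually_atin_within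
proof (cases "p \<in> topspace (tuple_topology n)")
  case True
  have "openin (tuple_topology n) (\<Pi>\<^sub>E i\<in>{..n}. uball (p i) d)"
    by (rule openin_tuple_box[OF assms])
  moreover have "p \<in> (\<Pi>\<^sub>E i\<in>{..n}. uball (p i) d)"
    using assms True by (auto simp: topspace_tuple PiE_iff uball_def)
  moreover have "x \<in> (\<Pi>\<^sub>E i\<in>{..n}. \<O>)" "\<forall>i\<le>n. x i \<in> uball (p i) d"
    if "x \<in> (\<Pi>\<^sub>E i\<in>{..n}. uball (p i) d)" for x
    using that by (auto simp: PiE_iff uball_def)
  ultimately show "p \<notin> topspace (tuple_topology n) \<or> (\<exists>T. openin (tuple_topology n) T \<and> p \<in> T \<and>
      (\<forall>x\<in>T. x \<in> S \<and> x \<noteq> p \<longrightarrow> x \<in> S \<and> x \<in> (\<Pi>\<^sub>E i\<in>{..n}. \<O>) \<and> (\<forall>i\<le>n. x i \<in> uball (p i) d)))"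
    by blast
qed auto

text \<open>Each coordinate is moved by a different small power of a uniformizer. Different
  coordinates stay apart because the powers are below their separation, and equal ones come apart
  because the powers are distinct.\<close>

lemma nabla_dense: "(\<Pi>\<^sub>E i\<in>{..n}. \<O>) \<subseteq> tuple_topology n closure_of (nabla n :: (nat \<Rightarrow> 'k::local_field) set)"
proof
  fix p :: "nat \<Rightarrow> 'k" assume p: "p \<in> (\<Pi>\<^sub>E i\<in>{..n}. \<O>)"
  have "\<exists>y. y \<in> nabla n \<and> y \<in> T" if T: "p \<in> T" "openin (tuple_topology n) T" for T
  proof -
    obtain d where d: "0 < d" "(\<Pi>\<^sub>E i\<in>{..n}. uball (p i) d) \<subseteq> T"
      using openin_tuple_contains_box[OF T(2,1)] .
    obtain r where r: "0 < r" "\<And>x y. x \<in> p ` {..n} \<Longrightarrow> y \<in> p ` {..n} \<Longrightarrow> x \<noteq> y \<Longrightarrow> r < lf_abs (x - y)"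
      by (rule finite_separation[of "p ` {..n}"]) auto
    have "\<forall>\<^sub>F N in sequentially. \<forall>m. \<forall>h\<in>set (shifts N m). lf_abs (h::'k) \<le> min r (min d 1)"
      using d r by (intro eventually_shifts) auto
    then obtain N where N: "\<And>m h. h \<in> set (shifts N m) \<Longrightarrow> lf_abs (h::'k) \<le> min r (min d 1)"
      using eventually_happens'[OF sequentially_bot] by blast
    have small: "lf_abs (some_unif ^ (N + i) :: 'k) \<le> r" "lf_abs (some_unif ^ (N + i) :: 'k) \<le> d"
      "lf_abs (some_unif ^ (N + i) :: 'k) \<le> 1" for i
    proof -
      have "(some_unif ^ (N + i) :: 'k) \<in> set (shifts N (Suc i))" by (simp add: shifts_def)
      from N[OF this] show "lf_abs (some_unif ^ (N + i) :: 'k) \<le> r" "lf_abs (some_unif ^ (N + i) :: 'k) \<le> d"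
        "lf_abs (some_unif ^ (N + i) :: 'k) \<le> 1" by auto
    qed
    define y where "y = (\<lambda>i\<in>{..n}. p i + some_unif ^ (N + i))"
    have "y i \<in> uball (p i) d" if "i \<le> n" for i
    proof -
      have "p i \<in> uball (p i) d"
        using p d that by (auto simp: uball_def PiE_iff)
      from uball_add[OF this small(2,3)] show ?thesis
        using that by (simp add: y_def)
    qed
    then have yT: "y \<in> (\<Pi>\<^sub>E i\<in>{..n}. uball (p i) d)"
      by (auto simp: y_def)
    moreover have "inj_on y {..n}"
    proof (rule inj_onI, rule ccontr)
      fix i j assume ij: "i \<in> {..n}" "j \<in> {..n}" "y i = y j" "i \<noteq> j"
      have eq: "p i - p j = some_unif ^ (N + j) - some_unif ^ (N + i)"
        using ij by (simp add: y_def algebra_simps)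
      then have "lf_abs (p i - p j) \<le> r"
        using small by (auto intro: lf_abs_diff_leI)
      then have "p i = p j"
        using r(2)[of "p i" "p j"] ij by fastforce
      then show False
        using eq ij by (auto simp: some_unif_power_inj)
    qed
    moreover have "y \<in> (\<Pi>\<^sub>E i\<in>{..n}. \<O>)"
      using yT by (auto simp: PiE_iff uball_def)
    ultimately show ?thesis
      using d by (auto simp: nabla_def)
  qed
  then show "p \<in> tuple_topology n closure_of nabla n"
    unfolding in_closure_of using p by (auto simp: topspace_tuple)
qed

lemma Phi_extension_imp_tendsto:
  assumes "Phi_extension n f g" "a \<in> \<O>"
  shows "Phi_tendsto n f a (g (\<lambda>i\<in>{..n}. a))"
  unfolding Phi_tendsto_def
proof (intro allI impI)
  fix e :: real assume "0 < e"
  define c where "c = (\<lambda>i\<in>{..n}. a)"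
  have g: "continuous_map (tuple_topology n) euclidean g"
    "\<And>x. x \<in> nabla n \<Longrightarrow> g x = Phi f (map x [0..<Suc n])"
    using assms(1) by (auto simp: Phi_extension_def)
  have "openin (tuple_topology n) {x \<in> topspace (tuple_topology n). g x \<in> ball (g c) e}"
    by (rule openin_continuous_map_preimage[OF g(1)]) auto
  moreover have "c \<in> {x \<in> topspace (tuple_topology n). g x \<in> ball (g c) e}"
    using assms(2) \<open>0 < e\<close> by (auto simp: topspace_tuple c_def)
  ultimately obtain d where d: "0 < d"
    "(\<Pi>\<^sub>E i\<in>{..n}. uball (c i) d) \<subseteq> {x \<in> topspace (tuple_topology n). g x \<in> ball (g c) e}"
    by (rule openin_tuple_contains_box)
  have "lf_abs (Phi f xs - g c) \<le> e" if xs: "xs \<in> dlists n (uball a d)" for xs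
  proof -
    define x where "x = (\<lambda>i\<in>{..n}. xs ! i)"
    have len: "length xs = Suc n" "distinct xs" "set xs \<subseteq> uball a d"
      using xs by (auto simp: dlists_def)
    have "xs ! i \<in> uball a d" if "i \<le> n" for i
      using len that by (metis le_imp_less_Suc nth_mem subsetD)
    then have x: "x \<in> (\<Pi>\<^sub>E i\<in>{..n}. uball (c i) d)" "x \<in> (\<Pi>\<^sub>E i\<in>{..n}. \<O>)"
      by (auto simp: x_def c_def uball_def)
    have eq: "map x [0..<Suc n] = xs"
      using len by (intro nth_equalityI) (auto simp: x_def simp del: upt_Suc)
    have "inj_on x {..n}"
      using len by (auto simp: inj_on_def x_def nth_eq_iff_index_eq)
    then have "g x = Phi f xs"
      using g(2)[of x] x eq by (auto simp: nabla_def)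
    moreover have "g x \<in> ball (g c) e"
      using d x by auto
    ultimately show ?thesis
      by (auto simp: dist_lf_abs lf_abs_commute)
  qed
  then show "\<exists>d>0. \<forall>xs\<in>dlists n (uball a d). lf_abs (Phi f xs - g (\<lambda>i\<in>{..n}. a)) \<le> e"
    using d(1) by (auto simp: c_def)
qed

text \<open>Induction on the number of nodes. If two selected coordinates of \<open>p\<close>
  differ, the recursion at these two divides by a quantity with nonzero limit; if all agree, the
  quotient has a diagonal limit of order at most \<open>n\<close>. The second conclusion is
  continuity at tuples with distinct entries, which the first does not give because the limit leaves
  out \<open>p\<close>.\<close>

lemma Phi_limit_at_tuple:
  fixes f :: "'k::local_field \<Rightarrow> 'k"
  assumes C: "\<And>a. a \<in> \<O> \<Longrightarrow> \<exists>L. Phi_tendsto n f a L" and p: "p \<in> (\<Pi>\<^sub>E i\<in>{..n}. \<O>)"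
    and "is \<noteq> []" "distinct is" "set is \<subseteq> {..n}"
  shows "\<exists>L. ((\<lambda>x. Phi f (map x is)) \<longlongrightarrow> L) (atin_within (tuple_topology n) p (nabla n)) \<and>
    (distinct (map p is) \<longrightarrow> L = Phi f (map p is))"
  using assms(3-)
proof (induction "length is" arbitrary: "is" rule: less_induct)
  case less
  define F where "F = atin_within (tuple_topology n) p (nabla n)"
  have ev: "\<forall>\<^sub>F x in F. x \<in> nabla n \<and> x \<in> (\<Pi>\<^sub>E i\<in>{..n}. \<O>) \<and> (\<forall>i\<le>n. x i \<in> uball (p i) d)" if "0 < d" for d
    unfolding F_def using eventually_tuple_close[OF that] .
  show ?case
  proof (cases "\<exists>i\<in>set is. \<exists>j\<in>set is. p i \<noteq> p j")
    case True
    then obtain i j where ij: "i \<in> set is" "j \<in> set is" "p i \<noteq> p j" by blast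
    \<comment> \<open>By symmetry the two nodes with different limits may be placed in front, where
      the recursion splits them.\<close>
    define rest where "rest = remove1 i (remove1 j is)"
    have rest: "set rest = set is - {i, j}" "distinct rest"
      using less.prems by (auto simp: rest_def)
    have ijr: "set (i # j # rest) = set is" "distinct (i # j # rest)"
      using ij rest by auto
    have leng: "length is = Suc (Suc (length rest))"
      using distinct_card[OF ijr(2)] distinct_card[OF less.prems(2)] ijr(1) by simp
    have sub: "set (i # rest) \<subseteq> {..n}" "set (j # rest) \<subseteq> {..n}" "i \<le> n" "j \<le> n"
      using ijr less.prems by auto
    obtain L1 where L1: "((\<lambda>x. Phi f (map x (i # rest))) \<longlongrightarrow> L1) F"
      "distinct (map p (i # rest)) \<Longrightarrow> L1 = Phi f (map p (i # rest))"
      using less.hyps[of "i # rest"] leng ijr sub unfolding F_def by auto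
    obtain L2 where L2: "((\<lambda>x. Phi f (map x (j # rest))) \<longlongrightarrow> L2) F"
      "distinct (map p (j # rest)) \<Longrightarrow> L2 = Phi f (map p (j # rest))"
      using less.hyps[of "j # rest"] leng ijr sub unfolding F_def by auto
    have proj: "((\<lambda>x. x k) \<longlongrightarrow> p k) F" if "k \<le> n" for k
      unfolding tendsto_lf_abs_iff
    proof (intro allI impI)
      fix e :: real assume "0 < e"
      from ev[OF this] show "\<forall>\<^sub>F x in F. lf_abs (x k - p k) \<le> e"
        by eventually_elim (use that in \<open>auto simp: uball_def\<close>)
    qed
    have quot: "((\<lambda>x. (Phi f (map x (i # rest)) - Phi f (map x (j # rest))) / (x i - x j)) \<longlongrightarrow>
        (L1 - L2) / (p i - p j)) F"
      using ij(3) sub by (intro tendsto_lf_divide tendsto_diff L1 L2 proj) auto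
    have eq: "Phi f (map x is) = (Phi f (map x (i # rest)) - Phi f (map x (j # rest))) / (x i - x j)"
      if x: "inj_on x {..n}" for x
    proof -
      have "inj_on x (set is)" "inj_on x (set (i # j # rest))"
        using x less.prems(3) ijr by (auto intro: inj_on_subset)
      then have "Phi f (map x is) = Phi f (map x (i # j # rest))"
        using ijr less.prems by (intro Phi_set_eq) (simp_all only: distinct_map set_map)
      then show ?thesis by simp
    qed
    have "\<forall>\<^sub>F x in F. inj_on x {..n}"
      using ev[OF zero_less_one] by eventually_elim (auto simp: nabla_def)
    then have "\<forall>\<^sub>F x in F. (Phi f (map x (i # rest)) - Phi f (map x (j # rest))) / (x i - x j) = Phi f (map x is)"
      by eventually_elim (rule eq[symmetric])
    from Lim_transform_eventually[OF quot this]
    have lim: "((\<lambda>x. Phi f (map x is)) \<longlongrightarrow> (L1 - L2) / (p i - p j)) F" .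
    have "(L1 - L2) / (p i - p j) = Phi f (map p is)" if "distinct (map p is)"
    proof -
      have inj: "inj_on p (set (i # j # rest))"
        using that ijr by (simp only: distinct_map)
      then have d: "distinct (map p (i # j # rest))"
        using ijr(2) by (simp only: distinct_map)
      have "Phi f (map p is) = Phi f (map p (i # j # rest))"
        using that d ijr(1) by (intro Phi_set_eq) (simp_all only: set_map)
      moreover have "L1 = Phi f (map p (i # rest))" "L2 = Phi f (map p (j # rest))"
        using d L1(2) L2(2) by auto
      ultimately show ?thesis by simp
    qed
    with lim show ?thesis unfolding F_def by blast
  next
    case False
    then obtain a where a: "\<And>i. i \<in> set is \<Longrightarrow> p i = a" by blast
    obtain k where k: "length is = Suc k"
      using less.prems by (cases "is") auto
    have "length is \<le> Suc n"
      using distinct_card[OF less.prems(2)] card_mono[OF _ less.prems(3)] by simp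
    moreover have "a \<in> \<O>"
    proof -
      have "hd is \<in> {..n}" "p (hd is) = a"
        using less.prems a hd_in_set[of "is"] by blast+
      then show ?thesis using p by (auto simp: PiE_iff)
    qed
    ultimately obtain L where L: "Phi_tendsto k f a L"
      using Phi_tendsto_le_imp[OF C, of a k] k by auto
    have "((\<lambda>x. Phi f (map x is)) \<longlongrightarrow> L) F"
      unfolding tendsto_lf_abs_iff
    proof (intro allI impI)
      fix e :: real assume "0 < e"
      then obtain d where d: "0 < d" "\<And>xs. xs \<in> dlists k (uball a d) \<Longrightarrow> lf_abs (Phi f xs - L) \<le> e"
        using L unfolding Phi_tendsto_def by metis
      from ev[OF d(1)] show "\<forall>\<^sub>F x in F. lf_abs (Phi f (map x is) - L) \<le> e"
      proof eventually_elim
        case (elim x)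
        have "inj_on x (set is)"
          using elim less.prems(3) by (auto simp: nabla_def intro: inj_on_subset)
        then have "map x is \<in> dlists k (uball a d)"
          using k less.prems elim a by (auto simp: dlists_def distinct_map)
        then show ?case by (rule d)
      qed
    qed
    moreover have "L = Phi f (map p is)" if "distinct (map p is)"
    proof -
      obtain i is' where i: "is = i # is'" using less.prems by (cases "is") auto
      \<comment> \<open>All selected coordinates equal \<open>a\<close>, so distinct images leave a
        single node and the order is 0.\<close>
      have "is' = []"
        using that a unfolding i by (cases is') auto
      then show ?thesis
        using L k i a Phi_tendsto_0D[of f a L] \<open>a \<in> \<O>\<close> by auto
    qed
    ultimately show ?thesis unfolding F_def by blast
  qed
qed

text \<open>Limits at all tuples suffice for a continuous extension, since the tuples with distinct
  entries are dense and the target is a regular space.\<close>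

lemma Phi_extension_exists:
  fixes f :: "'k::local_field \<Rightarrow> 'k"
  assumes C: "\<And>a. a \<in> \<O> \<Longrightarrow> \<exists>L. Phi_tendsto n f a L"
  shows "\<exists>g. Phi_extension n f g"
proof -
  define \<phi> where "\<phi> x = Phi f (map x [0..<Suc n])" for x
  have *: "\<exists>L. (\<phi> \<longlongrightarrow> L) (atin_within (tuple_topology n) p (nabla n)) \<and> (p \<in> nabla n \<longrightarrow> L = \<phi> p)"
    if p: "p \<in> (\<Pi>\<^sub>E i\<in>{..n}. \<O>)" for p
  proof -
    have *: "[0..<Suc n] \<noteq> []" "distinct [0..<Suc n]" "set [0..<Suc n] \<subseteq> {..n}"
      by auto
    have "distinct (map p [0..<Suc n])" if "p \<in> nabla n"
    proof -
      have "set [0..<Suc n] = {..n}" by auto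
      then show ?thesis
        using that by (simp only: nabla_def distinct_map) auto
    qed
    then show ?thesis
      using Phi_limit_at_tuple[OF C p *] unfolding \<phi>_def by blast
  qed
  have sub: "nabla n \<subseteq> (\<Pi>\<^sub>E i\<in>{..n}. \<O>)" by (auto simp: nabla_def)
  obtain g where g: "continuous_map (subtopology (tuple_topology n) (\<Pi>\<^sub>E i\<in>{..n}. \<O>)) euclidean g"
    "\<And>x. x \<in> nabla n \<Longrightarrow> g x = \<phi> x"
  proof (rule continuous_map_extension_pointwise_alt)
    show "regular_space (euclidean :: 'k topology)"
      by (rule regular_space_euclidean)
    show "nabla n \<subseteq> (\<Pi>\<^sub>E i\<in>{..n}. \<O>)" by (rule sub)
    show "(\<Pi>\<^sub>E i\<in>{..n}. \<O>) \<subseteq> tuple_topology n closure_of (nabla n :: (nat \<Rightarrow> 'k) set)"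
      by (rule nabla_dense)
    show "continuous_map (subtopology (tuple_topology n) (nabla n)) euclidean \<phi>"
      unfolding continuous_map_atin
    proof
      fix x :: "nat \<Rightarrow> 'k" assume "x \<in> topspace (subtopology (tuple_topology n) (nabla n))"
      then have "x \<in> nabla n" by auto
      then show "limitin euclidean \<phi> (\<phi> x) (atin (subtopology (tuple_topology n) (nabla n)) x)"
        using *[of x] sub by (auto simp: atin_subtopology_within)
    qed
    show "\<exists>l. limitin euclidean \<phi> l (atin_within (tuple_topology n) t (nabla n))"
      if "t \<in> (\<Pi>\<^sub>E i\<in>{..n}. \<O>) - nabla n" for t
      using *[of t] that by auto
  qed auto
  have "subtopology (tuple_topology n) (\<Pi>\<^sub>E i\<in>{..n}. \<O> :: 'k set) = tuple_topology n"
    by (metis subtopology_topspace topspace_tuple)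
  then show ?thesis
    using g unfolding Phi_extension_def \<phi>_def by metis
qed

text \<open>Trades the product topology for diagonal limits at single points, which add, scale and
  pass to lower orders directly.\<close>

lemma Cspace_iff:
  "f \<in> Cspace n \<longleftrightarrow> (\<forall>x. x \<notin> \<O> \<longrightarrow> f x = 0) \<and> (\<forall>a\<in>\<O>. \<exists>L. Phi_tendsto n f a L)"
proof
  assume "f \<in> Cspace n"
  then obtain g where "\<forall>x. x \<notin> \<O> \<longrightarrow> f x = 0" "Phi_extension n f g"
    by (auto simp: Cspace_def)
  then show "(\<forall>x. x \<notin> \<O> \<longrightarrow> f x = 0) \<and> (\<forall>a\<in>\<O>. \<exists>L. Phi_tendsto n f a L)"
    by (meson Phi_extension_imp_tendsto)
next
  assume f: "(\<forall>x. x \<notin> \<O> \<longrightarrow> f x = 0) \<and> (\<forall>a\<in>\<O>. \<exists>L. Phi_tendsto n f a L)"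
  then have "\<exists>g. Phi_extension n f g"
    by (intro Phi_extension_exists) simp
  with f show "f \<in> Cspace n"
    by (simp add: Cspace_def)
qed

lemma CspaceI:
  "(\<And>x. x \<notin> \<O> \<Longrightarrow> f x = 0) \<Longrightarrow> (\<And>a. a \<in> \<O> \<Longrightarrow> \<exists>L. Phi_tendsto n f a L) \<Longrightarrow> f \<in> Cspace n"
  unfolding Cspace_iff by simp

lemma CspaceD: "f \<in> Cspace n \<Longrightarrow> a \<in> \<O> \<Longrightarrow> \<exists>L. Phi_tendsto n f a L"
  unfolding Cspace_iff by simp

lemma Cspace_outside: "f \<in> Cspace n \<Longrightarrow> x \<notin> \<O> \<Longrightarrow> f x = 0"
  unfolding Cspace_iff by simp

lemma Cspace_mono: "k \<le> n \<Longrightarrow> Cspace n \<subseteq> Cspace k"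
  by (intro subsetI CspaceI, simp add: Cspace_outside) (rule Phi_tendsto_le_imp[OF CspaceD])

lemma Phi_tendsto_Dq:
  assumes "f \<in> Cspace n" "a \<in> \<O>" "j \<le> n"
  shows "Phi_tendsto j f a (Dq j f a)"
proof -
  have "f \<in> Cspace j"
    using Cspace_mono[OF assms(3)] assms(1) by blast
  then have "\<exists>g. Phi_extension j f g"
    by (simp add: Cspace_def)
  then have "Phi_extension j f (SOME g. Phi_extension j f g)"
    by (rule someI_ex)
  from Phi_extension_imp_tendsto[OF this assms(2)] show ?thesis
    using assms(2) by (simp add: Dq_def)
qed

lemma Dq_eqI:
  assumes "f \<in> Cspace n" "a \<in> \<O>" "j \<le> n" "Phi_tendsto j f a L"
  shows "Dq j f a = L"
  by (rule Phi_tendsto_unique[OF Phi_tendsto_Dq[OF assms(1-3)] assms(4,2)])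

lemma Dq_outside: "x \<notin> \<O> \<Longrightarrow> Dq j f x = 0"
  by (simp add: Dq_def)

lemma Dq_0: "f \<in> Cspace n \<Longrightarrow> Dq 0 f = f"
proof
  fix x assume f: "f \<in> Cspace n"
  show "Dq 0 f x = f x"
  proof (cases "x \<in> \<O>")
    case True
    from Phi_tendsto_0D[OF Phi_tendsto_Dq[OF f this] this] show ?thesis by simp
  next
    case False
    then show ?thesis using f by (simp add: Dq_outside Cspace_iff)
  qed
qed

lemma Phi_tendsto_Dq_Dq:
  assumes "f \<in> Cspace n" "i + j \<le> n" "a \<in> \<O>"
  shows "Phi_tendsto i (Dq j f) a (of_nat ((i + j) choose j) * Dq (i + j) f a)"
proof (rule Phi_tendsto_derivative)
  show "Phi_tendsto j f y (Dq j f y)" if "y \<in> \<O>" for y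
    by (rule Phi_tendsto_Dq[OF assms(1) that]) (use assms in simp)
  show "Phi_tendsto (i + j) f a (Dq (i + j) f a)"
    by (rule Phi_tendsto_Dq[OF assms(1,3,2)])
qed

lemma Dq_in_Cspace: "f \<in> Cspace n \<Longrightarrow> j \<le> n \<Longrightarrow> Dq j f \<in> Cspace (n - j)"
  unfolding Cspace_iff[of "Dq j f"] using Phi_tendsto_Dq_Dq[of f n "n - j" j] by (simp add: Dq_outside) blast

lemma Dq_Dq:
  assumes "f \<in> Cspace n" "i + j \<le> n" "a \<in> \<O>"
  shows "Dq i (Dq j f) a = of_nat ((i + j) choose j) * Dq (i + j) f a"
proof (rule Dq_eqI)
  show "Dq j f \<in> Cspace (n - j)" "i \<le> n - j"
    using assms by (auto intro: Dq_in_Cspace)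
qed (use assms in \<open>simp_all add: Phi_tendsto_Dq_Dq\<close>)

lemma Cspace_zero: "(\<lambda>x. 0) \<in> Cspace n"
  unfolding Cspace_iff using Phi_tendsto_zero by blast

lemma Cspace_add:
  assumes "f \<in> Cspace n" "g \<in> Cspace n"
  shows "(\<lambda>x. f x + g x) \<in> Cspace n"
proof (rule CspaceI)
  fix a :: 'a assume "a \<in> \<O>"
  then obtain L L' where "Phi_tendsto n f a L" "Phi_tendsto n g a L'"
    using assms CspaceD by blast
  from Phi_tendsto_add[OF this] show "\<exists>L. Phi_tendsto n (\<lambda>x. f x + g x) a L" ..
qed (use assms in \<open>simp add: Cspace_outside\<close>)

lemma Cspace_cmult:
  assumes "f \<in> Cspace n"
  shows "(\<lambda>x. c * f x) \<in> Cspace n"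
proof (rule CspaceI)
  fix a :: 'a assume "a \<in> \<O>"
  then obtain L where "Phi_tendsto n f a L"
    using assms CspaceD by blast
  from Phi_tendsto_cmult[OF this] show "\<exists>L. Phi_tendsto n (\<lambda>x. c * f x) a L" ..
qed (use assms in \<open>simp add: Cspace_outside\<close>)

lemma Cspace_diff:
  assumes "f \<in> Cspace n" "g \<in> Cspace n"
  shows "(\<lambda>x. f x - g x) \<in> Cspace n"
proof (rule CspaceI)
  fix a :: 'a assume "a \<in> \<O>"
  then obtain L L' where "Phi_tendsto n f a L" "Phi_tendsto n g a L'"
    using assms CspaceD by blast
  from Phi_tendsto_diff[OF this] show "\<exists>L. Phi_tendsto n (\<lambda>x. f x - g x) a L" ..
qed (use assms in \<open>simp add: Cspace_outside\<close>)

lemma Cspace_sum: "(\<And>i. i \<in> I \<Longrightarrow> f i \<in> Cspace n) \<Longrightarrow> (\<lambda>x. \<Sum>i\<in>I. f i x) \<in> Cspace n"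
  by (induction I rule: infinite_finite_induct) (auto simp: Cspace_zero Cspace_add)

lemma Dq_diff:
  assumes "f \<in> Cspace n" "g \<in> Cspace n" "j \<le> n" "a \<in> \<O>"
  shows "Dq j (\<lambda>x. f x - g x) a = Dq j f a - Dq j g a"
  by (rule Dq_eqI[OF Cspace_diff[OF assms(1,2)] assms(4,3)],
      rule Phi_tendsto_diff[OF Phi_tendsto_Dq[OF assms(1,4,3)] Phi_tendsto_Dq[OF assms(2,4,3)]])


subsection \<open>Finite expansions\<close>

text \<open>The value group is generated by \<open>lf_abs p\<close>, so nothing lies strictly
  between consecutive powers and a strict bound improves by a whole factor.\<close>

lemma lf_abs_discrete:
  fixes p x :: "'k::local_field"
  assumes "uniformizer p" "lf_abs x < lf_abs p ^ m"
  shows "lf_abs x \<le> lf_abs p ^ Suc m"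
proof -
  have *: "lf_abs y \<le> lf_abs p" if "lf_abs y < 1" for y :: 'k
  proof (cases "y = 0")
    case False
    then have "0 < val y"
      using that by (auto simp flip: in_val_ideal_iff simp: val_ideal_def)
    then have "real (card (residue_field :: 'k set set)) powi (- val y) \<le>
        real (card (residue_field :: 'k set set)) powi (- 1)"
      using residue_card_gt_1[where 'k='k] by (intro power_int_increasing) auto
    then show ?thesis
      using False assms(1) by (simp add: lf_abs_def uniformizer_def)
  qed simp
  have p: "0 < lf_abs p" using lf_abs_uniformizer_bounds[OF assms(1)] by simp
  have "lf_abs (x / p ^ m) < 1"
    using assms(2) p by (simp add: lf_abs_divide lf_abs_power)
  then have "lf_abs (x / p ^ m) \<le> lf_abs p" by (rule *)
  then show ?thesis
    using p by (simp add: lf_abs_divide lf_abs_power field_simps)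
qed

lemma digits_0: "digits \<pi> T 0 = {0}"
  by (auto simp: digits_def)

lemma digits_Suc: "digits \<pi> T (Suc m) = {s + t * \<pi> ^ m | s t. s \<in> digits \<pi> T m \<and> t \<in> T}"
proof (intro equalityI subsetI)
  fix r assume "r \<in> digits \<pi> T (Suc m)"
  then obtain a where a: "\<And>i. i < Suc m \<Longrightarrow> a i \<in> T" "r = (\<Sum>i<m. a i * \<pi> ^ i) + a m * \<pi> ^ m"
    by (auto simp: digits_def)
  moreover have "(\<Sum>i<m. a i * \<pi> ^ i) \<in> digits \<pi> T m"
    using a by (auto simp: digits_def)
  ultimately show "r \<in> {s + t * \<pi> ^ m | s t. s \<in> digits \<pi> T m \<and> t \<in> T}"
    by blast
next
  fix r assume "r \<in> {s + t * \<pi> ^ m | s t. s \<in> digits \<pi> T m \<and> t \<in> T}"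
  then obtain a t where a: "\<And>i. i < m \<Longrightarrow> a i \<in> T" "t \<in> T" "r = (\<Sum>i<m. a i * \<pi> ^ i) + t * \<pi> ^ m"
    by (auto simp: digits_def)
  define b where "b = a(m := t)"
  have "r = (\<Sum>i<Suc m. b i * \<pi> ^ i)" "\<forall>i<Suc m. b i \<in> T"
    using a by (auto simp: b_def less_Suc_eq)
  then show "r \<in> digits \<pi> T (Suc m)"
    by (auto simp: digits_def)
qed

locale wavelet_setup =
  fixes \<pi> :: "'k::local_field" and T :: "'k set"
  assumes unif: "uniformizer \<pi>" and reps: "residue_reps T"
begin

abbreviation "\<rho> \<equiv> lf_abs \<pi>"
abbreviation "\<R> \<equiv> fin_exp \<pi> T"
abbreviation "\<R>p \<equiv> fin_exp_plus \<pi> T"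
abbreviation "dig \<equiv> digits \<pi> T"
abbreviation "lg \<equiv> len \<pi> T"
abbreviation "pr \<equiv> pred \<pi> T"
abbreviation "\<gamma> \<equiv> gam \<pi> T"
abbreviation "wav \<equiv> wavelet \<pi> T"
abbreviation "Cnrm \<equiv> Cnorm \<pi> T"
abbreviation "atp a \<equiv> at a within \<R>p"

text \<open>The set of which \<open>chi\<close> is the indicator function. For \<open>r = 0\<close>
  it is all of \<open>\<O>\<close>.\<close>

definition cell :: "'k \<Rightarrow> 'k set" where
  "cell r = uball r (\<rho> ^ lg r)"

text \<open>The part of \<open>x\<close> made of its first \<open>m\<close> digits; for an integer
  \<open>x\<close> the choice is unique by \<open>digits_unique\<close>.\<close>

definition trunc :: "nat \<Rightarrow> 'k \<Rightarrow> 'k" where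
  "trunc m x = (SOME r. r \<in> dig m \<and> lf_abs (x - r) \<le> \<rho> ^ m)"

lemma rho: "0 < \<rho>" "\<rho> < 1" "\<rho> \<le> 1" "0 \<le> \<rho>"
  using lf_abs_uniformizer_bounds[OF unif] by auto

lemma pi_in_integers [simp]: "\<pi> \<in> \<O>"
  by (simp add: in_integers_iff rho)

lemma rho_mono: "m \<le> k \<Longrightarrow> \<rho> ^ k \<le> \<rho> ^ m"
  using rho by (intro power_decreasing) auto

lemma residue_card_powi: "real (card (residue_field :: 'k set set)) powi (- int m) = \<rho> ^ m"
  by (simp add: lf_abs_uniformizer[OF unif] power_int_minus power_inverse)

lemma T_integers: "t \<in> T \<Longrightarrow> t \<in> \<O>"
  using reps by (auto simp: residue_reps_def)

lemma zero_in_T: "0 \<in> T"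
  using reps by (auto simp: residue_reps_def)

lemma T_exists: "x \<in> \<O> \<Longrightarrow> \<exists>t\<in>T. lf_abs (x - t) < 1"
  using reps unfolding residue_reps_def in_val_ideal_iff by blast

lemma T_unique: "t \<in> T \<Longrightarrow> t' \<in> T \<Longrightarrow> lf_abs (t - t') < 1 \<Longrightarrow> t = t'"
  using reps T_integers unfolding residue_reps_def in_val_ideal_iff
  by (metis diff_self lf_abs_0 zero_less_one)

lemma T_abs: "t \<in> T \<Longrightarrow> t \<noteq> 0 \<Longrightarrow> lf_abs t = 1"
  using T_unique[OF _ zero_in_T, of t] T_integers[of t] by (force simp: in_integers_iff)

lemma finite_T: "finite T"
proof (rule inj_on_finite)
  define E where "E = {(x, y). x \<in> \<O> \<and> y \<in> \<O> \<and> x - y \<in> (val_ideal :: 'k set)}"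
  show "inj_on (\<lambda>t. E `` {t}) T"
  proof (rule inj_onI)
    fix t t' assume t: "t \<in> T" "t' \<in> T" "E `` {t} = E `` {t'}"
    have "t \<in> E `` {t}"
      using T_integers[OF t(1)] by (simp add: E_def val_ideal_def)
    then have "t \<in> E `` {t'}"
      using t(3) by (rule subst[rotated])
    then have "t' - t \<in> val_ideal"
      by (simp add: E_def)
    then show "t = t'"
      using T_unique[OF t(2,1)] by (simp add: in_val_ideal_iff)
  qed
  show "(\<lambda>t. E `` {t}) ` T \<subseteq> residue_field"
    unfolding residue_field_def E_def by (intro image_subsetI quotientI T_integers)
qed (rule finite_residue_field)

lemma finite_digits: "finite (dig m)"
proof (induction m)
  case (Suc m)
  have "dig (Suc m) = (\<lambda>(s, t). s + t * \<pi> ^ m) ` (dig m \<times> T)"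
    by (auto simp: digits_Suc)
  then show ?case using Suc finite_T by simp
qed (simp add: digits_0)

lemma digits_subset_Suc: "dig m \<subseteq> dig (Suc m)"
proof
  fix s assume "s \<in> dig m"
  then show "s \<in> dig (Suc m)"
    unfolding digits_Suc using zero_in_T by force
qed

lemma digits_mono: "m \<le> k \<Longrightarrow> dig m \<subseteq> dig k"
  by (rule lift_Suc_mono_le[of dig, OF digits_subset_Suc])

lemma digits_integers: "r \<in> dig m \<Longrightarrow> r \<in> \<O>"
  unfolding digits_def by (fastforce intro: integers_sum integers_mult integers_power T_integers pi_in_integers)

lemma digit_diff_abs_le:
  assumes "t \<in> T" "u \<in> T"
  shows "lf_abs ((t - u) * \<pi> ^ m) \<le> \<rho> ^ m"
proof -
  have "lf_abs (t - u) \<le> 1"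
    using integers_diff[OF T_integers[OF assms(1)] T_integers[OF assms(2)]] by (simp add: in_integers_iff)
  then have "lf_abs (t - u) * \<rho> ^ m \<le> 1 * \<rho> ^ m"
    using rho by (intro mult_right_mono) auto
  then show ?thesis by (simp add: lf_abs_mult lf_abs_power)
qed

text \<open>Induction on the number of digits: all digits but the last agree by the weaker bound,
  after which the last digits differ by less than 1 and represent the same residue class.\<close>

lemma digits_unique: "r \<in> dig m \<Longrightarrow> s \<in> dig m \<Longrightarrow> lf_abs (r - s) \<le> \<rho> ^ m \<Longrightarrow> r = s"
proof (induction m arbitrary: r s)
  case (Suc m)
  obtain r' t where r: "r = r' + t * \<pi> ^ m" "r' \<in> dig m" "t \<in> T"
    using Suc.prems(1) by (auto simp: digits_Suc)
  obtain s' u where s: "s = s' + u * \<pi> ^ m" "s' \<in> dig m" "u \<in> T"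
    using Suc.prems(2) by (auto simp: digits_Suc)
  have "lf_abs ((t - u) * \<pi> ^ m) \<le> \<rho> ^ m"
    using r s by (intro digit_diff_abs_le)
  moreover have "lf_abs (r - s) \<le> \<rho> ^ m"
    using Suc.prems(3) rho_mono[of m "Suc m"] by linarith
  ultimately have "lf_abs ((r - s) - (t - u) * \<pi> ^ m) \<le> \<rho> ^ m"
    using lf_abs_diff_leI by blast
  then have "r' = s'"
    using Suc.IH[of r' s'] r s by (simp add: algebra_simps)
  then have "lf_abs ((t - u) * \<pi> ^ m) \<le> \<rho> * \<rho> ^ m"
    using Suc.prems(3) r s by (simp add: algebra_simps)
  then have "lf_abs (t - u) \<le> \<rho>"
    using rho by (simp add: lf_abs_mult lf_abs_power)
  then have "t = u"
    using T_unique[OF r(3) s(3)] rho by linarith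
  with \<open>r' = s'\<close> show ?case using r s by simp
qed (auto simp: digits_0)

text \<open>The next digit represents the residue class of \<open>(x - s) / \<pi> ^ m\<close>. This
  yields a strict bound by \<open>\<rho> ^ m\<close>, which discreteness of the valuation turns into
  \<open>\<rho> ^ Suc m\<close>.\<close>

lemma digits_exist: "x \<in> \<O> \<Longrightarrow> \<exists>r\<in>dig m. lf_abs (x - r) \<le> \<rho> ^ m"
proof (induction m)
  case (Suc m)
  then obtain s where s: "s \<in> dig m" "lf_abs (x - s) \<le> \<rho> ^ m" by blast
  then have "(x - s) / \<pi> ^ m \<in> \<O>"
    using rho by (simp add: in_integers_iff lf_abs_divide lf_abs_power)
  then obtain t where t: "t \<in> T" "lf_abs ((x - s) / \<pi> ^ m - t) < 1"
    using T_exists by blast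
  have "(x - s) / \<pi> ^ m - t = (x - (s + t * \<pi> ^ m)) / \<pi> ^ m"
    using rho by (simp add: field_simps)
  then have "lf_abs (x - (s + t * \<pi> ^ m)) < \<rho> ^ m"
    using t rho by (simp add: lf_abs_divide lf_abs_power)
  then have "lf_abs (x - (s + t * \<pi> ^ m)) \<le> \<rho> ^ Suc m"
    by (rule lf_abs_discrete[OF unif])
  moreover have "s + t * \<pi> ^ m \<in> dig (Suc m)"
    using s t by (auto simp: digits_Suc)
  ultimately show ?case by blast
qed (auto simp: digits_0 in_integers_iff)

lemma trunc:
  assumes "x \<in> \<O>"
  shows "trunc m x \<in> dig m" "lf_abs (x - trunc m x) \<le> \<rho> ^ m"
  using someI_ex[of "\<lambda>r. r \<in> dig m \<and> lf_abs (x - r) \<le> \<rho> ^ m"] digits_exist[OF assms, of m]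
  unfolding trunc_def by auto

lemma trunc_unique:
  assumes "x \<in> \<O>" "r \<in> dig m" "lf_abs (x - r) \<le> \<rho> ^ m"
  shows "trunc m x = r"
  using digits_unique[OF trunc(1)[OF assms(1)] assms(2)] trunc(2)[OF assms(1), of m] assms(3)
  by (metis lf_abs_commute lf_abs_diff_trans)

lemma zero_in_digits: "0 \<in> dig m"
  using digits_mono[of 0 m] by (simp add: digits_0)

lemma fin_exp_iff: "r \<in> \<R> \<longleftrightarrow> (\<exists>m. r \<in> dig m)"
  by (simp add: fin_exp_def)

lemma fin_exp_plus_iff: "r \<in> \<R>p \<longleftrightarrow> r \<in> \<R> \<and> r \<noteq> 0"
proof
  assume "r \<in> \<R> \<and> r \<noteq> 0"
  moreover from this obtain m where "r \<in> dig m" by (auto simp: fin_exp_iff)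
  ultimately show "r \<in> \<R>p"
    using digits_subset_Suc[of m] by (auto simp: fin_exp_plus_def)
qed (auto simp: fin_exp_plus_def fin_exp_def)

lemma fin_exp_integers: "r \<in> \<R> \<Longrightarrow> r \<in> \<O>"
  using digits_integers by (auto simp: fin_exp_iff)

lemma zero_in_fin_exp: "0 \<in> \<R>"
  using zero_in_digits by (auto simp: fin_exp_iff)

lemma in_digits_len: "r \<in> \<R> \<Longrightarrow> r \<in> dig (lg r)"
  unfolding len_def fin_exp_iff by (rule LeastI_ex)

lemma len_le: "r \<in> dig m \<Longrightarrow> lg r \<le> m"
  unfolding len_def by (rule Least_le)

lemma digits_iff: "r \<in> dig m \<longleftrightarrow> r \<in> \<R> \<and> lg r \<le> m"
  using in_digits_len digits_mono len_le fin_exp_iff by blast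

lemma len_0 [simp]: "lg 0 = 0"
  using len_le[of 0 0] by (simp add: digits_0)

text \<open>Makes the description in \<open>pred\<close> unambiguous. If \<open>m < m'\<close>, the
  common value has at most \<open>m'\<close> digits and lies within \<open>\<rho> ^ m'\<close> of
  \<open>s'\<close>, hence equals \<open>s'\<close>, against \<open>t' \<noteq> 0\<close>.\<close>

lemma last_digit_unique:
  assumes "s + t * \<pi> ^ m = s' + t' * \<pi> ^ m'" "s \<in> dig m" "s' \<in> dig m'"
    "t \<in> T" "t' \<in> T" "t \<noteq> 0" "t' \<noteq> 0" "m \<le> m'"
  shows "m = m' \<and> s = s'"
proof (cases "m = m'")
  case True
  have "s - s' = (t' - t) * \<pi> ^ m"
    using assms(1) True by (simp add: algebra_simps)
  then have "lf_abs (s - s') \<le> \<rho> ^ m"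
    using digit_diff_abs_le[OF assms(5,4)] by simp
  then show ?thesis
    using digits_unique[of s m s'] assms True by auto
next
  case False
  moreover have "s + t * \<pi> ^ m \<in> dig (Suc m)"
    using assms(2,4) by (auto simp: digits_Suc)
  ultimately have "s + t * \<pi> ^ m \<in> dig m'"
    using assms(8) digits_mono[of "Suc m" m'] by auto
  moreover have "lf_abs (s + t * \<pi> ^ m - s') \<le> \<rho> ^ m'"
    using assms T_abs by (simp add: lf_abs_mult lf_abs_power)
  ultimately have "s + t * \<pi> ^ m = s'"
    using assms digits_unique by blast
  then show ?thesis
    using assms rho by auto
qed

lemma pred_eq:
  assumes "s \<in> dig m" "t \<in> T" "t \<noteq> 0"
  shows "pr (s + t * \<pi> ^ m) = s"
  unfolding pred_def
proof (rule the_equality)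
  obtain a where a: "\<And>i. i < m \<Longrightarrow> a i \<in> T" "s = (\<Sum>i<m. a i * \<pi> ^ i)"
    using assms(1) by (auto simp: digits_def)
  define b where "b = a(m := t)"
  have "(\<Sum>i<m. b i * \<pi> ^ i) = s"
    using a(2) by (auto simp: b_def)
  moreover from this have "(\<Sum>i\<le>m. b i * \<pi> ^ i) = s + t * \<pi> ^ m"
    by (simp add: b_def flip: lessThan_Suc_atMost)
  moreover have "\<forall>i\<le>m. b i \<in> T" "b m \<noteq> 0"
    using a assms by (auto simp: b_def)
  ultimately show "\<exists>m' a. (\<forall>i\<le>m'. a i \<in> T) \<and> a m' \<noteq> 0 \<and> s + t * \<pi> ^ m = (\<Sum>i\<le>m'. a i * \<pi> ^ i) \<and>
      s = (\<Sum>i<m'. a i * \<pi> ^ i)"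
    by metis
next
  fix s'
  assume "\<exists>m' a. (\<forall>i\<le>m'. a i \<in> T) \<and> a m' \<noteq> 0 \<and> s + t * \<pi> ^ m = (\<Sum>i\<le>m'. a i * \<pi> ^ i) \<and>
      s' = (\<Sum>i<m'. a i * \<pi> ^ i)"
  then obtain m' a where a: "\<And>i. i \<le> m' \<Longrightarrow> a i \<in> T" "a m' \<noteq> 0"
    "s + t * \<pi> ^ m = (\<Sum>i\<le>m'. a i * \<pi> ^ i)" "s' = (\<Sum>i<m'. a i * \<pi> ^ i)"
    by blast
  have s': "s' \<in> dig m'"
    using a by (auto simp: digits_def)
  have eq: "s + t * \<pi> ^ m = s' + a m' * \<pi> ^ m'"
    using a by (simp flip: lessThan_Suc_atMost)
  show "s' = s"
  proof (cases "m \<le> m'")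
    case True
    then show ?thesis
      using last_digit_unique[OF eq assms(1) s' assms(2)] assms a by auto
  next
    case False
    then show ?thesis
      using last_digit_unique[OF eq[symmetric] s' assms(1) _ assms(2)] assms a by auto
  qed
qed

lemma fin_exp_plus_cases:
  assumes "r \<in> \<R>p"
  obtains m t where "lg r = Suc m" "pr r \<in> dig m" "t \<in> T" "t \<noteq> 0" "r = pr r + t * \<pi> ^ m"
    "\<gamma> r = t * \<pi> ^ m"
proof -
  have r: "r \<in> \<R>" "r \<noteq> 0" using assms by (auto simp: fin_exp_plus_iff)
  have "lg r \<noteq> 0"
    using in_digits_len[OF r(1)] r(2) by (metis digits_0 singletonD)
  then obtain m where m: "lg r = Suc m" by (cases "lg r") auto
  then obtain s t where st: "r = s + t * \<pi> ^ m" "s \<in> dig m" "t \<in> T"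
    using in_digits_len[OF r(1)] by (auto simp: digits_Suc)
  have "t \<noteq> 0"
  proof
    assume "t = 0"
    then have "r \<in> dig m" using st by simp
    then show False using len_le[of r m] m by simp
  qed
  then have "pr r = s" using pred_eq st by simp
  then show ?thesis
    using that m st \<open>t \<noteq> 0\<close> r by (simp add: gam_def)
qed

lemma gam_0 [simp]: "\<gamma> 0 = 1"
  by (simp add: gam_def)

lemma gam_plus: "r \<in> \<R>p \<Longrightarrow> \<gamma> r = r - pr r"
  by (simp add: gam_def fin_exp_plus_iff)

text \<open>For \<open>r = 0\<close> the truncated subtraction gives the exponent 0, in accordance
  with \<open>\<gamma> 0 = 1\<close>; otherwise \<open>\<gamma> r\<close> is the last nonzero digit,
  of absolute value 1, times \<open>\<pi> ^ (lg r - 1)\<close>.\<close>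

lemma gam_abs: "r \<in> \<R> \<Longrightarrow> lf_abs (\<gamma> r) = \<rho> ^ (lg r - 1)"
proof (cases "r = 0")
  case False
  assume "r \<in> \<R>"
  with False have "r \<in> \<R>p" by (simp add: fin_exp_plus_iff)
  then show ?thesis
    by (rule fin_exp_plus_cases) (simp add: lf_abs_mult lf_abs_power T_abs)
qed simp

lemma gam_pos: "r \<in> \<R> \<Longrightarrow> 0 < lf_abs (\<gamma> r)"
  using rho by (simp only: gam_abs) simp

lemma gam_nonzero: "r \<in> \<R> \<Longrightarrow> \<gamma> r \<noteq> 0"
  using gam_pos by fastforce

lemma gam_le_1: "r \<in> \<R> \<Longrightarrow> lf_abs (\<gamma> r) \<le> 1"
  using rho by (simp only: gam_abs) (simp add: power_le_one)

lemma len_pos: "r \<in> \<R>p \<Longrightarrow> 0 < lg r"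
  by (erule fin_exp_plus_cases) simp

lemma pred_digits: "r \<in> \<R>p \<Longrightarrow> pr r \<in> dig (lg r - 1)"
  by (erule fin_exp_plus_cases) simp

lemma pred_fin_exp: "r \<in> \<R>p \<Longrightarrow> pr r \<in> \<R>"
  using pred_digits by (auto simp: fin_exp_iff)

lemma pred_integers: "r \<in> \<R>p \<Longrightarrow> pr r \<in> \<O>"
  using pred_fin_exp fin_exp_integers by blast

lemma fin_exp_plus_integers: "r \<in> \<R>p \<Longrightarrow> r \<in> \<O>"
  using fin_exp_integers by (auto simp: fin_exp_plus_iff)

lemma len_pred_less: "r \<in> \<R>p \<Longrightarrow> lg (pr r) < lg r"
  using len_le[OF pred_digits, of r] len_pos[of r] by linarith

lemma gam_abs_pred: "r \<in> \<R>p \<Longrightarrow> lf_abs (r - pr r) = \<rho> ^ (lg r - 1)"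
  using gam_abs[of r] by (simp add: gam_plus fin_exp_plus_iff)

lemma cell_iff: "x \<in> cell r \<longleftrightarrow> x \<in> \<O> \<and> lf_abs (x - r) \<le> \<rho> ^ lg r"
  by (simp add: cell_def uball_def)

lemma chi_eq: "chi \<pi> T r x = (if x \<in> cell r then 1 else 0)"
  by (simp add: chi_def cell_iff residue_card_powi)

lemma cell_close: "x \<in> cell r \<Longrightarrow> y \<in> \<O> \<Longrightarrow> lf_abs (x - y) \<le> \<rho> ^ lg r \<Longrightarrow> y \<in> cell r"
  unfolding cell_iff using lf_abs_diff_trans[of y x _ r] by (auto simp: lf_abs_commute)

text \<open>For \<open>r \<noteq> 0\<close> the radius of the cell is the next value below
  \<open>lf_abs (\<gamma> r)\<close>, so a distance strictly below the latter does not leave the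
  cell. For \<open>r = 0\<close> the cell is the whole ring.\<close>

lemma cell_close_gam:
  assumes "r \<in> \<R>" "x \<in> cell r" "y \<in> \<O>" "lf_abs (x - y) < lf_abs (\<gamma> r)"
  shows "y \<in> cell r"
proof (cases "r = 0")
  case True
  then show ?thesis using assms by (simp add: cell_iff in_integers_iff)
next
  case False
  then have "r \<in> \<R>p" using assms by (simp add: fin_exp_plus_iff)
  then have "Suc (lg r - 1) = lg r" using len_pos by simp
  then show ?thesis
    using lf_abs_discrete[OF unif, of "x - y" "lg r - 1"] assms cell_close by (simp add: gam_abs)
qed

lemma cell_abs_le_gam: "r \<in> \<R> \<Longrightarrow> x \<in> cell r \<Longrightarrow> lf_abs (x - r) \<le> lf_abs (\<gamma> r)"
  using rho_mono[of "lg r - 1" "lg r"] by (simp add: cell_iff gam_abs)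

lemma center_in_cell: "r \<in> \<R> \<Longrightarrow> r \<in> cell r"
  using rho by (simp add: cell_iff fin_exp_integers)

text \<open>Two expansions with at most \<open>lg r\<close> digits in one ball of radius
  \<open>\<rho> ^ lg r\<close> coincide, so any other expansion in the cell must be longer than its
  centre.\<close>

lemma cell_len:
  assumes "r \<in> \<R>" "s \<in> \<R>" "s \<in> cell r" "s \<noteq> r"
  shows "lg r < lg s"
proof (rule ccontr)
  assume "\<not> lg r < lg s"
  then have "s \<in> dig (lg r)"
    using assms by (simp add: digits_iff)
  then show False
    using digits_unique[of s "lg r" r] assms in_digits_len by (auto simp: cell_iff)
qed

text \<open>Dropping the last digit moves \<open>s\<close> by \<open>\<rho> ^ (lg s - 1)\<close>,
  too little to leave or enter a cell with a shorter centre. The case \<open>s = r\<close> is a true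
  exception by \<open>pred_not_in_cell\<close>.\<close>

lemma cell_pred_iff:
  assumes "r \<in> \<R>" "s \<in> \<R>p" "s \<noteq> r"
  shows "pr s \<in> cell r \<longleftrightarrow> s \<in> cell r"
proof -
  have s: "s \<in> \<R>" using assms by (simp add: fin_exp_plus_iff)
  have le: "lf_abs (s - pr s) \<le> \<rho> ^ lg r" if "lg r < lg s"
    using that rho_mono[of "lg r" "lg s - 1"] by (simp add: gam_abs_pred[OF assms(2)])
  have len: "lg r < lg s" if "pr s \<in> cell r"
    using cell_len[OF assms(1) pred_fin_exp[OF assms(2)] that] len_pred_less[OF assms(2)]
    by (cases "pr s = r") auto
  show ?thesis
  proof
    assume "pr s \<in> cell r"
    from cell_close[OF this fin_exp_integers[OF s]] len[OF this] show "s \<in> cell r"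
      using le by (simp add: lf_abs_commute)
  next
    assume "s \<in> cell r"
    from cell_close[OF this pred_integers[OF assms(2)]] cell_len[OF assms(1) s this assms(3)]
    show "pr s \<in> cell r"
      using le by simp
  qed
qed

lemma pred_not_in_cell: "r \<in> \<R>p \<Longrightarrow> pr r \<notin> cell r"
  using cell_len[of r "pr r"] len_pred_less[of r] pred_fin_exp[of r] fin_exp_plus_iff[of r]
  by (cases "pr r = r") auto


subsection \<open>Wavelets\<close>

lemma wavelet_in: "x \<in> cell r \<Longrightarrow> wav n r j x = \<gamma> r ^ (n - j) * (x - r) ^ j"
  by (simp add: wavelet_def chi_eq)

lemma wavelet_out: "x \<notin> cell r \<Longrightarrow> wav n r j x = 0"
  by (simp add: wavelet_def chi_eq)

text \<open>
  Two points separated by at least \<open>\<bar>\<gamma> r\<bar>\<close> cost one factor \<open>\<bar>\<gamma> r\<bar>\<close> each time they are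
  divided out; otherwise all points lie in one cell, where the wavelet is a polynomial.
\<close>

lemma Phi_wavelet_le:
  assumes r: "r \<in> \<R>" and j: "j \<le> n"
  shows "xs \<in> dlists k \<O> \<Longrightarrow> lf_abs (Phi (wav n r j) xs) * lf_abs (\<gamma> r) ^ k \<le> lf_abs (\<gamma> r) ^ n"
proof (induction k arbitrary: xs rule: less_induct)
  case (less k)
  define g where "g = lf_abs (\<gamma> r)"
  have g: "0 < g" using gam_pos[OF r] by (simp add: g_def)
  have xs: "length xs = Suc k" "distinct xs" "set xs \<subseteq> \<O>"
    using less.prems by (auto simp: dlists_def)
  show ?case
  proof (cases "\<exists>x\<in>set xs. \<exists>y\<in>set xs. x \<noteq> y \<and> g \<le> lf_abs (x - y)")
    case True
    then obtain x y where xy: "x \<in> set xs" "y \<in> set xs" "x \<noteq> y" "g \<le> lf_abs (x - y)" by blast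
    define zs where "zs = remove1 x (remove1 y xs)"
    have zs: "set zs = set xs - {x, y}" "distinct zs"
      using xs by (auto simp: zs_def)
    have all: "distinct (x # y # zs)" "set (x # y # zs) = set xs"
      using xy zs by auto
    then have "length (x # y # zs) = length xs"
      using xs by (metis distinct_card)
    then obtain k' where k': "k = Suc k'" "length zs = k'"
      using xs by auto
    have IH: "lf_abs (Phi (wav n r j) (w # zs)) * g ^ k' \<le> g ^ n" if "w = x \<or> w = y" for w
      using that all xs k' unfolding g_def by (intro less.IH) (auto simp: dlists_def)
    have "lf_abs (Phi (wav n r j) (x # zs) - Phi (wav n r j) (y # zs)) \<le> g ^ n / g ^ k'"
      using IH g by (intro lf_abs_diff_leI) (simp_all add: field_simps)
    then have le: "lf_abs (Phi (wav n r j) (x # zs) - Phi (wav n r j) (y # zs)) * g ^ k' \<le> g ^ n"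
      using g by (simp add: field_simps)
    have "Phi (wav n r j) xs = Phi (wav n r j) (x # y # zs)"
      using all xs by (intro Phi_set_eq) auto
    then have "lf_abs (Phi (wav n r j) xs) * g ^ k =
        (lf_abs (Phi (wav n r j) (x # zs) - Phi (wav n r j) (y # zs)) * g ^ k') * (g / lf_abs (x - y))"
      by (simp add: lf_abs_divide k')
    also have "\<dots> \<le> (lf_abs (Phi (wav n r j) (x # zs) - Phi (wav n r j) (y # zs)) * g ^ k') * 1"
      using xy g by (intro mult_left_mono) auto
    finally show ?thesis
      using le by (simp add: g_def)
  next
    case close: False
    show ?thesis
    proof (cases "\<exists>x\<in>set xs. x \<in> cell r")
      case True
      then obtain x where x: "x \<in> set xs" "x \<in> cell r" by blast
      have "y \<in> cell r" if "y \<in> set xs" for y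
        using close x that xs cell_close_gam[OF r x(2), of y] unfolding g_def
        by (cases "x = y") force+
      then have cell: "set xs \<subseteq> cell r" by blast
      then have "Phi (wav n r j) xs = \<gamma> r ^ (n - j) * Phi (\<lambda>x. (x - r) ^ j) xs"
        unfolding Phi_cmult[symmetric] by (intro Phi_cong wavelet_in) auto
      moreover have "lf_abs (Phi (\<lambda>x. (x - r) ^ j) xs) * g ^ k \<le> g ^ j"
      proof (cases "k \<le> j")
        case True
        have "lf_abs (Phi (\<lambda>x. (x - r) ^ j) xs) \<le> g ^ (Suc j - length xs)"
          using xs True cell cell_abs_le_gam[OF r] unfolding g_def by (intro Phi_power_le) auto
        then have "lf_abs (Phi (\<lambda>x. (x - r) ^ j) xs) * g ^ k \<le> g ^ (j - k) * g ^ k"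
          using xs g by (intro mult_right_mono) auto
        then show ?thesis using True by (simp flip: power_add)
      next
        case False
        then show ?thesis using xs g by (simp add: Phi_power_high)
      qed
      then have "g ^ (n - j) * (lf_abs (Phi (\<lambda>x. (x - r) ^ j) xs) * g ^ k) \<le> g ^ (n - j) * g ^ j"
        using g by (intro mult_left_mono) auto
      ultimately show ?thesis
        using j by (simp add: lf_abs_mult lf_abs_power mult.assoc g_def[symmetric] flip: power_add)
    next
      case False
      then have "Phi (wav n r j) xs = Phi (\<lambda>x. 0) xs"
        by (intro Phi_cong wavelet_out) auto
      then show ?thesis using g by (simp add: g_def)
    qed
  qed
qed

text \<open>On the ball of radius \<open>\<rho> ^ lg r\<close> about any integer the wavelet is one
  polynomial or zero, so its diagonal limits are those of a power.\<close>

lemma Phi_tendsto_wavelet: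
  assumes "r \<in> \<R>" "a \<in> \<O>"
  shows "Phi_tendsto k (wav n r j) a
    (if a \<in> cell r then \<gamma> r ^ (n - j) * (of_nat (j choose k) * (a - r) ^ (j - k)) else 0)"
proof -
  have d: "0 < \<rho> ^ lg r" using rho by simp
  show ?thesis
  proof (cases "a \<in> cell r")
    case True
    have "Phi_tendsto k (wav n r j) a (\<gamma> r ^ (n - j) * (of_nat (j choose k) * (a - r) ^ (j - k)))"
    proof (rule Phi_tendsto_local[OF Phi_tendsto_cmult[OF Phi_tendsto_power] d])
      fix x assume "x \<in> uball a (\<rho> ^ lg r)"
      then have "x \<in> cell r"
        using cell_close[OF True] by (auto simp: uball_def lf_abs_commute)
      then show "\<gamma> r ^ (n - j) * (x - r) ^ j = wav n r j x"
        by (simp add: wavelet_in)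
    qed
    then show ?thesis using True by simp
  next
    case False
    have "Phi_tendsto k (wav n r j) a 0"
    proof (rule Phi_tendsto_local[OF Phi_tendsto_zero d])
      fix x assume "x \<in> uball a (\<rho> ^ lg r)"
      then have "x \<notin> cell r"
        using cell_close[of x r a] False assms by (auto simp: uball_def)
      then show "0 = wav n r j x"
        by (simp add: wavelet_out)
    qed
    then show ?thesis using False by simp
  qed
qed

lemma wavelet_Cspace:
  assumes "r \<in> \<R>"
  shows "wav n r j \<in> Cspace m"
proof (rule CspaceI)
  show "wav n r j x = 0" if "x \<notin> \<O>" for x
    using that by (simp add: wavelet_out cell_iff)
  show "\<exists>L. Phi_tendsto m (wav n r j) a L" if "a \<in> \<O>" for a
    using Phi_tendsto_wavelet[OF assms that] by blast
qed

lemma Dq_wavelet: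
  assumes "r \<in> \<R>" "a \<in> \<O>"
  shows "Dq k (wav n r j) a =
    (if a \<in> cell r then \<gamma> r ^ (n - j) * (of_nat (j choose k) * (a - r) ^ (j - k)) else 0)"
  using Dq_eqI[OF wavelet_Cspace[OF assms(1)] assms(2) order_refl Phi_tendsto_wavelet[OF assms]] .

text \<open>A cell of length at most \<open>m\<close> contains the ball or misses it.\<close>

lemma Phi_wavelet_eq_0:
  assumes r: "r \<in> \<R>" and jk: "j < k" and xs: "xs \<in> dlists k (uball a (\<rho> ^ m))"
    and "\<not> (r \<in> uball a (\<rho> ^ m) \<and> m < lg r)"
  shows "Phi (wav n r j) xs = 0"
proof -
  have l: "length xs = Suc k" "distinct xs" "set xs \<subseteq> uball a (\<rho> ^ m)"
    using xs by (auto simp: dlists_def)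
  have close: "lf_abs (x - y) \<le> \<rho> ^ m" if "x \<in> uball a (\<rho> ^ m)" "y \<in> uball a (\<rho> ^ m)" for x y
    using that lf_abs_diff_leI[of "x - a" _ "y - a"] by (simp add: uball_def)
  show ?thesis
  proof (cases "\<exists>x\<in>set xs. x \<in> cell r")
    case True
    then obtain x where x: "x \<in> set xs" "x \<in> cell r" by blast
    have "lg r \<le> m"
    proof (rule ccontr)
      assume "\<not> lg r \<le> m"
      then have "\<rho> ^ lg r \<le> \<rho> ^ m" by (intro rho_mono) simp
      then have "lf_abs (r - x) \<le> \<rho> ^ m"
        using x by (auto simp: cell_iff lf_abs_commute)
      then have "r \<in> uball a (\<rho> ^ m)"
        using x l lf_abs_diff_trans[of r x _ a] fin_exp_integers[OF r] by (auto simp: uball_def)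
      then show False using assms(4) \<open>\<not> lg r \<le> m\<close> by simp
    qed
    then have "set xs \<subseteq> cell r"
    proof (intro subsetI)
      fix y assume "y \<in> set xs"
      then have "x \<in> uball a (\<rho> ^ m)" "y \<in> uball a (\<rho> ^ m)"
        using l x by auto
      from close[OF this] have "lf_abs (x - y) \<le> \<rho> ^ lg r"
        using rho_mono[OF \<open>lg r \<le> m\<close>] by linarith
      then show "y \<in> cell r"
        using cell_close[OF x(2)] \<open>y \<in> uball a (\<rho> ^ m)\<close> by (simp add: uball_def)
    qed
    then have "Phi (wav n r j) xs = \<gamma> r ^ (n - j) * Phi (\<lambda>x. (x - r) ^ j) xs"
      unfolding Phi_cmult[symmetric] by (intro Phi_cong wavelet_in) auto
    then show ?thesis using l jk by (simp add: Phi_power_high)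
  next
    case False
    then have "Phi (wav n r j) xs = Phi (\<lambda>x. 0) xs"
      by (intro Phi_cong wavelet_out) auto
    then show ?thesis by simp
  qed
qed

end


section \<open>Continuity, Taylor remainders near the diagonal and exact Taylor formulas\<close>

lemma Cspace_continuous:
  assumes "f \<in> Cspace n" "a \<in> \<O>" "(s \<longlongrightarrow> a) F" "\<forall>\<^sub>F i in F. s i \<in> \<O>"
  shows "((\<lambda>i. f (s i)) \<longlongrightarrow> f a) F"
  unfolding tendsto_lf_abs_iff
proof (intro allI impI)
  fix e :: real assume "0 < e"
  have "Phi_tendsto 0 f a (f a)"
    using Phi_tendsto_Dq[OF assms(1,2), of 0] by (simp add: Dq_0[OF assms(1)])
  then obtain d where d: "0 < d" "\<And>xs. xs \<in> dlists 0 (uball a d) \<Longrightarrow> lf_abs (Phi f xs - f a) \<le> e"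
    using \<open>0 < e\<close> unfolding Phi_tendsto_def by metis
  have "\<forall>\<^sub>F i in F. lf_abs (s i - a) \<le> d"
    using assms(3) d(1) unfolding tendsto_lf_abs_iff by blast
  then show "\<forall>\<^sub>F i in F. lf_abs (f (s i) - f a) \<le> e"
    using assms(4)
  proof eventually_elim
    case (elim i)
    then have "[s i] \<in> dlists 0 (uball a d)"
      by (simp add: dlists_def uball_def)
    from d(2)[OF this] show ?case by simp
  qed
qed

lemma psi_eq:
  assumes "f \<in> Cspace n"
  shows "psi k f x y = (f x - (\<Sum>l\<le>k. (x - y) ^ l * Dq l f y)) / (x - y) ^ Suc k"
proof -
  have "(\<Sum>l\<le>k. (x - y) ^ l * Dq l f y) = f y + (\<Sum>l=1..k. (x - y) ^ l * Dq l f y)"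
    by (simp add: Dq_0[OF assms] sum.atMost_shift sum.atLeast1_atMost_eq lessThan_Suc_atMost)
  then show ?thesis
    by (simp add: psi_def)
qed

lemma psi_le:
  assumes f: "f \<in> Cspace (Suc k)" and xy: "x \<in> \<O>" "y \<in> \<O>" "x \<noteq> y"
    and M: "\<And>xs. xs \<in> dlists (Suc k) \<O> \<Longrightarrow> lf_abs (Phi f xs) \<le> M" "0 \<le> M"
  shows "lf_abs (psi k f x y) \<le> M"
proof -
  have "lf_abs (f x - (\<Sum>l<Suc k. (x - y) ^ l * Dq l f y)) \<le> M * lf_abs (x - y) ^ Suc k"
    by (rule Taylor_le[of 1 x 0 y]) (use xy M in \<open>auto simp: uball_0_1 intro!: Phi_tendsto_Dq[OF f]\<close>)
  then show ?thesis
    using xy(3) by (simp add: psi_eq[OF f] lf_abs_divide lf_abs_power lessThan_Suc_atMost pos_divide_le_eq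
        del: power_Suc sum.atMost_Suc sum.lessThan_Suc)
qed

lemma diff_diff_eq_diff_diff: "a - b - (c - d) = a - c - (b - (d :: 'a::ab_group_add))"
  by simp

text \<open>Here \<open>x\<close> and \<open>y\<close> both vary near \<open>a\<close>. The power
  \<open>(x - a)^(k + 1)\<close> is subtracted because its Taylor remainder of order
  \<open>k\<close> at any \<open>y\<close> is exactly \<open>(x - y)^(k + 1)\<close>, so that it
  contributes precisely \<open>L\<close> to \<open>psi\<close>.\<close>

lemma psi_near_diagonal:
  assumes f: "f \<in> Cspace (Suc k)" and d: "0 < d" and xy: "x \<in> uball a d" "y \<in> uball a d" "x \<noteq> y"
    and M: "\<And>xs. xs \<in> dlists (Suc k) (uball a d) \<Longrightarrow> lf_abs (Phi f xs - L) \<le> M" "0 \<le> M"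
  shows "lf_abs (psi k f x y - L) \<le> M"
proof -
  define g where "g x = f x - L * (x - a) ^ Suc k" for x
  define D where "D l = Dq l f y - L * (of_nat (Suc k choose l) * (y - a) ^ (Suc k - l))" for l
  have "lf_abs (g x - (\<Sum>l<Suc k. (x - y) ^ l * D l)) \<le> M * lf_abs (x - y) ^ Suc k"
  proof (rule Taylor_le[OF d xy(1,2)])
    show "Phi_tendsto l g y (D l)" if "l < Suc k" for l
      unfolding g_def D_def using xy that
      by (intro Phi_tendsto_diff Phi_tendsto_cmult Phi_tendsto_power Phi_tendsto_Dq[OF f]) (auto simp: uball_def)
    show "lf_abs (Phi g xs) \<le> M" if "xs \<in> dlists (Suc k) (uball a d)" for xs
      using M(1)[OF that] that unfolding g_def
      by (simp add: Phi_diff Phi_cmult Phi_power_top dlists_def del: power_Suc)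
  qed (rule M(2))
  moreover have "g x - (\<Sum>l<Suc k. (x - y) ^ l * D l) =
      (f x - (\<Sum>l<Suc k. (x - y) ^ l * Dq l f y)) - L * (x - y) ^ Suc k"
  proof -
    have "(x - a) ^ Suc k = (\<Sum>l\<le>Suc k. of_nat (Suc k choose l) * (x - y) ^ l * (y - a) ^ (Suc k - l))"
      using binomial_ring[of "x - y" "y - a" "Suc k"] by simp
    also have "\<dots> = (\<Sum>l<Suc k. of_nat (Suc k choose l) * (x - y) ^ l * (y - a) ^ (Suc k - l)) + (x - y) ^ Suc k"
      unfolding lessThan_Suc_atMost[symmetric] sum.lessThan_Suc[of _ "Suc k"] by simp
    finally have e1: "(x - a) ^ Suc k - (\<Sum>l<Suc k. (x - y) ^ l * (of_nat (Suc k choose l) * (y - a) ^ (Suc k - l))) = (x - y) ^ Suc k"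
      by (simp add: mult_ac del: power_Suc sum.lessThan_Suc)
    have e2: "(\<Sum>l<Suc k. (x - y) ^ l * D l) = (\<Sum>l<Suc k. (x - y) ^ l * Dq l f y) -
        L * (\<Sum>l<Suc k. (x - y) ^ l * (of_nat (Suc k choose l) * (y - a) ^ (Suc k - l)))"
      unfolding D_def sum_distrib_left sum_subtractf[symmetric] by (intro sum.cong) (simp_all add: algebra_simps)
    show ?thesis
      unfolding g_def e2 e1[symmetric] right_diff_distrib by (rule diff_diff_eq_diff_diff)
  qed
  ultimately have "lf_abs ((f x - (\<Sum>l<Suc k. (x - y) ^ l * Dq l f y)) - L * (x - y) ^ Suc k) \<le>
      M * lf_abs (x - y) ^ Suc k"
    by simp
  moreover have "psi k f x y - L = ((f x - (\<Sum>l<Suc k. (x - y) ^ l * Dq l f y)) - L * (x - y) ^ Suc k) / (x - y) ^ Suc k"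
    unfolding psi_eq[OF f] diff_divide_distrib using xy(3)
    by (simp add: lessThan_Suc_atMost del: power_Suc)
  ultimately show ?thesis
    using xy(3) by (simp add: lf_abs_divide lf_abs_power pos_divide_le_eq del: power_Suc sum.lessThan_Suc)
qed

text \<open>The exact Taylor formula at \<open>y\<close> for the \<open>j\<close>-th Hasse
  derivative of \<open>(x - c)^i\<close>; the coefficients match by the product identity
  \<open>choose_mult\<close>.\<close>

lemma Taylor_power:
  fixes x y c :: "'k::comm_ring_1"
  assumes "j \<le> i"
  shows "(\<Sum>l\<le>i-j. (x - y) ^ l * (of_nat ((l + j) choose j) * (of_nat (i choose (l + j)) * (y - c) ^ (i - (l + j))))) =
    of_nat (i choose j) * (x - c) ^ (i - j)"
proof -
  have "(x - c) ^ (i - j) = (\<Sum>l\<le>i-j. of_nat ((i - j) choose l) * (x - y) ^ l * (y - c) ^ (i - j - l))"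
    using binomial_ring[of "x - y" "y - c" "i - j"] by simp
  moreover have "of_nat (i choose j) * (of_nat ((i - j) choose l) * (x - y) ^ l * (y - c) ^ (i - j - l)) =
      (x - y) ^ l * (of_nat ((l + j) choose j) * (of_nat (i choose (l + j)) * (y - c) ^ (i - (l + j))))"
    if "l \<le> i - j" for l
  proof -
    have "(i choose (l + j)) * ((l + j) choose j) = (i choose j) * ((i - j) choose l)"
      using choose_mult[of j "l + j" i] that assms by simp
    then have eq: "of_nat (i choose (l + j)) * of_nat ((l + j) choose j) =
        (of_nat (i choose j) * of_nat ((i - j) choose l) :: 'k)"
      by (simp flip: of_nat_mult)
    have "i - (l + j) = i - j - l" using that by simp
    then have "(x - y) ^ l * (of_nat ((l + j) choose j) * (of_nat (i choose (l + j)) * (y - c) ^ (i - (l + j)))) =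
        (of_nat (i choose (l + j)) * of_nat ((l + j) choose j)) * ((x - y) ^ l * (y - c) ^ (i - j - l))"
      by (simp only: mult_ac)
    then show ?thesis
      unfolding eq by (simp only: mult_ac)
  qed
  ultimately show ?thesis
    by (simp add: sum_distrib_left)
qed

context wavelet_setup
begin

text \<open>\<open>dig m\<close> is a finite net of mesh \<open>\<rho> ^ m\<close>, so the complete
  ring is totally bounded.\<close>

lemma compact_integers: "compact (\<O> :: 'k set)"
  unfolding compact_eq_totally_bounded
proof (intro conjI allI impI complete_integers)
  fix e :: real assume "0 < e"
  obtain m where m: "\<rho> ^ m \<le> e / 2"
    using uniformizer_power_small[OF unif, of "e / 2"] \<open>0 < e\<close> by auto
  have "x \<in> (\<Union>r\<in>dig m. ball r e)" if "x \<in> \<O>" for x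
  proof (intro UN_I[OF trunc(1)[OF that]])
    show "x \<in> ball (trunc m x) e"
      using trunc(2)[OF that, of m] m \<open>0 < e\<close> by (simp add: dist_lf_abs lf_abs_commute)
  qed
  then show "\<exists>K. finite K \<and> (\<O> :: 'k set) \<subseteq> (\<Union>x\<in>K. ball x e)"
    using finite_digits[of m] by blast
qed


subsection \<open>Coefficients\<close>

text \<open>Given by the closed formula, so that it is available before any expansion is known to
  converge; \<open>wavelet_expansion_unique\<close> identifies it with the coefficients of an
  arbitrary expansion.\<close>

definition coef :: "nat \<Rightarrow> ('k \<Rightarrow> 'k) \<Rightarrow> 'k \<Rightarrow> nat \<Rightarrow> 'k" where
  "coef n f r j = (if r = 0 then Dq j f 0 else \<gamma> r * psi (n - j) (Dq j f) r (pr r))"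

definition Taylor :: "nat \<Rightarrow> ('k \<Rightarrow> 'k) \<Rightarrow> 'k \<Rightarrow> 'k \<Rightarrow> 'k" where
  "Taylor n f s x = (\<Sum>i\<le>n. (x - s) ^ i * Dq i f s)"

definition wavelet_sum :: "nat \<Rightarrow> ('k \<times> nat) set \<Rightarrow> ('k \<times> nat \<Rightarrow> 'k) \<Rightarrow> 'k \<Rightarrow> 'k" where
  "wavelet_sum n F c x = (\<Sum>i\<in>F. c i * wav n (fst i) (snd i) x)"

lemma pred_neq: "r \<in> \<R>p \<Longrightarrow> r \<noteq> pr r"
  using len_pred_less[of r] by auto

text \<open>The form without denominators: times \<open>\<gamma> r ^ (n - j)\<close>, the
  coefficient is the \<open>j\<close>-th derivative of \<open>f\<close> at \<open>r\<close> minus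
  that of the Taylor polynomial centred at \<open>pr r\<close>. Its linearity in \<open>f\<close> is
  used in \<open>coef_lincomb\<close>.\<close>

lemma coef_eq:
  assumes f: "f \<in> Cspace n" and r: "r \<in> \<R>p" and j: "j \<le> n"
  shows "coef n f r j * \<gamma> r ^ (n - j) =
    Dq j f r - (\<Sum>l\<le>n - j. (r - pr r) ^ l * (of_nat ((l + j) choose j) * Dq (l + j) f (pr r)))"
proof -
  have r0: "r \<noteq> 0" using r by (simp add: fin_exp_plus_iff)
  have g: "\<gamma> r = r - pr r" "r - pr r \<noteq> 0"
    using gam_plus[OF r] pred_neq[OF r] by auto
  have "psi (n - j) (Dq j f) r (pr r) * \<gamma> r ^ Suc (n - j) =
      Dq j f r - (\<Sum>l\<le>n - j. (r - pr r) ^ l * Dq l (Dq j f) (pr r))"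
    unfolding psi_eq[OF Dq_in_Cspace[OF f j]] g(1) using g(2) by (simp del: power_Suc)
  moreover have "Dq l (Dq j f) (pr r) = of_nat ((l + j) choose j) * Dq (l + j) f (pr r)" if "l \<le> n - j" for l
    using that j by (intro Dq_Dq[OF f]) (auto simp: pred_integers[OF r])
  ultimately show ?thesis
    using r0 by (simp add: coef_def mult_ac)
qed

text \<open>Re-expanding the polynomial centred at \<open>pr r\<close> in powers of
  \<open>x - r\<close> produces exactly the sums in \<open>coef_eq\<close>: moving the centre from
  \<open>pr r\<close> to \<open>r\<close> adds the wavelet terms at \<open>r\<close>.\<close>

lemma Taylor_step:
  assumes f: "f \<in> Cspace n" and r: "r \<in> \<R>p"
  shows "Taylor n f r x - Taylor n f (pr r) x = (\<Sum>j\<le>n. coef n f r j * (\<gamma> r ^ (n - j) * (x - r) ^ j))"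
proof -
  define d where "d = r - pr r"
  have "Taylor n f (pr r) x = (\<Sum>i\<le>n. \<Sum>j\<le>i. of_nat (i choose j) * (x - r) ^ j * d ^ (i - j) * Dq i f (pr r))"
    unfolding Taylor_def
  proof (intro sum.cong refl)
    fix i
    have "x - pr r = (x - r) + d" by (simp add: d_def)
    then show "(x - pr r) ^ i * Dq i f (pr r) =
        (\<Sum>j\<le>i. of_nat (i choose j) * (x - r) ^ j * d ^ (i - j) * Dq i f (pr r))"
      by (simp only: binomial_ring sum_distrib_right)
  qed
  also have "\<dots> = (\<Sum>(i, j)\<in>Sigma {..n} (\<lambda>i. {..i}). of_nat (i choose j) * (x - r) ^ j * d ^ (i - j) * Dq i f (pr r))"
    by (simp add: sum.Sigma)
  also have "\<dots> = (\<Sum>(j, l)\<in>Sigma {..n} (\<lambda>j. {..n - j}).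
      of_nat ((l + j) choose j) * (x - r) ^ j * d ^ l * Dq (l + j) f (pr r))"
    by (rule sum.reindex_bij_witness[where i = "\<lambda>(j, l). (l + j, j)" and j = "\<lambda>(i, j). (j, i - j)"]) auto
  also have "\<dots> = (\<Sum>j\<le>n. \<Sum>l\<le>n - j. of_nat ((l + j) choose j) * (x - r) ^ j * d ^ l * Dq (l + j) f (pr r))"
    by (simp add: sum.Sigma)
  also have "\<dots> = (\<Sum>j\<le>n. (x - r) ^ j * (\<Sum>l\<le>n - j. d ^ l * (of_nat ((l + j) choose j) * Dq (l + j) f (pr r))))"
    unfolding sum_distrib_left by (intro sum.cong refl) (simp only: mult_ac)
  finally have "Taylor n f r x - Taylor n f (pr r) x = (\<Sum>j\<le>n. (x - r) ^ j *
      (Dq j f r - (\<Sum>l\<le>n - j. d ^ l * (of_nat ((l + j) choose j) * Dq (l + j) f (pr r)))))"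
    by (simp add: Taylor_def sum_subtractf right_diff_distrib)
  also have "\<dots> = (\<Sum>j\<le>n. (x - r) ^ j * (coef n f r j * \<gamma> r ^ (n - j)))"
    using coef_eq[OF f r] by (simp add: d_def)
  finally show ?thesis
    by (simp only: mult_ac)
qed

text \<open>Among the expansions of length \<open>m + 1\<close> only \<open>trunc (Suc m) x\<close>
  can have \<open>x\<close> in its cell. If the next digit of \<open>x\<close> is zero, it is not
  new and the centre stays; otherwise its predecessor is \<open>trunc m x\<close>, and
  \<open>Taylor_step\<close> moves the centre.\<close>

lemma partial_sum_eq_Taylor:
  assumes f: "f \<in> Cspace n" and x: "x \<in> \<O>"
  shows "(\<Sum>r\<in>dig m. \<Sum>j\<le>n. coef n f r j * wav n r j x) = Taylor n f (trunc m x) x"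
proof (induction m)
  case 0
  have "trunc 0 x = 0"
    using trunc(1)[OF x, of 0] by (simp add: digits_0)
  moreover have "x \<in> cell 0"
    using x by (simp add: cell_iff in_integers_iff)
  ultimately show ?case
    by (simp add: digits_0 wavelet_in coef_def Taylor_def mult.commute)
next
  case (Suc m)
  define r where "r = trunc (Suc m) x"
  define t where "t = (\<lambda>r. \<Sum>j\<le>n. coef n f r j * wav n r j x)"
  have r: "r \<in> dig (Suc m)" "lf_abs (x - r) \<le> \<rho> ^ Suc m"
    unfolding r_def using trunc[OF x, of "Suc m"] by blast+
  have t0: "t s = 0" if "s \<in> dig (Suc m) - dig m" "s \<noteq> r" for s
  proof -
    have "lg s = Suc m"
      using that digits_iff[of s m] digits_iff[of s "Suc m"] by auto
    then have "x \<notin> cell s"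
      using trunc_unique[OF x, of s "Suc m"] that unfolding r_def by (auto simp: cell_iff)
    then show ?thesis by (simp add: t_def wavelet_out)
  qed
  have split: "sum t (dig (Suc m)) = sum t (dig m) + sum t (dig (Suc m) - dig m)"
    using sum.subset_diff[OF digits_subset_Suc finite_digits, of t m] by simp
  show ?case
  proof (cases "r \<in> dig m")
    case True
    have "lf_abs (x - r) \<le> \<rho> ^ m"
      using r(2) rho_mono[of m "Suc m"] by simp
    then have "trunc m x = r"
      by (rule trunc_unique[OF x True])
    moreover have "sum t (dig (Suc m) - dig m) = 0"
      using t0 True by (intro sum.neutral) auto
    ultimately show ?thesis
      using Suc.IH split by (simp add: t_def r_def)
  next
    case False
    have "r \<noteq> 0" using False zero_in_digits by auto
    moreover have "r \<in> \<R>" "lg r = Suc m"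
      using r False digits_iff[of r m] digits_iff[of r "Suc m"] by auto
    ultimately have rp: "r \<in> \<R>p" by (simp add: fin_exp_plus_iff)
    have "sum t (dig (Suc m) - dig m) = t r"
    proof -
      have "sum t (dig (Suc m) - dig m) = sum t {r}"
        using t0 r False finite_digits by (intro sum.mono_neutral_right) auto
      then show ?thesis by simp
    qed
    moreover have "trunc m x = pr r"
    proof (rule trunc_unique[OF x])
      show "pr r \<in> dig m"
        using pred_digits[OF rp] \<open>lg r = Suc m\<close> by simp
      have "lf_abs (r - pr r) \<le> \<rho> ^ m"
        using gam_abs_pred[OF rp] \<open>lg r = Suc m\<close> by simp
      moreover have "lf_abs (x - r) \<le> \<rho> ^ m"
        using r(2) rho_mono[of m "Suc m"] by simp
      ultimately show "lf_abs (x - pr r) \<le> \<rho> ^ m"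
        by (rule lf_abs_diff_trans[rotated])
    qed
    moreover have "t r = Taylor n f r x - Taylor n f (pr r) x"
    proof -
      have "x \<in> cell r"
        using x r \<open>lg r = Suc m\<close> by (simp add: cell_iff)
      then show ?thesis
        unfolding Taylor_step[OF f rp] t_def by (simp add: wavelet_in)
    qed
    ultimately show ?thesis
      using Suc.IH split by (simp add: t_def r_def)
  qed
qed

lemma wavelet_sum_digits:
  "wavelet_sum n (dig m \<times> {..n}) (\<lambda>(r, j). c r j) x = (\<Sum>r\<in>dig m. \<Sum>j\<le>n. c r j * wav n r j x)"
  unfolding wavelet_sum_def by (simp add: sum.cartesian_product case_prod_beta)

lemma wavelet_sum_outside: "x \<notin> \<O> \<Longrightarrow> wavelet_sum n F c x = 0"
  unfolding wavelet_sum_def by (intro sum.neutral) (auto simp: wavelet_out cell_iff)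

lemma trunc_tendsto:
  assumes "x \<in> \<O>"
  shows "(\<lambda>m. trunc m x) \<longlonglongrightarrow> x"
  unfolding tendsto_lf_abs_iff eventually_sequentially
proof (intro allI impI)
  fix e :: real assume "0 < e"
  then obtain N where "\<And>m. m \<ge> N \<Longrightarrow> \<rho> ^ m \<le> e"
    using uniformizer_power_small[OF unif] by blast
  then show "\<exists>N. \<forall>m\<ge>N. lf_abs (trunc m x - x) \<le> e"
    using trunc(2)[OF assms] by (metis lf_abs_commute order_trans)
qed

text \<open>Pointwise convergence suffices for what follows: a difference quotient involves finitely
  many values, so bounds for the partial sums pass to \<open>f\<close>.\<close>

lemma wavelet_expansion_pointwise:
  assumes f: "f \<in> Cspace n"
  shows "(\<lambda>m. wavelet_sum n (dig m \<times> {..n}) (\<lambda>(r, j). coef n f r j) x) \<longlonglongrightarrow> f x"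
proof (cases "x \<in> \<O>")
  case True
  have "(\<lambda>m. Dq i f (trunc m x)) \<longlonglongrightarrow> Dq i f x" if "i \<le> n" for i
    using digits_integers[OF trunc(1)[OF True]]
    by (intro Cspace_continuous[OF Dq_in_Cspace[OF f that] True trunc_tendsto[OF True]]) simp
  then have "(\<lambda>m. Taylor n f (trunc m x) x) \<longlonglongrightarrow> (\<Sum>i\<le>n. (x - x) ^ i * Dq i f x)"
    unfolding Taylor_def by (intro tendsto_sum tendsto_mult tendsto_power_strong tendsto_diff tendsto_const trunc_tendsto[OF True]) auto
  moreover have "(\<Sum>i\<le>n. (x - x) ^ i * Dq i f x) = f x"
    using Dq_0[OF f] by (simp add: sum.atMost_shift)
  ultimately show ?thesis
    unfolding wavelet_sum_digits using partial_sum_eq_Taylor[OF f True] by simp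
next
  case False
  then show ?thesis
    using Cspace_outside[OF f False] by (simp add: wavelet_sum_outside)
qed

lemma wavelet_sum_diff:
  assumes "finite G" "F \<subseteq> G"
  shows "wavelet_sum n G c x - wavelet_sum n F c x = wavelet_sum n (G - F) c x"
  unfolding wavelet_sum_def using sum.subset_diff[OF assms(2,1), of "\<lambda>i. c i * wav n (fst i) (snd i) x"]
  by simp

lemma Phi_wavelet_sum:
  "Phi (wavelet_sum n F c) xs = (\<Sum>i\<in>F. c i * Phi (wav n (fst i) (snd i)) xs)"
  unfolding wavelet_sum_def by (simp add: Phi_sum Phi_cmult)

lemma wavelet_sum_Cspace: "F \<subseteq> \<R> \<times> A \<Longrightarrow> wavelet_sum n F c \<in> Cspace m"
  unfolding wavelet_sum_def by (intro Cspace_sum Cspace_cmult wavelet_Cspace) auto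

lemma Phi_wavelet_le_1:
  assumes "r \<in> \<R>" "j \<le> n" "k \<le> n" "xs \<in> dlists k \<O>"
  shows "lf_abs (Phi (wav n r j) xs) \<le> 1"
proof -
  have "lf_abs (Phi (wav n r j) xs) * lf_abs (\<gamma> r) ^ k \<le> lf_abs (\<gamma> r) ^ n"
    by (rule Phi_wavelet_le) (use assms in auto)
  also have "\<dots> \<le> lf_abs (\<gamma> r) ^ k"
    using assms gam_le_1 by (intro power_decreasing) auto
  finally show ?thesis
    using gam_pos[OF assms(1)] by simp
qed

lemma Phi_wavelet_sum_le:
  assumes "F \<subseteq> \<R> \<times> {..n}" "\<And>i. i \<in> F \<Longrightarrow> lf_abs (c i) \<le> M" "0 \<le> M" "k \<le> n" "xs \<in> dlists k \<O>"
  shows "lf_abs (Phi (wavelet_sum n F c) xs) \<le> M"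
  unfolding Phi_wavelet_sum
proof (rule lf_abs_sum_leI[OF assms(3)])
  fix i assume i: "i \<in> F"
  then have "lf_abs (Phi (wav n (fst i) (snd i)) xs) \<le> 1"
    using assms by (intro Phi_wavelet_le_1) auto
  then have "lf_abs (c i) * lf_abs (Phi (wav n (fst i) (snd i)) xs) \<le> M * 1"
    using assms(2)[OF i] assms(3) by (intro mult_mono) auto
  then show "lf_abs (c i * Phi (wav n (fst i) (snd i)) xs) \<le> M"
    by (simp add: lf_abs_mult)
qed

lemma finite_subset_digits:
  assumes "finite F" "F \<subseteq> \<R> \<times> {..n}"
  shows "\<forall>\<^sub>F m in sequentially. F \<subseteq> dig m \<times> {..n}"
proof -
  define M where "M = Max (insert 0 (lg ` fst ` F))"
  have "F \<subseteq> dig m \<times> {..n}" if "m \<ge> M" for m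
  proof
    fix i assume i: "i \<in> F"
    have "lg (fst i) \<le> M"
      unfolding M_def using assms(1) i by (intro Max_ge) auto
    then have "fst i \<in> dig m"
      using that i assms(2) by (auto simp: digits_iff)
    then show "i \<in> dig m \<times> {..n}"
      using i assms(2) by (cases i) auto
  qed
  then show ?thesis
    unfolding eventually_sequentially by blast
qed

text \<open>The ultrametric inequality bounds every finite sum outside \<open>F\<close> by its
  largest coefficient, whatever the number of terms; the bound passes to the pointwise
  limit.\<close>

lemma Phi_remainder_le:
  assumes f: "f \<in> Cspace n" and F: "finite F" "F \<subseteq> \<R> \<times> {..n}" and M: "0 \<le> M"
    and c: "\<And>r j. (r, j) \<in> \<R> \<times> {..n} - F \<Longrightarrow> lf_abs (coef n f r j) \<le> M"
    and k: "k \<le> n" "xs \<in> dlists k \<O>"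
  shows "lf_abs (Phi (\<lambda>x. f x - wavelet_sum n F (\<lambda>(r, j). coef n f r j) x) xs) \<le> M"
proof (rule lf_abs_lim_le)
  let ?c = "\<lambda>(r, j). coef n f r j"
  show "(\<lambda>m. Phi (\<lambda>x. wavelet_sum n (dig m \<times> {..n}) ?c x - wavelet_sum n F ?c x) xs) \<longlonglongrightarrow>
      Phi (\<lambda>x. f x - wavelet_sum n F ?c x) xs"
    by (intro tendsto_Phi tendsto_diff tendsto_const wavelet_expansion_pointwise[OF f])
  show "\<forall>\<^sub>F m in sequentially. lf_abs (Phi (\<lambda>x. wavelet_sum n (dig m \<times> {..n}) ?c x - wavelet_sum n F ?c x) xs) \<le> M"
    using finite_subset_digits[OF F]
  proof eventually_elim
    case (elim m)
    have fin: "finite (dig m \<times> {..n})" by (simp add: finite_digits)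
    have sub: "dig m \<times> {..n} - F \<subseteq> \<R> \<times> {..n}"
      by (auto simp: digits_iff)
    have "lf_abs (Phi (wavelet_sum n (dig m \<times> {..n} - F) ?c) xs) \<le> M"
    proof (rule Phi_wavelet_sum_le[OF sub _ M k])
      fix i assume i: "i \<in> dig m \<times> {..n} - F"
      then have "(fst i, snd i) \<in> \<R> \<times> {..n} - F"
        using sub by (cases i) auto
      from c[OF this] show "lf_abs (?c i) \<le> M"
        by (simp add: case_prod_beta)
    qed
    then show ?case
      unfolding wavelet_sum_diff[OF fin elim] .
  qed
qed simp

text \<open>A quotient of order \<open>n + 1\<close> of a wavelet is at most
  \<open>1 / lf_abs (\<gamma> r)\<close>, which the bound on the coefficient absorbs. All other
  wavelets are polynomials of degree at most \<open>n\<close>, or zero, on the ball and contribute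
  nothing.\<close>

lemma Phi_le_near:
  assumes f: "f \<in> Cspace n" and M: "0 \<le> M"
    and c: "\<And>r j. r \<in> \<R>p \<Longrightarrow> r \<in> uball a (\<rho> ^ m) \<Longrightarrow> m < lg r \<Longrightarrow> j \<le> n \<Longrightarrow> lf_abs (coef n f r j) \<le> M * lf_abs (\<gamma> r)"
    and xs: "xs \<in> dlists (Suc n) (uball a (\<rho> ^ m))"
  shows "lf_abs (Phi f xs) \<le> M"
proof (rule lf_abs_lim_le)
  let ?c = "\<lambda>(r, j). coef n f r j"
  show "(\<lambda>N. Phi (wavelet_sum n (dig N \<times> {..n}) ?c) xs) \<longlonglongrightarrow> Phi f xs"
    by (intro tendsto_Phi wavelet_expansion_pointwise[OF f])
  have "lf_abs (Phi (wavelet_sum n (dig N \<times> {..n}) ?c) xs) \<le> M" for N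
    unfolding Phi_wavelet_sum
  proof (rule lf_abs_sum_leI[OF M])
    fix i assume "i \<in> dig N \<times> {..n}"
    then have "fst i \<in> \<R>" "snd i \<le> n"
      using digits_iff[of "fst i" N] by auto
    then obtain r j where i: "i = (r, j)" "r \<in> \<R>" "j \<le> n"
      by (cases i) simp
    show "lf_abs (?c i * Phi (wav n (fst i) (snd i)) xs) \<le> M"
    proof (cases "r \<in> uball a (\<rho> ^ m) \<and> m < lg r")
      case True
      then have "r \<in> \<R>p" using i(2) by (auto simp: fin_exp_plus_iff)
      have O: "xs \<in> dlists (Suc n) \<O>"
        using xs by (rule dlists_mono[rotated]) (auto simp: uball_def)
      define g where "g = lf_abs (\<gamma> r)"
      have g: "0 < g" using gam_pos[OF i(2)] by (simp add: g_def)
      have "lf_abs (Phi (wav n r j) xs) * g ^ Suc n \<le> g ^ n"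
        unfolding g_def by (rule Phi_wavelet_le[OF i(2,3) O])
      then have "(lf_abs (Phi (wav n r j) xs) * g) * g ^ n \<le> 1 * g ^ n"
        by (simp add: mult_ac)
      then have P: "lf_abs (Phi (wav n r j) xs) * g \<le> 1"
        using g mult_right_le_imp_le[OF _ zero_less_power[OF g, of n]] by blast
      have "lf_abs (coef n f r j) * lf_abs (Phi (wav n r j) xs) \<le> (M * g) * lf_abs (Phi (wav n r j) xs)"
        using c[OF \<open>r \<in> \<R>p\<close> _ _ i(3)] True unfolding g_def by (intro mult_right_mono) simp_all
      also have "\<dots> = M * (lf_abs (Phi (wav n r j) xs) * g)"
        by (simp add: mult_ac)
      also have "\<dots> \<le> M * 1"
        using P M by (intro mult_left_mono)
      finally show ?thesis
        by (simp add: i lf_abs_mult)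
    next
      case False
      then have "Phi (wav n r j) xs = 0"
        using i by (intro Phi_wavelet_eq_0[OF i(2) _ xs]) auto
      then show ?thesis using M by (simp add: i)
    qed
  qed
  then show "\<forall>\<^sub>F N in sequentially. lf_abs (Phi (wavelet_sum n (dig N \<times> {..n}) ?c) xs) \<le> M"
    by simp
qed simp


subsection \<open>Limits along finite expansions\<close>

text \<open>Only finitely many expansions have length at most \<open>m\<close>; close enough to
  \<open>a\<close>, and different from it, every expansion is longer and therefore close to its
  predecessor.\<close>

lemma eventually_pred_close:
  assumes a: "a \<in> \<O>" and "0 < d"
  shows "\<forall>\<^sub>F r in atp a. r \<in> \<R>p \<and> r \<in> uball a d \<and> pr r \<in> uball a d"
proof -
  obtain m where m: "\<rho> ^ m \<le> d"
    using uniformizer_power_small[OF unif \<open>0 < d\<close>] by blast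
  obtain e where e: "0 < e" "\<And>x y. x \<in> insert a (dig m) \<Longrightarrow> y \<in> insert a (dig m) \<Longrightarrow> x \<noteq> y \<Longrightarrow> e < lf_abs (x - y)"
    by (rule finite_separation[of "insert a (dig m)"]) (simp_all add: finite_digits)
  have "r \<in> uball a d \<and> pr r \<in> uball a d" if r: "r \<in> \<R>p" "r \<noteq> a" "dist r a < min e d" for r
  proof -
    have "lf_abs (r - a) < e" "lf_abs (r - a) \<le> d"
      using r(3) by (auto simp: dist_lf_abs)
    then have "r \<notin> dig m"
      using e(2)[of r a] r(2) by auto
    then have "m \<le> lg r - 1"
      using r(1) digits_iff[of r m] by (auto simp: fin_exp_plus_iff)
    then have "lf_abs (r - pr r) \<le> d"
      using rho_mono[of m "lg r - 1"] m gam_abs_pred[OF r(1)] by simp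
    then have "lf_abs (pr r - a) \<le> d"
      using lf_abs_diff_trans[of "pr r" r d a] \<open>lf_abs (r - a) \<le> d\<close> by (simp add: lf_abs_commute)
    then show ?thesis
      using \<open>lf_abs (r - a) \<le> d\<close> pred_integers[OF r(1)] fin_exp_plus_integers[OF r(1)] by (simp add: uball_def)
  qed
  then show ?thesis
    unfolding eventually_at using e(1) \<open>0 < d\<close> by (intro exI[of _ "min e d"]) auto
qed

lemma pred_tendsto:
  assumes "a \<in> \<O>"
  shows "(pr \<longlongrightarrow> a) (atp a)"
  unfolding tendsto_lf_abs_iff
proof (intro allI impI)
  fix e :: real assume "0 < e"
  from eventually_pred_close[OF assms this]
  show "\<forall>\<^sub>F r in atp a. lf_abs (pr r - a) \<le> e"
    by eventually_elim (simp add: uball_def)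
qed

lemma eventually_fin_exp_plus: "a \<in> \<O> \<Longrightarrow> \<forall>\<^sub>F r in atp a. r \<in> \<R>p"
  using eventually_pred_close[of a 1] by (auto elim: eventually_mono)

lemma psi_tendsto:
  assumes f: "f \<in> Cspace (Suc k)" and a: "a \<in> \<O>"
  shows "((\<lambda>r. psi k f r (pr r)) \<longlongrightarrow> Dq (Suc k) f a) (atp a)"
  unfolding tendsto_lf_abs_iff
proof (intro allI impI)
  fix e :: real assume "0 < e"
  then obtain d where d: "0 < d"
    "\<And>xs. xs \<in> dlists (Suc k) (uball a d) \<Longrightarrow> lf_abs (Phi f xs - Dq (Suc k) f a) \<le> e"
    using Phi_tendsto_Dq[OF f a order_refl] unfolding Phi_tendsto_def by metis
  from eventually_pred_close[OF a d(1)]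
  show "\<forall>\<^sub>F r in atp a. lf_abs (psi k f r (pr r) - Dq (Suc k) f a) \<le> e"
  proof eventually_elim
    case (elim r)
    then show ?case
      using pred_neq[of r] \<open>0 < e\<close> by (intro psi_near_diagonal[OF f d(1) _ _ _ d(2)]) auto
  qed
qed

text \<open>Splits off the last Taylor term. It turns a coefficient, which involves
  \<open>psi (n - j)\<close>, into \<open>psi (n - 1 - j)\<close>, the quantity that is controlled
  in \<open>C^n\<close> and occurs in its norm.\<close>

lemma psi_Suc_eq:
  assumes "(f :: 'k \<Rightarrow> 'k) \<in> Cspace n" "x \<noteq> y"
  shows "(x - y) * psi (Suc k) f x y = psi k f x y - Dq (Suc k) f y"
proof -
  have "d * ((a - (s + p * c)) / (d * p)) = (a - s) / p - c" if "d \<noteq> 0" "p \<noteq> 0" for a c d p s :: 'k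
    using that by (simp add: field_simps)
  from this[of "x - y" "(x - y) ^ Suc k"] show ?thesis
    using assms(2) unfolding psi_eq[OF assms(1)] sum.atMost_Suc power_Suc[of _ "Suc k"] by simp
qed

lemma coef_last:
  "f \<in> Cspace n \<Longrightarrow> r \<in> \<R>p \<Longrightarrow> coef n f r n = Dq n f r - Dq n f (pr r)"
  using coef_eq[of f n r n] by simp

lemma coef_less:
  assumes f: "f \<in> Cspace n" and r: "r \<in> \<R>p" and j: "j < n"
  shows "coef n f r j = psi (n - 1 - j) (Dq j f) r (pr r) - of_nat (n choose j) * Dq n f (pr r)"
proof -
  obtain k where k: "n - j = Suc k" "n - 1 - j = k" "Suc k + j = n"
    using j by (cases "n - j") auto
  have "coef n f r j = (r - pr r) * psi (Suc k) (Dq j f) r (pr r)"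
    using r by (simp add: coef_def k(1) gam_plus fin_exp_plus_iff)
  also have "\<dots> = psi k (Dq j f) r (pr r) - Dq (Suc k) (Dq j f) (pr r)"
    using j by (intro psi_Suc_eq[OF Dq_in_Cspace[OF f] pred_neq[OF r]]) simp
  also have "Dq (Suc k) (Dq j f) (pr r) = of_nat (n choose j) * Dq n f (pr r)"
    using Dq_Dq[OF f, of "Suc k" j "pr r"] pred_integers[OF r] k by simp
  finally show ?thesis unfolding k(2) .
qed

text \<open>\<open>psi (n - j) (Dq j f)\<close> is one order beyond the smoothness of
  \<open>f\<close>, but the factor \<open>\<gamma> r\<close> lowers it: for \<open>j < n\<close>,
  \<open>psi (n - 1 - j) (Dq j f)\<close> tends to \<open>(n choose j) * Dq n f a\<close>, and the
  subtracted term has the same limit by continuity of \<open>Dq n f\<close>.\<close>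

lemma coef_tendsto_0:
  assumes f: "f \<in> Cspace n" and a: "a \<in> \<O>" and j: "j \<le> n"
  shows "((\<lambda>r. coef n f r j) \<longlongrightarrow> 0) (atp a)"
proof -
  have D: "Dq n f \<in> Cspace 0"
    using Dq_in_Cspace[OF f, of n] by simp
  have evr: "\<forall>\<^sub>F r in atp a. r \<in> \<O>" "\<forall>\<^sub>F r in atp a. pr r \<in> \<O>"
    using eventually_fin_exp_plus[OF a] by (eventually_elim, simp add: fin_exp_plus_integers pred_integers)+
  have lim: "((\<lambda>r. Dq n f (pr r)) \<longlongrightarrow> Dq n f a) (atp a)"
    "((\<lambda>r. Dq n f r) \<longlongrightarrow> Dq n f a) (atp a)"
    by (rule Cspace_continuous[OF D a pred_tendsto[OF a] evr(2)],
        rule Cspace_continuous[OF D a tendsto_ident_at evr(1)])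
  show ?thesis
  proof (cases "j = n")
    case True
    have "((\<lambda>r. Dq n f r - Dq n f (pr r)) \<longlongrightarrow> Dq n f a - Dq n f a) (atp a)"
      by (intro tendsto_diff lim)
    moreover have "\<forall>\<^sub>F r in atp a. Dq n f r - Dq n f (pr r) = coef n f r j"
      using eventually_fin_exp_plus[OF a] by eventually_elim (simp add: True coef_last[OF f])
    ultimately show ?thesis
      using Lim_transform_eventually by fastforce
  next
    case False
    then have j': "j < n" using j by simp
    then obtain k where k: "n - j = Suc k" "n - 1 - j = k" "Suc k + j = n"
      by (cases "n - j") auto
    have "Dq j f \<in> Cspace (Suc k)"
      using Dq_in_Cspace[OF f j] k by simp
    from psi_tendsto[OF this a]
    have "((\<lambda>r. psi k (Dq j f) r (pr r)) \<longlongrightarrow> of_nat (n choose j) * Dq n f a) (atp a)"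
      using Dq_Dq[OF f, of "Suc k" j a] a k by simp
    then have "((\<lambda>r. psi k (Dq j f) r (pr r) - of_nat (n choose j) * Dq n f (pr r)) \<longlongrightarrow>
        of_nat (n choose j) * Dq n f a - of_nat (n choose j) * Dq n f a) (atp a)"
      by (intro tendsto_diff tendsto_mult tendsto_const lim)
    moreover have "\<forall>\<^sub>F r in atp a.
        psi k (Dq j f) r (pr r) - of_nat (n choose j) * Dq n f (pr r) = coef n f r j"
      using eventually_fin_exp_plus[OF a] by eventually_elim (rule coef_less[OF f _ j', unfolded k(2), symmetric])
    ultimately show ?thesis
      using Lim_transform_eventually by fastforce
  qed
qed

lemma coef_null:
  assumes f: "f \<in> Cspace n"
  shows "null_family (\<R> \<times> {..n}) (\<lambda>(r, j). coef n f r j)"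
  unfolding null_family_def
proof (intro allI impI)
  fix e :: real assume "0 < e"
  have fin: "finite {r \<in> \<R>p. e \<le> lf_abs (coef n f r j)}" if j: "j \<le> n" for j
  proof (rule ccontr)
    assume "infinite {r \<in> \<R>p. e \<le> lf_abs (coef n f r j)}"
    moreover have "{r \<in> \<R>p. e \<le> lf_abs (coef n f r j)} \<subseteq> \<O>"
      using fin_exp_plus_integers by blast
    ultimately obtain a where a: "a \<in> \<O>" "a islimpt {r \<in> \<R>p. e \<le> lf_abs (coef n f r j)}"
      using Heine_Borel_imp_Bolzano_Weierstrass[OF compact_integers] by blast
    have "\<forall>\<^sub>F r in atp a. lf_abs (coef n f r j - 0) \<le> e / 2"
      using coef_tendsto_0[OF f a(1) j] \<open>0 < e\<close> unfolding tendsto_lf_abs_iff by (meson half_gt_zero)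
    then obtain d where d: "0 < d" "\<And>r. r \<in> \<R>p \<Longrightarrow> r \<noteq> a \<Longrightarrow> dist r a < d \<Longrightarrow> lf_abs (coef n f r j) \<le> e / 2"
      unfolding eventually_at by auto
    obtain r where "r \<in> \<R>p" "e \<le> lf_abs (coef n f r j)" "r \<noteq> a" "dist r a < d"
      using a(2) d(1) unfolding islimpt_approachable by blast
    then show False
      using d(2)[of r] \<open>0 < e\<close> by simp
  qed
  have "{i \<in> \<R> \<times> {..n}. e \<le> lf_abs ((\<lambda>(r, j). coef n f r j) i)} \<subseteq>
      (\<Union>j\<le>n. ({0} \<union> {r \<in> \<R>p. e \<le> lf_abs (coef n f r j)}) \<times> {j})"
    by (auto simp: fin_exp_plus_iff)
  then show "finite {i \<in> \<R> \<times> {..n}. e \<le> lf_abs ((\<lambda>(r, j). coef n f r j) i)}"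
    by (rule finite_subset) (use fin in auto)
qed

text \<open>Uniqueness of limits along \<open>fin_exp_plus\<close>, and the passage of bounds to
  them, require a nontrivial filter.\<close>

lemma at_within_fin_exp_plus_nontrivial:
  assumes "a \<in> \<O>"
  shows "atp a \<noteq> bot"
proof -
  have "a islimpt \<R>p"
    unfolding islimpt_approachable
  proof (intro allI impI)
    fix e :: real assume "0 < e"
    then obtain m where m: "\<rho> ^ m \<le> e / 2"
      using uniformizer_power_small[OF unif, of "e / 2"] by auto
    have "infinite (uball a (\<rho> ^ m) - {a, 0})"
      using infinite_uball[OF _ assms, of "\<rho> ^ m"] rho by simp
    \<comment> \<open>A nearby \<open>b\<close> other than \<open>a\<close> and 0, truncated more
      finely than its distances to both, yields an expansion different from \<open>a\<close> and
      from 0, the latter being excluded from \<open>fin_exp_plus\<close>.\<close>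
    then obtain b where "b \<in> uball a (\<rho> ^ m) - {a, 0}"
      using infinite_imp_nonempty by blast
    then have b: "b \<in> \<O>" "lf_abs (b - a) \<le> \<rho> ^ m" "b \<noteq> a" "b \<noteq> 0"
      by (auto simp: uball_def)
    have pos: "0 < lf_abs (b - a)" "0 < lf_abs b"
      using b by auto
    then have "0 < min (\<rho> ^ m) (min (lf_abs (b - a) / 2) (lf_abs b / 2))"
      using rho by simp
    from uniformizer_power_small[OF unif this]
    obtain k where k: "\<rho> ^ k \<le> \<rho> ^ m" "\<rho> ^ k \<le> lf_abs (b - a) / 2" "\<rho> ^ k \<le> lf_abs b / 2"
      unfolding min.bounded_iff by blast
    define r where "r = trunc k b"
    have r: "r \<in> \<R>" "lf_abs (b - r) \<le> \<rho> ^ k"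
      using trunc[OF b(1), of k] fin_exp_iff unfolding r_def by auto
    have "lf_abs (b - r) < lf_abs (b - a)" "lf_abs (b - r) < lf_abs (b - 0)"
      using r(2) k(2,3) pos by (simp_all del: lf_abs_pos)
    then have "r \<noteq> a" "r \<noteq> 0"
      by blast+
    moreover have "lf_abs (r - a) \<le> \<rho> ^ m"
      using lf_abs_diff_trans[of r b "\<rho> ^ m" a] b(2) r(2) k(1) by (simp add: lf_abs_commute)
    then have "dist r a < e"
      using m \<open>0 < e\<close> by (simp add: dist_lf_abs)
    ultimately show "\<exists>r\<in>\<R>p. r \<noteq> a \<and> dist r a < e"
      using r(1) by (auto simp: fin_exp_plus_iff)
  qed
  then show ?thesis
    by (simp add: trivial_limit_within)
qed

end


section \<open>The norm, its completeness and convergence of the expansion\<close>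

lemma ennreal_tendsto_0_iff:
  "((f :: 'a \<Rightarrow> ennreal) \<longlongrightarrow> 0) F \<longleftrightarrow> (\<forall>e>0. \<forall>\<^sub>F x in F. f x \<le> ennreal e)"
proof
  assume f: "(f \<longlongrightarrow> 0) F"
  show "\<forall>e>0. \<forall>\<^sub>F x in F. f x \<le> ennreal e"
  proof (intro allI impI)
    fix e :: real assume "0 < e"
    then have "\<forall>\<^sub>F x in F. f x < ennreal e"
      by (intro order_tendstoD(2)[OF f]) simp
    then show "\<forall>\<^sub>F x in F. f x \<le> ennreal e"
      by eventually_elim simp
  qed
next
  assume f: "\<forall>e>0. \<forall>\<^sub>F x in F. f x \<le> ennreal e"
  show "(f \<longlongrightarrow> 0) F"
  proof (rule order_tendstoI)
    fix a :: ennreal assume "0 < a"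
    then obtain b where b: "0 < b" "b < a" using dense by blast
    then have "b < top" using order_less_le_trans top_greatest by blast
    then have "ennreal (enn2real b) = b" by simp
    moreover have "0 < enn2real b"
      using b \<open>b < top\<close> by (simp add: enn2real_positive_iff)
    ultimately have "\<forall>\<^sub>F x in F. f x \<le> b" using f by metis
    then show "\<forall>\<^sub>F x in F. f x < a"
      by eventually_elim (use b in simp)
  qed simp
qed

text \<open>Bounds all orders up to \<open>n\<close> at once. For \<open>f\<close> in
  \<open>Cspace n\<close> and \<open>0 \<le> M\<close> it stands in for
  \<open>Cnrm n f \<le> ennreal M\<close>, by \<open>Cnorm_le_iff\<close>.\<close>

definition Phi_bounded :: "nat \<Rightarrow> ('k::local_field \<Rightarrow> 'k) \<Rightarrow> real \<Rightarrow> bool" where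
  "Phi_bounded n f M \<longleftrightarrow> (\<forall>k\<le>n. \<forall>xs\<in>dlists k \<O>. lf_abs (Phi f xs) \<le> M)"

lemma Phi_boundedD: "Phi_bounded n f M \<Longrightarrow> k \<le> n \<Longrightarrow> xs \<in> dlists k \<O> \<Longrightarrow> lf_abs (Phi f xs) \<le> M"
  by (simp add: Phi_bounded_def)

lemma Phi_bounded_add: "Phi_bounded n f M \<Longrightarrow> Phi_bounded n g M \<Longrightarrow> Phi_bounded n (\<lambda>x. f x + g x) M"
  by (simp add: Phi_bounded_def Phi_add lf_abs_add_leI)

lemma Phi_bounded_cmult: "Phi_bounded n f M \<Longrightarrow> Phi_bounded n (\<lambda>x. c * f x) (lf_abs c * M)"
  by (simp add: Phi_bounded_def Phi_cmult lf_abs_mult mult_left_mono)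

lemma Phi_bounded_value: "Phi_bounded n f M \<Longrightarrow> x \<in> \<O> \<Longrightarrow> lf_abs (f x) \<le> M"
  using Phi_boundedD[of n f M 0 "[x]"] by (simp add: dlists_def)

lemma Dq_le:
  assumes "f \<in> Cspace n" "Phi_bounded n f M" "j \<le> n" "a \<in> \<O>"
  shows "lf_abs (Dq j f a) \<le> M"
proof (rule Phi_tendsto_bound[OF Phi_tendsto_Dq[OF assms(1,4,3)], of 0 1])
  show "a \<in> uball 0 1" using assms(4) by (simp add: uball_0_1)
  show "lf_abs (Phi f xs) \<le> M" if "xs \<in> dlists j (uball 0 1)" for xs
    using Phi_boundedD[OF assms(2,3)] that by (simp add: uball_0_1)
qed simp

lemma Cspace_dlists_bound_Dq:
  assumes f: "f \<in> Cspace n" and M: "Phi_bounded n f M" "0 \<le> M" and j: "j \<le> n"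
    and ys: "ys \<in> dlists (n - j) \<O>"
  shows "lf_abs (Phi (Dq j f) ys) \<le> M"
proof (rule Phi_derivative_le[of 1 0 j f "Dq j f" "n - j" M])
  show "Phi_tendsto j f y (Dq j f y)" if "y \<in> uball 0 1" for y
    using that by (intro Phi_tendsto_Dq[OF f _ j]) (simp add: uball_0_1)
  show "lf_abs (Phi f xs) \<le> M" if "xs \<in> dlists (n - j + j) (uball 0 1)" for xs
    using Phi_boundedD[OF M(1) order_refl] that j by (simp add: uball_0_1)
qed (use M ys in \<open>simp_all add: uball_0_1\<close>)

context wavelet_setup
begin

lemma Cnorm_le:
  assumes f: "f \<in> Cspace n" and M: "Phi_bounded n f M" "0 \<le> M"
  shows "Cnrm n f \<le> ennreal M"
proof (cases "n = 0")
  case True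
  then show ?thesis
    using Phi_bounded_value[OF M(1)] by (auto simp: Cnorm_def intro!: SUP_least ennreal_leI)
next
  case False
  have 1: "lf_abs (Dq j f 0) \<le> M" if "j \<le> n - 1" for j
    using that by (intro Dq_le[OF f M(1)]) auto
  have 2: "lf_abs (psi (n - 1 - j) (Dq j f) r (pr r)) \<le> M" if r: "r \<in> \<R>p" and j: "j \<le> n - 1" for r j
  proof -
    have k: "Suc (n - 1 - j) = n - j" "j \<le> n" using j False by auto
    show ?thesis
    proof (rule psi_le)
      show "Dq j f \<in> Cspace (Suc (n - 1 - j))"
        unfolding k(1) by (rule Dq_in_Cspace[OF f k(2)])
      show "lf_abs (Phi (Dq j f) xs) \<le> M" if "xs \<in> dlists (Suc (n - 1 - j)) \<O>" for xs
        using that unfolding k(1) by (rule Cspace_dlists_bound_Dq[OF f M k(2)])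
    qed (use r pred_neq pred_integers fin_exp_plus_integers M in auto)
  qed
  show ?thesis
    unfolding Cnorm_def if_not_P[OF False]
  proof (rule Sup_least)
    fix y assume "y \<in> {ennreal (lf_abs (Dq j f 0)) | j. j \<le> n - 1} \<union>
      {ennreal (lf_abs (psi (n - 1 - j) (Dq j f) r (pr r))) | r j. r \<in> \<R>p \<and> j \<le> n - 1}"
    then consider j where "j \<le> n - 1" "y = ennreal (lf_abs (Dq j f 0))"
      | r j where "r \<in> \<R>p" "j \<le> n - 1" "y = ennreal (lf_abs (psi (n - 1 - j) (Dq j f) r (pr r)))"
      by blast
    then show "y \<le> ennreal M"
      by cases (simp_all only: 1 2 ennreal_leI)
  qed
qed

lemma Cnorm_leD:
  assumes "Cnrm n f \<le> ennreal M" "0 \<le> M"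
  shows "n = 0 \<Longrightarrow> x \<in> \<O> \<Longrightarrow> lf_abs (f x) \<le> M"
    and "j < n \<Longrightarrow> lf_abs (Dq j f 0) \<le> M"
    and "r \<in> \<R>p \<Longrightarrow> j < n \<Longrightarrow> lf_abs (psi (n - 1 - j) (Dq j f) r (pr r)) \<le> M"
proof -
  show "lf_abs (f x) \<le> M" if "n = 0" "x \<in> \<O>"
  proof -
    have "ennreal (lf_abs (f x)) \<le> Cnrm n f"
      using that by (auto simp: Cnorm_def intro: SUP_upper)
    also note assms(1)
    finally show ?thesis using assms(2) by simp
  qed
  show "lf_abs (Dq j f 0) \<le> M" if "j < n"
  proof -
    have "ennreal (lf_abs (Dq j f 0)) \<le> Cnrm n f"
      unfolding Cnorm_def using that by (auto intro!: Sup_upper)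
    also note assms(1)
    finally show ?thesis using assms(2) by simp
  qed
  show "lf_abs (psi (n - 1 - j) (Dq j f) r (pr r)) \<le> M" if "r \<in> \<R>p" "j < n"
  proof -
    have n: "n \<noteq> 0" "j \<le> n - 1" using that by auto
    have "ennreal (lf_abs (psi (n - 1 - j) (Dq j f) r (pr r))) \<le> Cnrm n f"
      unfolding Cnorm_def if_not_P[OF n(1)] using that(1) n(2) by (intro Sup_upper UnI2) blast
    also note assms(1)
    finally show ?thesis using assms(2) by simp
  qed
qed

text \<open>\<open>Dq n f\<close> does not occur in the norm for \<open>n > 0\<close>; it is bounded
  as a limit of \<open>psi (n - 1) f\<close> along \<open>fin_exp_plus\<close>. Then
  \<open>coef_last\<close> and \<open>coef_less\<close> express the coefficients by bounded
  quantities, the binomial coefficients having absolute value at most 1.\<close>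

lemma coef_le:
  assumes f: "f \<in> Cspace n" and M: "Cnrm n f \<le> ennreal M" "0 \<le> M"
    and r: "r \<in> \<R>" and j: "j \<le> n"
  shows "lf_abs (coef n f r j) \<le> M"
proof -
  have top: "lf_abs (Dq n f a) \<le> M" if a: "a \<in> \<O>" for a
  proof (cases n)
    case 0
    then show ?thesis
      using Cnorm_leD(1)[OF M _ a] Dq_0[OF f] by simp
  next
    case (Suc k)
    show ?thesis
    proof (rule lf_abs_lim_le)
      show "((\<lambda>r. psi k f r (pr r)) \<longlongrightarrow> Dq n f a) (atp a)"
        unfolding Suc by (rule psi_tendsto[OF f[unfolded Suc] a])
      show "\<forall>\<^sub>F r in atp a. lf_abs (psi k f r (pr r)) \<le> M"
        using eventually_fin_exp_plus[OF a]
        by eventually_elim (use Cnorm_leD(3)[OF M, of _ 0] Suc Dq_0[OF f] in simp)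
    qed (rule at_within_fin_exp_plus_nontrivial[OF a])
  qed
  show ?thesis
  proof (cases "r = 0")
    case True
    then show ?thesis
      using top[of 0] Cnorm_leD(2)[OF M, of j] j by (cases "j = n") (simp_all add: coef_def)
  next
    case False
    then have rp: "r \<in> \<R>p" using r by (simp add: fin_exp_plus_iff)
    show ?thesis
    proof (cases "j = n")
      case True
      then show ?thesis
        using coef_last[OF f rp] top[OF fin_exp_plus_integers[OF rp]] top[OF pred_integers[OF rp]]
        by (simp add: lf_abs_diff_leI)
    next
      case False
      then have jn: "j < n" using j by simp
      have "lf_abs (of_nat (n choose j) * Dq n f (pr r)) \<le> 1 * M"
        unfolding lf_abs_mult using top[OF pred_integers[OF rp]]
        by (intro mult_mono lf_abs_of_nat_le) auto
      then show ?thesis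
        unfolding coef_less[OF f rp jn] using Cnorm_leD(3)[OF M rp jn] by (intro lf_abs_diff_leI) auto
    qed
  qed
qed

lemma Phi_bounded_coef:
  assumes f: "f \<in> Cspace n" and M: "0 \<le> M" "\<And>r j. r \<in> \<R> \<Longrightarrow> j \<le> n \<Longrightarrow> lf_abs (coef n f r j) \<le> M"
  shows "Phi_bounded n f M"
  unfolding Phi_bounded_def
proof (intro allI impI ballI)
  fix k xs assume "k \<le> n" "xs \<in> dlists k (\<O> :: 'k set)"
  from Phi_remainder_le[OF f finite.emptyI _ M(1) _ this] M(2)
  show "lf_abs (Phi f xs) \<le> M"
    by (simp add: wavelet_sum_def)
qed

text \<open>Closes a circle: bounded quotients bound the norm, the norm bounds the coefficients, and
  these bound the quotients. Norm axioms and completeness can then be checked on difference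
  quotients, which are linear in \<open>f\<close>.\<close>

lemma Cnorm_le_iff:
  assumes "f \<in> Cspace n" "0 \<le> M"
  shows "Cnrm n f \<le> ennreal M \<longleftrightarrow> Phi_bounded n f M"
  using Cnorm_le[OF assms(1) _ assms(2)] Phi_bounded_coef[OF assms] coef_le[OF assms(1) _ assms(2)] by blast

lemma Cnorm_finite:
  assumes f: "f \<in> Cspace n"
  shows "Cnrm n f < \<infinity>"
proof -
  define B where "B = {i \<in> \<R> \<times> {..n}. 1 \<le> lf_abs ((\<lambda>(r, j). coef n f r j) i)}"
  have "finite B"
    using coef_null[OF f] unfolding null_family_def B_def by (meson zero_less_one)
  \<comment> \<open>Finitely many coefficients reach 1; the inserted 1 bounds all others and keeps
    the maximum defined.\<close>
  define M where "M = Max (insert 1 ((\<lambda>(r, j). lf_abs (coef n f r j)) ` B))"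
  have M: "0 \<le> M" "1 \<le> M" "\<And>i. i \<in> B \<Longrightarrow> (\<lambda>(r, j). lf_abs (coef n f r j)) i \<le> M"
    using \<open>finite B\<close> unfolding M_def by (auto intro!: Max_ge simp: Max_ge_iff)
  have "lf_abs (coef n f r j) \<le> M" if "r \<in> \<R>" "j \<le> n" for r j
  proof (cases "(r, j) \<in> B")
    case True
    from M(3)[OF this] show ?thesis by simp
  next
    case False
    then show ?thesis using that M(2) by (simp add: B_def)
  qed
  from Phi_bounded_coef[OF f M(1) this] have "Cnrm n f \<le> ennreal M"
    using Cnorm_le_iff[OF f M(1)] by blast
  then show ?thesis
    using ennreal_less_top order_le_less_trans by (metis infinity_ennreal_def)
qed

lemma Cnorm_real:
  assumes "f \<in> Cspace n"
  obtains M where "0 \<le> M" "Cnrm n f = ennreal M" "Phi_bounded n f M"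
proof
  have "Cnrm n f < top"
    using Cnorm_finite[OF assms] by simp
  then show eq: "Cnrm n f = ennreal (enn2real (Cnrm n f))"
    by simp
  then show "Phi_bounded n f (enn2real (Cnrm n f))"
    using Cnorm_le_iff[OF assms, of "enn2real (Cnrm n f)"] by simp
qed simp

lemma Cnorm_add_le:
  assumes "f \<in> Cspace n" "g \<in> Cspace n" "0 \<le> M" "Cnrm n f \<le> ennreal M" "Cnrm n g \<le> ennreal M"
  shows "Cnrm n (\<lambda>x. f x + g x) \<le> ennreal M"
  using assms Cnorm_le_iff[OF Cspace_add[OF assms(1,2)] assms(3)] Phi_bounded_add
  by (simp add: Cnorm_le_iff)

lemma Cnorm_cmult_le:
  assumes f: "f \<in> Cspace n"
  shows "Cnrm n (\<lambda>x. c * f x) \<le> ennreal (lf_abs c) * Cnrm n f"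
proof -
  obtain M where M: "0 \<le> M" "Cnrm n f = ennreal M" "Phi_bounded n f M"
    by (rule Cnorm_real[OF f])
  then have "Cnrm n (\<lambda>x. c * f x) \<le> ennreal (lf_abs c * M)"
    by (simp add: Cnorm_le_iff[OF Cspace_cmult[OF f]] Phi_bounded_cmult)
  then show ?thesis
    using M by (simp add: ennreal_mult)
qed

lemma Cnorm_cmult:
  assumes f: "f \<in> Cspace n"
  shows "Cnrm n (\<lambda>x. c * f x) = ennreal (lf_abs c) * Cnrm n f"
proof (cases "c = 0")
  case True
  then show ?thesis
    using Cnorm_cmult_le[OF f, of 0] by simp
next
  case False
  \<comment> \<open>The reverse inequality comes from scaling back by
    \<open>inverse c\<close>.\<close>
  have "ennreal (lf_abs c) * Cnrm n (\<lambda>x. inverse c * (c * f x)) \<le>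
      ennreal (lf_abs c) * (ennreal (lf_abs (inverse c)) * Cnrm n (\<lambda>x. c * f x))"
    by (intro mult_left_mono Cnorm_cmult_le[OF Cspace_cmult[OF f]]) simp
  also have "\<dots> = Cnrm n (\<lambda>x. c * f x)"
    using False by (simp add: lf_abs_inverse mult.assoc[symmetric] flip: ennreal_mult)
  finally have "ennreal (lf_abs c) * Cnrm n f \<le> Cnrm n (\<lambda>x. c * f x)"
    using False by (simp add: mult.assoc[symmetric])
  then show ?thesis
    using Cnorm_cmult_le[OF f, of c] by (rule antisym[rotated])
qed

lemma Cnorm_eq_0_iff:
  assumes f: "f \<in> Cspace n"
  shows "Cnrm n f = 0 \<longleftrightarrow> f = (\<lambda>_. 0)"
proof
  assume "Cnrm n f = 0"
  then have "Phi_bounded n f 0"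
    using Cnorm_le_iff[OF f, of 0] by simp
  then have "f x = 0" if "x \<in> \<O>" for x
    using Phi_bounded_value[OF _ that] lf_abs_nonneg[of "f x"] by (metis lf_abs_eq_0 order_antisym)
  then show "f = (\<lambda>_. 0)"
    using Cspace_outside[OF f] by blast
next
  assume "f = (\<lambda>_. 0)"
  then have "Phi_bounded n f 0"
    by (simp add: Phi_bounded_def)
  then show "Cnrm n f = 0"
    using Cnorm_le_iff[OF f, of 0] by simp
qed

lemma is_norm_Cnorm: "is_norm (Cspace n) (Cnrm n)"
  unfolding is_norm_def fun_subspace_def
proof (intro conjI ballI allI)
  fix f g :: "'k \<Rightarrow> 'k" assume f: "f \<in> Cspace n" and g: "g \<in> Cspace n"
  obtain M M' where "0 \<le> M" "Cnrm n f = ennreal M" "0 \<le> M'" "Cnrm n g = ennreal M'"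
    using Cnorm_real[OF f] Cnorm_real[OF g] by metis
  moreover from this have "Cnrm n (\<lambda>x. f x + g x) \<le> ennreal (max M M')"
    by (intro Cnorm_add_le[OF f g]) (simp_all add: ennreal_leI)
  ultimately show "Cnrm n (\<lambda>x. f x + g x) \<le> max (Cnrm n f) (Cnrm n g)"
    by (cases "M \<le> M'") (simp_all add: max_def ennreal_leI)
qed (simp_all add: Cspace_zero Cspace_add Cspace_cmult Cnorm_finite[simplified] Cnorm_eq_0_iff Cnorm_cmult)

text \<open>Values converge pointwise, and the \<open>Dq n (s i) a\<close> are Cauchy because bounds
  on quotients pass to \<open>Dq\<close>. The uniform bound on quotients of order \<open>n\<close>
  makes the limit of these numbers the diagonal limit of the limit function.\<close>

lemma Cspace_uniform_limit:
  fixes s :: "nat \<Rightarrow> 'k \<Rightarrow> 'k"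
  assumes s: "\<And>i. s i \<in> Cspace n"
    and C: "\<And>e. 0 < e \<Longrightarrow> \<exists>M. \<forall>i\<ge>M. \<forall>j\<ge>M. Phi_bounded n (\<lambda>x. s i x - s j x) e"
  obtains f where "f \<in> Cspace n" "\<And>e. 0 < e \<Longrightarrow> \<exists>M. \<forall>i\<ge>M. Phi_bounded n (\<lambda>x. s i x - f x) e"
proof -
  have "\<exists>l. (\<lambda>i. s i x) \<longlonglongrightarrow> l" for x
  proof (cases "x \<in> \<O>")
    case True
    have "Cauchy (\<lambda>i. s i x)"
      unfolding Cauchy_lf_iff
    proof (intro allI impI)
      fix e :: real assume "0 < e"
      then obtain M where "\<And>i j. i \<ge> M \<Longrightarrow> j \<ge> M \<Longrightarrow> Phi_bounded n (\<lambda>x. s i x - s j x) (e / 2)"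
        using C[of "e / 2"] by auto
      then have le: "lf_abs (s i x - s j x) \<le> e / 2" if "i \<ge> M" "j \<ge> M" for i j
        using Phi_bounded_value[OF _ True] that by blast
      have "lf_abs (s i x - s j x) < e" if "i \<ge> M" "j \<ge> M" for i j
        using le[OF that] \<open>0 < e\<close> by linarith
      then show "\<exists>M. \<forall>i\<ge>M. \<forall>j\<ge>M. lf_abs (s i x - s j x) < e"
        by blast
    qed
    then show ?thesis using Cauchy_imp_tendsto by blast
  next
    case False
    then show ?thesis
      using Cspace_outside[OF s] by (intro exI[of _ 0]) simp
  qed
  then obtain f where f: "\<And>x. (\<lambda>i. s i x) \<longlonglongrightarrow> f x" by metis
  have close: "\<exists>M. \<forall>i\<ge>M. Phi_bounded n (\<lambda>x. s i x - f x) e" if e: "0 < e" for e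
  proof -
    obtain M where M: "\<And>i j. i \<ge> M \<Longrightarrow> j \<ge> M \<Longrightarrow> Phi_bounded n (\<lambda>x. s i x - s j x) e"
      using C[OF e] by blast
    have "lf_abs (Phi (\<lambda>x. s i x - f x) xs) \<le> e" if "i \<ge> M" "k \<le> n" "xs \<in> dlists k \<O>" for i k xs
    proof (rule lf_abs_lim_le)
      show "(\<lambda>j. Phi (\<lambda>x. s i x - s j x) xs) \<longlonglongrightarrow> Phi (\<lambda>x. s i x - f x) xs"
        by (intro tendsto_Phi tendsto_diff tendsto_const f)
      show "\<forall>\<^sub>F j in sequentially. lf_abs (Phi (\<lambda>x. s i x - s j x) xs) \<le> e"
        using eventually_ge_at_top[of M]
        by eventually_elim (use Phi_boundedD[OF M] that in blast)
    qed simp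
    then show ?thesis by (auto simp: Phi_bounded_def)
  qed
  have "f \<in> Cspace n"
  proof (rule CspaceI)
    fix x :: 'k assume "x \<notin> \<O>"
    then have "(\<lambda>i. s i x) \<longlonglongrightarrow> 0"
      using Cspace_outside[OF s] by simp
    then show "f x = 0" using f LIMSEQ_unique by blast
  next
    fix a :: 'k assume a: "a \<in> \<O>"
    have "Cauchy (\<lambda>i. Dq n (s i) a)"
      unfolding Cauchy_lf_iff
    proof (intro allI impI)
      fix e :: real assume "0 < e"
      then obtain M where M: "\<And>i j. i \<ge> M \<Longrightarrow> j \<ge> M \<Longrightarrow> Phi_bounded n (\<lambda>x. s i x - s j x) (e / 2)"
        using C[of "e / 2"] by auto
      have "lf_abs (Dq n (s i) a - Dq n (s j) a) < e" if "i \<ge> M" "j \<ge> M" for i j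
      proof -
        have "lf_abs (Dq n (s i) a - Dq n (s j) a) \<le> e / 2"
          using Dq_le[OF Cspace_diff[OF s s] M[OF that] order_refl a] Dq_diff[OF s s order_refl a] by simp
        then show ?thesis using \<open>0 < e\<close> by linarith
      qed
      then show "\<exists>M. \<forall>i\<ge>M. \<forall>j\<ge>M. lf_abs (Dq n (s i) a - Dq n (s j) a) < e"
        by blast
    qed
    then obtain L where L: "(\<lambda>i. Dq n (s i) a) \<longlonglongrightarrow> L"
      by (rule Cauchy_imp_tendsto)
    have "Phi_tendsto n f a L"
      unfolding Phi_tendsto_def
    proof (intro allI impI)
      fix e :: real assume e: "0 < e"
      obtain M where M: "\<And>i. i \<ge> M \<Longrightarrow> Phi_bounded n (\<lambda>x. s i x - f x) e"
        using close[OF e] by blast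
      obtain M' where M': "\<And>i. i \<ge> M' \<Longrightarrow> lf_abs (Dq n (s i) a - L) \<le> e"
        using L e unfolding tendsto_lf_abs_iff eventually_sequentially by blast
      define i where "i = max M M'"
      have i: "Phi_bounded n (\<lambda>x. s i x - f x) e" "lf_abs (Dq n (s i) a - L) \<le> e"
        using M M' by (auto simp: i_def)
      obtain d where d: "0 < d" "\<And>xs. xs \<in> dlists n (uball a d) \<Longrightarrow> lf_abs (Phi (s i) xs - Dq n (s i) a) \<le> e"
        using Phi_tendsto_Dq[OF s[of i] a order_refl] e unfolding Phi_tendsto_def by metis
      have "lf_abs (Phi f xs - L) \<le> e" if xs: "xs \<in> dlists n (uball a d)" for xs
      proof -
        have "xs \<in> dlists n \<O>"
          by (rule dlists_mono[OF _ xs]) (auto simp: uball_def)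
        then have "lf_abs (Phi (s i) xs - Phi f xs) \<le> e"
          using Phi_boundedD[OF i(1) order_refl] by (simp add: Phi_diff)
        then have "lf_abs (Phi f xs - Phi (s i) xs) \<le> e"
          by (simp add: lf_abs_commute)
        from lf_abs_diff_trans[OF lf_abs_diff_trans[OF this d(2)[OF xs]] i(2)] show ?thesis .
      qed
      then show "\<exists>d>0. \<forall>xs\<in>dlists n (uball a d). lf_abs (Phi f xs - L) \<le> e"
        using d(1) by blast
    qed
    then show "\<exists>L. Phi_tendsto n f a L" ..
  qed
  then show ?thesis using close by (rule that)
qed

lemma is_Banach_Cnorm: "is_Banach (Cspace n) (Cnrm n)"
  unfolding is_Banach_def
proof (intro conjI allI impI is_norm_Cnorm)
  fix s :: "nat \<Rightarrow> 'k \<Rightarrow> 'k"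
  assume A: "(\<forall>i. s i \<in> Cspace n) \<and> (\<forall>\<epsilon>>0. \<exists>M. \<forall>i\<ge>M. \<forall>j\<ge>M. Cnrm n (\<lambda>x. s i x - s j x) < \<epsilon>)"
  then have s: "s i \<in> Cspace n" for i by blast
  have C: "\<exists>M. \<forall>i\<ge>M. \<forall>j\<ge>M. Phi_bounded n (\<lambda>x. s i x - s j x) e" if e: "0 < e" for e
  proof -
    have "0 < ennreal e" using e by simp
    then obtain M where M: "\<And>i j. i \<ge> M \<Longrightarrow> j \<ge> M \<Longrightarrow> Cnrm n (\<lambda>x. s i x - s j x) < ennreal e"
      using A by blast
    have "Phi_bounded n (\<lambda>x. s i x - s j x) e" if "i \<ge> M" "j \<ge> M" for i j
      using Cnorm_le_iff[OF Cspace_diff[OF s s], of e] less_imp_le[OF M[OF that]] e by simp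
    then show ?thesis by blast
  qed
  obtain f where f: "f \<in> Cspace n" "\<And>e. 0 < e \<Longrightarrow> \<exists>M. \<forall>i\<ge>M. Phi_bounded n (\<lambda>x. s i x - f x) e"
    by (rule Cspace_uniform_limit[OF s C]) blast+
  have "(\<lambda>i. Cnrm n (\<lambda>x. s i x - f x)) \<longlonglongrightarrow> 0"
    unfolding ennreal_tendsto_0_iff eventually_sequentially
  proof (intro allI impI)
    fix e :: real assume e: "0 < e"
    then obtain M where "\<And>i. i \<ge> M \<Longrightarrow> Phi_bounded n (\<lambda>x. s i x - f x) e"
      using f(2) by blast
    then show "\<exists>M. \<forall>i\<ge>M. Cnrm n (\<lambda>x. s i x - f x) \<le> ennreal e"
      using Cnorm_le_iff[OF Cspace_diff[OF s f(1)]] e by (intro exI[of _ M]) simp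
  qed
  with f(1) show "\<exists>f\<in>Cspace n. (\<lambda>i. Cnrm n (\<lambda>x. s i x - f x)) \<longlonglongrightarrow> 0" by blast
qed

lemma norm_has_sum_iff:
  "norm_has_sum N (\<R> \<times> {..n}) (\<lambda>(r, j). wav n r j) c f \<longleftrightarrow>
    (\<forall>e>0. \<exists>F0. finite F0 \<and> F0 \<subseteq> \<R> \<times> {..n} \<and>
      (\<forall>F. finite F \<and> F0 \<subseteq> F \<and> F \<subseteq> \<R> \<times> {..n} \<longrightarrow> N (\<lambda>x. f x - wavelet_sum n F c x) \<le> ennreal e))"
  unfolding norm_has_sum_def ennreal_tendsto_0_iff eventually_finite_subsets_at_top wavelet_sum_def case_prod_beta
  by auto

text \<open>Once \<open>F\<close> contains the finitely many indices whose coefficients reach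
  \<open>e\<close>, all quotients of the remainder are at most \<open>e\<close>. No ordering of the
  indices enters, so the convergence is unconditional.\<close>

lemma wavelet_expansion_coef:
  assumes f: "f \<in> Cspace n"
  shows "norm_has_sum (Cnrm n) (\<R> \<times> {..n}) (\<lambda>(r, j). wav n r j) (\<lambda>(r, j). coef n f r j) f"
  unfolding norm_has_sum_iff
proof (intro allI impI)
  fix e :: real assume e: "0 < e"
  define F0 where "F0 = {i \<in> \<R> \<times> {..n}. e \<le> lf_abs ((\<lambda>(r, j). coef n f r j) i)}"
  have "finite F0"
    using coef_null[OF f] e unfolding null_family_def F0_def by simp
  moreover have "F0 \<subseteq> \<R> \<times> {..n}"
    by (simp add: F0_def)
  moreover have "Cnrm n (\<lambda>x. f x - wavelet_sum n F (\<lambda>(r, j). coef n f r j) x) \<le> ennreal e"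
    if F: "finite F" "F0 \<subseteq> F" "F \<subseteq> \<R> \<times> {..n}" for F
  proof (rule Cnorm_le)
    show "(\<lambda>x. f x - wavelet_sum n F (\<lambda>(r, j). coef n f r j) x) \<in> Cspace n"
      by (rule Cspace_diff[OF f wavelet_sum_Cspace[OF F(3)]])
    have "lf_abs (coef n f r j) \<le> e" if rj: "(r, j) \<in> \<R> \<times> {..n} - F" for r j
    proof -
      have "(r, j) \<notin> F0" using rj F(2) by blast
      then show ?thesis using rj by (simp add: F0_def)
    qed
    from Phi_remainder_le[OF f F(1,3) less_imp_le[OF e] this]
    show "Phi_bounded n (\<lambda>x. f x - wavelet_sum n F (\<lambda>(r, j). coef n f r j) x) e"
      unfolding Phi_bounded_def by (intro allI impI ballI) assumption
  qed (use e in simp)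
  ultimately show "\<exists>F0. finite F0 \<and> F0 \<subseteq> \<R> \<times> {..n} \<and> (\<forall>F. finite F \<and> F0 \<subseteq> F \<and> F \<subseteq> \<R> \<times> {..n} \<longrightarrow>
      Cnrm n (\<lambda>x. f x - wavelet_sum n F (\<lambda>(r, j). coef n f r j) x) \<le> ennreal e)"
    by (intro exI[of _ F0] conjI allI impI) simp_all
qed


subsection \<open>Uniqueness of the expansion\<close>

lemma Dq_lincomb:
  assumes "f \<in> Cspace n" "g \<in> Cspace n" "j \<le> n" "a \<in> \<O>"
  shows "Dq j (\<lambda>x. f x + c * g x) a = Dq j f a + c * Dq j g a"
  by (rule Dq_eqI[OF Cspace_add[OF assms(1) Cspace_cmult[OF assms(2)]] assms(4,3)],
      rule Phi_tendsto_add[OF Phi_tendsto_Dq[OF assms(1,4,3)]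
        Phi_tendsto_cmult[OF Phi_tendsto_Dq[OF assms(2,4,3)]]])

lemma coef_lincomb:
  assumes f: "f \<in> Cspace n" and g: "g \<in> Cspace n" and r: "r \<in> \<R>" and j: "j \<le> n"
  shows "coef n (\<lambda>x. f x + c * g x) r j = coef n f r j + c * coef n g r j"
proof (cases "r = 0")
  case True
  then show ?thesis
    using Dq_lincomb[OF f g j, of 0 c] by (simp add: coef_def)
next
  case False
  then have rp: "r \<in> \<R>p" using r by (simp add: fin_exp_plus_iff)
  let ?S = "\<lambda>f. \<Sum>l\<le>n - j. (r - pr r) ^ l * (of_nat ((l + j) choose j) * Dq (l + j) f (pr r))"
  have h: "(\<lambda>x. f x + c * g x) \<in> Cspace n"
    by (rule Cspace_add[OF f Cspace_cmult[OF g]])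
  have "(r - pr r) ^ l * (of_nat ((l + j) choose j) * Dq (l + j) (\<lambda>x. f x + c * g x) (pr r)) =
      (r - pr r) ^ l * (of_nat ((l + j) choose j) * Dq (l + j) f (pr r)) +
      c * ((r - pr r) ^ l * (of_nat ((l + j) choose j) * Dq (l + j) g (pr r)))" if "l \<le> n - j" for l
  proof -
    have "l + j \<le> n" using that j by simp
    then show ?thesis
      unfolding Dq_lincomb[OF f g \<open>l + j \<le> n\<close> pred_integers[OF rp]] by (simp only: algebra_simps)
  qed
  then have S: "?S (\<lambda>x. f x + c * g x) = ?S f + c * ?S g"
    by (simp add: sum.distrib sum_distrib_left)
  have "coef n (\<lambda>x. f x + c * g x) r j * \<gamma> r ^ (n - j) = (Dq j f r - ?S f) + c * (Dq j g r - ?S g)"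
    unfolding coef_eq[OF h rp j] Dq_lincomb[OF f g j fin_exp_plus_integers[OF rp]] S
    by (simp add: algebra_simps)
  also have "\<dots> = coef n f r j * \<gamma> r ^ (n - j) + c * (coef n g r j * \<gamma> r ^ (n - j))"
    unfolding coef_eq[OF f rp j] coef_eq[OF g rp j] ..
  also have "\<dots> = (coef n f r j + c * coef n g r j) * \<gamma> r ^ (n - j)"
    by (simp add: algebra_simps)
  finally show ?thesis
    using gam_nonzero[OF r] by simp
qed

lemma coef_diff:
  assumes "f \<in> Cspace n" "g \<in> Cspace n" "r \<in> \<R>" "j \<le> n"
  shows "coef n (\<lambda>x. f x - g x) r j = coef n f r j - coef n g r j"
  using coef_lincomb[OF assms, of "- 1"] by simp

lemma coef_zero: "r \<in> \<R> \<Longrightarrow> j \<le> n \<Longrightarrow> coef n (\<lambda>x. 0) r j = 0"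
  using coef_diff[OF Cspace_zero Cspace_zero, of r j n] by simp

lemma coef_wavelet_sum:
  assumes "finite F" "F \<subseteq> \<R> \<times> {..n}" "r \<in> \<R>" "j \<le> n"
  shows "coef n (wavelet_sum n F c) r j = (\<Sum>i\<in>F. c i * coef n (wav n (fst i) (snd i)) r j)"
  using assms(1,2)
proof (induction F)
  case empty
  then show ?case using coef_zero[OF assms(3,4)] by (simp add: wavelet_sum_def[abs_def])
next
  case (insert i F)
  have "wavelet_sum n (insert i F) c = (\<lambda>x. wavelet_sum n F c x + c i * wav n (fst i) (snd i) x)"
    using insert.hyps by (simp add: wavelet_sum_def fun_eq_iff add.commute)
  moreover have "fst i \<in> \<R>" "F \<subseteq> \<R> \<times> {..n}" using insert.prems by auto
  ultimately show ?case
    using insert.IH insert.hyps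
    by (simp add: coef_lincomb[OF wavelet_sum_Cspace wavelet_Cspace assms(3,4)] add.commute)
qed

text \<open>Biorthogonality. For \<open>r \<noteq> 0\<close>: if \<open>s = r\<close>, the
  predecessor lies outside the cell and only the derivative at \<open>r\<close> survives; if
  \<open>r\<close> lies outside \<open>cell s\<close>, so does its predecessor; if \<open>r\<close>
  lies in the cell of another \<open>s\<close>, the wavelet is one polynomial of degree at most
  \<open>n\<close> at both points and its Taylor remainder vanishes. The point 0 lies in no cell but
  its own.\<close>

lemma coef_wavelet:
  assumes s: "s \<in> \<R>" and i: "i \<le> n" and r: "r \<in> \<R>" and j: "j \<le> n"
  shows "coef n (wav n s i) r j = (if s = r \<and> i = j then 1 else 0)"
proof (cases "r = 0")
  case True
  have "0 \<in> cell s \<longleftrightarrow> s = 0"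
    using cell_len[OF s zero_in_fin_exp] center_in_cell[OF s] by auto
  then show ?thesis
    using Dq_wavelet[OF s zero_in_integers, of j n i] True by (auto simp: coef_def binomial_eq_0)
next
  case False
  then have rp: "r \<in> \<R>p" using r by (simp add: fin_exp_plus_iff)
  let ?w = "wav n s i"
  let ?S = "\<Sum>l\<le>n - j. (r - pr r) ^ l * (of_nat ((l + j) choose j) * Dq (l + j) ?w (pr r))"
  have eq: "coef n ?w r j * \<gamma> r ^ (n - j) = Dq j ?w r - ?S"
    by (rule coef_eq[OF wavelet_Cspace[OF s] rp j])
  note Dr = Dq_wavelet[OF s fin_exp_integers[OF r]] and Dp = Dq_wavelet[OF s pred_integers[OF rp]]
  consider "s = r" | "s \<noteq> r" "r \<notin> cell s" | "s \<noteq> r" "r \<in> cell s" by blast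
  then show ?thesis
  proof cases
    case 1
    have "?S = 0"
      using pred_not_in_cell[OF rp] by (simp add: Dp[unfolded 1] 1)
    moreover have "Dq j ?w r = (if i = j then \<gamma> r ^ (n - j) else 0)"
      using center_in_cell[OF r] by (auto simp: Dr[unfolded 1] 1 binomial_eq_0)
    ultimately show ?thesis
      using eq gam_nonzero[OF r] 1 by (auto split: if_splits)
  next
    case 2
    then have "pr r \<notin> cell s"
      using cell_pred_iff[OF s rp] by simp
    then have "Dq j ?w r - ?S = 0"
      using 2 by (simp add: Dr Dp)
    then show ?thesis
      using eq gam_nonzero[OF r] 2 by simp
  next
    case 3
    then have p: "pr r \<in> cell s"
      using cell_pred_iff[OF s rp] by simp
    have "?S = \<gamma> s ^ (n - i) * (\<Sum>l\<le>n - j. (r - pr r) ^ l *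
        (of_nat ((l + j) choose j) * (of_nat (i choose (l + j)) * (pr r - s) ^ (i - (l + j)))))"
      unfolding sum_distrib_left by (intro sum.cong refl) (simp add: Dp p mult_ac)
    also have "(\<Sum>l\<le>n - j. (r - pr r) ^ l *
        (of_nat ((l + j) choose j) * (of_nat (i choose (l + j)) * (pr r - s) ^ (i - (l + j))))) =
        of_nat (i choose j) * (r - s) ^ (i - j)"
    proof (cases "j \<le> i")
      case True
      \<comment> \<open>The terms with \<open>l + j > i\<close> vanish with their binomial
        coefficient, which cuts the sum down to the exact Taylor formula.\<close>
      have "(\<Sum>l\<le>n - j. (r - pr r) ^ l *
          (of_nat ((l + j) choose j) * (of_nat (i choose (l + j)) * (pr r - s) ^ (i - (l + j))))) =
          (\<Sum>l\<le>i - j. (r - pr r) ^ l *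
          (of_nat ((l + j) choose j) * (of_nat (i choose (l + j)) * (pr r - s) ^ (i - (l + j)))))"
        using i by (intro sum.mono_neutral_right) (auto simp: binomial_eq_0)
      then show ?thesis using Taylor_power[OF True] by simp
    next
      case False
      then show ?thesis by (simp add: binomial_eq_0)
    qed
    finally have "Dq j ?w r - ?S = 0"
      using 3 by (simp add: Dr)
    then show ?thesis
      using eq gam_nonzero[OF r] 3 by simp
  qed
qed

text \<open>Coefficients are linear and bounded by the norm, and a finite sum whose index set
  contains \<open>(r, j)\<close> has coefficient \<open>c (r, j)\<close> there. Convergence in norm
  therefore makes the two sides differ by at most every \<open>e\<close>.\<close>

lemma expansion_unique:
  assumes f: "f \<in> Cspace n"
    and c: "norm_has_sum (Cnrm n) (\<R> \<times> {..n}) (\<lambda>(r, j). wav n r j) c f"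
    and r: "r \<in> \<R>" and j: "j \<le> n"
  shows "c (r, j) = coef n f r j"
proof -
  have "lf_abs (coef n f r j - c (r, j)) \<le> e" if e: "0 < e" for e
  proof -
    obtain F0 where F0: "finite F0" "F0 \<subseteq> \<R> \<times> {..n}"
      "\<And>F. finite F \<Longrightarrow> F0 \<subseteq> F \<Longrightarrow> F \<subseteq> \<R> \<times> {..n} \<Longrightarrow> Cnrm n (\<lambda>x. f x - wavelet_sum n F c x) \<le> ennreal e"
      using c e unfolding norm_has_sum_iff by metis
    define F where "F = insert (r, j) F0"
    have F: "finite F" "F0 \<subseteq> F" "F \<subseteq> \<R> \<times> {..n}" "(r, j) \<in> F"
      using F0 r j by (auto simp: F_def)
    have "coef n (wavelet_sum n F c) r j = (\<Sum>i\<in>F. if i = (r, j) then c i else 0)"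
      unfolding coef_wavelet_sum[OF F(1,3) r j]
    proof (intro sum.cong refl)
      fix i assume "i \<in> F"
      then have "fst i \<in> \<R>" "snd i \<le> n" using F(3) by auto
      from coef_wavelet[OF this r j]
      show "c i * coef n (wav n (fst i) (snd i)) r j = (if i = (r, j) then c i else 0)"
        by (cases i) auto
    qed
    also have "\<dots> = c (r, j)"
      using F by simp
    finally have "coef n f r j - c (r, j) = coef n (\<lambda>x. f x - wavelet_sum n F c x) r j"
      using coef_diff[OF f wavelet_sum_Cspace[OF F(3)] r j] by simp
    also have "lf_abs \<dots> \<le> e"
      by (rule coef_le[OF Cspace_diff[OF f wavelet_sum_Cspace[OF F(3)]] F0(3)[OF F(1-3)] less_imp_le[OF e] r j])
    finally show ?thesis .
  qed
  then have "lf_abs (coef n f r j - c (r, j)) \<le> 0"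
    using field_le_epsilon[of "lf_abs (coef n f r j - c (r, j))" 0] by simp
  then have "coef n f r j - c (r, j) = 0"
    using lf_abs_nonneg[of "coef n f r j - c (r, j)"] lf_abs_eq_0 order_antisym by blast
  then show ?thesis by simp
qed

lemma wavelet_expansion_unique:
  "f \<in> Cspace n \<Longrightarrow> wavelet_expansion \<pi> T n f b \<Longrightarrow> r \<in> \<R> \<Longrightarrow> j \<le> n \<Longrightarrow> b r j = coef n f r j"
  using expansion_unique[of f n "\<lambda>(r, j). b r j" r j] by (simp add: wavelet_expansion_def)


subsection \<open>The orthonormal basis\<close>

text \<open>The lower bound holds because the wavelet has coefficient 1 at its own index and
  coefficients are at most the norm.\<close>

lemma Cnorm_wavelet:
  assumes r: "r \<in> \<R>" and j: "j \<le> n"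
  shows "Cnrm n (wav n r j) = 1"
proof (rule antisym)
  have "Phi_bounded n (wav n r j) 1"
    unfolding Phi_bounded_def using Phi_wavelet_le_1[OF r j] by blast
  then show "Cnrm n (wav n r j) \<le> 1"
    using Cnorm_le[OF wavelet_Cspace[OF r], where n = n and M = 1] by simp
  obtain M where M: "0 \<le> M" "Cnrm n (wav n r j) = ennreal M"
    by (rule Cnorm_real[OF wavelet_Cspace[OF r]])
  have "lf_abs (coef n (wav n r j) r j) \<le> M"
    by (rule coef_le[OF wavelet_Cspace[OF r] _ M(1) r j]) (simp add: M(2))
  then have "1 \<le> M"
    by (simp add: coef_wavelet[OF r j r j])
  then show "1 \<le> Cnrm n (wav n r j)"
    unfolding M(2) by simp
qed

lemma Phi_bounded_diff: "Phi_bounded n f M \<Longrightarrow> Phi_bounded n g M \<Longrightarrow> Phi_bounded n (\<lambda>x. f x - g x) M"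
  by (simp add: Phi_bounded_def Phi_diff lf_abs_diff_leI)

text \<open>Two finite sums that both contain the finite set \<open>B e\<close> of indices with
  coefficients reaching \<open>e\<close> differ by at most \<open>e\<close> in every quotient. So
  the sums over \<open>dig m\<close> are Cauchy, and \<open>Cspace_uniform_limit\<close> provides
  the sum.\<close>

lemma null_family_summable:
  assumes c: "null_family (\<R> \<times> {..n}) c"
  obtains f where "f \<in> Cspace n" "norm_has_sum (Cnrm n) (\<R> \<times> {..n}) (\<lambda>(r, j). wav n r j) c f"
proof -
  define s where "s m = wavelet_sum n (dig m \<times> {..n}) c" for m
  define B where "B e = {i \<in> \<R> \<times> {..n}. e \<le> lf_abs (c i)}" for e
  have B: "finite (B e)" "B e \<subseteq> \<R> \<times> {..n}" if "0 < e" for e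
    using c that unfolding null_family_def B_def by simp_all
  have dig: "dig m \<times> {..n} \<subseteq> \<R> \<times> {..n}" "finite (dig m \<times> {..n})" for m
    using digits_iff finite_digits by auto
  have tail: "Phi_bounded n (\<lambda>x. wavelet_sum n G c x - wavelet_sum n F c x) e"
    if "0 < e" "B e \<subseteq> F" "F \<subseteq> G" "G \<subseteq> \<R> \<times> {..n}" "finite G" for F G e
  proof -
    have "lf_abs (Phi (wavelet_sum n (G - F) c) xs) \<le> e" if "k \<le> n" "xs \<in> dlists k \<O>" for k xs
    proof (rule Phi_wavelet_sum_le[OF _ _ _ that])
      show "G - F \<subseteq> \<R> \<times> {..n}" using \<open>G \<subseteq> _\<close> by blast
      show "lf_abs (c i) \<le> e" if "i \<in> G - F" for i
      proof -
        have "i \<in> \<R> \<times> {..n}" "i \<notin> B e" using that \<open>G \<subseteq> _\<close> \<open>B e \<subseteq> F\<close> by blast+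
        then show ?thesis by (simp add: B_def)
      qed
    qed (use \<open>0 < e\<close> in simp)
    then show ?thesis
      unfolding wavelet_sum_diff[OF \<open>finite G\<close> \<open>F \<subseteq> G\<close>] Phi_bounded_def by blast
  qed
  have cover: "\<exists>M. B e \<subseteq> dig M \<times> {..n}" if "0 < e" for e
    using eventually_happens'[OF sequentially_bot finite_subset_digits[OF B[OF that]]] .
  have mono: "dig M \<times> {..n} \<subseteq> dig m \<times> {..n}" if "M \<le> m" for M m
    using digits_mono[OF that] by blast
  have Cauchy: "\<exists>M. \<forall>i\<ge>M. \<forall>j\<ge>M. Phi_bounded n (\<lambda>x. s i x - s j x) e" if e: "0 < e" for e
  proof -
    obtain M where M: "B e \<subseteq> dig M \<times> {..n}" using cover[OF e] by blast
    have "Phi_bounded n (\<lambda>x. s i x - s j x) e" if "i \<ge> M" "j \<ge> M" for i j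
    proof -
      have "Phi_bounded n (\<lambda>x. s i x - s M x) e" "Phi_bounded n (\<lambda>x. s j x - s M x) e"
        unfolding s_def by (rule tail[OF e M mono[OF that(1)] dig], rule tail[OF e M mono[OF that(2)] dig])
      from Phi_bounded_diff[OF this] show ?thesis by simp
    qed
    then show ?thesis by blast
  qed
  have sC: "s i \<in> Cspace n" for i
    unfolding s_def by (rule wavelet_sum_Cspace[OF dig(1)])
  obtain f where f: "f \<in> Cspace n" "\<And>e. 0 < e \<Longrightarrow> \<exists>M. \<forall>i\<ge>M. Phi_bounded n (\<lambda>x. s i x - f x) e"
    by (rule Cspace_uniform_limit[OF sC Cauchy]) blast+
  have "norm_has_sum (Cnrm n) (\<R> \<times> {..n}) (\<lambda>(r, j). wav n r j) c f"
    unfolding norm_has_sum_iff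
  proof (intro allI impI)
    fix e :: real assume e: "0 < e"
    show "\<exists>F0. finite F0 \<and> F0 \<subseteq> \<R> \<times> {..n} \<and> (\<forall>F. finite F \<and> F0 \<subseteq> F \<and> F \<subseteq> \<R> \<times> {..n} \<longrightarrow>
        Cnrm n (\<lambda>x. f x - wavelet_sum n F c x) \<le> ennreal e)"
    proof (intro exI[of _ "B e"] conjI allI impI)
      fix F assume "finite F \<and> B e \<subseteq> F \<and> F \<subseteq> \<R> \<times> {..n}"
      then have F: "finite F" "B e \<subseteq> F" "F \<subseteq> \<R> \<times> {..n}" by auto
      obtain M where M: "\<And>i. i \<ge> M \<Longrightarrow> Phi_bounded n (\<lambda>x. s i x - f x) e"
        using f(2)[OF e] by blast
      have "\<forall>\<^sub>F m in sequentially. F \<subseteq> dig m \<times> {..n} \<and> M \<le> m"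
        using finite_subset_digits[OF F(1,3)] eventually_ge_at_top[of M] by eventually_elim simp
      \<comment> \<open>An arbitrary \<open>F\<close> containing \<open>B e\<close> is compared with
        a partial sum over some \<open>dig m\<close> that contains \<open>F\<close> and is already
        close to \<open>f\<close>.\<close>
      then obtain m where m: "F \<subseteq> dig m \<times> {..n}" "M \<le> m"
        using eventually_happens'[OF sequentially_bot] by blast
      have "Phi_bounded n (\<lambda>x. s m x - wavelet_sum n F c x) e"
        unfolding s_def by (rule tail[OF e F(2) m(1) dig])
      from Phi_bounded_diff[OF this M[OF m(2)]]
      have "Phi_bounded n (\<lambda>x. f x - wavelet_sum n F c x) e"
        by simp
      then show "Cnrm n (\<lambda>x. f x - wavelet_sum n F c x) \<le> ennreal e"
        using e by (intro Cnorm_le[OF Cspace_diff[OF f(1) wavelet_sum_Cspace[OF F(3)]]]) simp_all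
    qed (use B[OF e] in simp_all)
  qed
  with f(1) show ?thesis by (rule that)
qed

lemma Cnorm_eq_SUP_coef:
  assumes f: "f \<in> Cspace n"
  shows "Cnrm n f = (SUP i\<in>\<R> \<times> {..n}. ennreal (lf_abs (coef n f (fst i) (snd i))))"
    (is "_ = ?S")
proof (rule antisym)
  obtain M where M: "0 \<le> M" "Cnrm n f = ennreal M"
    by (rule Cnorm_real[OF f])
  show le: "?S \<le> Cnrm n f"
  proof (rule SUP_least)
    fix i assume "i \<in> \<R> \<times> {..n}"
    then have "lf_abs (coef n f (fst i) (snd i)) \<le> M"
      using M by (intro coef_le[OF f _ M(1)]) auto
    then show "ennreal (lf_abs (coef n f (fst i) (snd i))) \<le> Cnrm n f"
      unfolding M(2) by (rule ennreal_leI)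
  qed
  define M' where "M' = enn2real ?S"
  have S: "?S = ennreal M'" "0 \<le> M'"
  proof -
    have "?S < top"
      using le unfolding M(2) by (rule order_le_less_trans) simp
    then show "?S = ennreal M'" by (simp add: M'_def)
  qed (simp add: M'_def)
  have "lf_abs (coef n f r j) \<le> M'" if "r \<in> \<R>" "j \<le> n" for r j
  proof -
    have "ennreal (lf_abs (coef n f (fst (r, j)) (snd (r, j)))) \<le> ?S"
      by (rule SUP_upper) (use that in simp)
    then show ?thesis
      unfolding S(1) using S(2) by simp
  qed
  from Phi_bounded_coef[OF f S(2) this] show "Cnrm n f \<le> ?S"
    unfolding S(1) using Cnorm_le[OF f _ S(2)] by blast
qed

lemma orthonormal_basis_wavelets:
  "orthonormal_basis (Cspace n) (Cnrm n) (\<R> \<times> {..n}) (\<lambda>(r, j). wav n r j)"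
  unfolding orthonormal_basis_def
proof (intro conjI ballI allI impI is_Banach_Cnorm)
  fix i assume "i \<in> \<R> \<times> {..n}"
  then obtain r j where "i = (r, j)" "r \<in> \<R>" "j \<le> n" by auto
  then show "(\<lambda>(r, j). wav n r j) i \<in> Cspace n"
    "Cnrm n ((\<lambda>(r, j). wav n r j) i) = 1"
    by (simp_all add: wavelet_Cspace Cnorm_wavelet)
next
  fix f :: "'k \<Rightarrow> 'k" assume "f \<in> Cspace n"
  from wavelet_expansion_coef[OF this]
  show "\<exists>c. norm_has_sum (Cnrm n) (\<R> \<times> {..n}) (\<lambda>(r, j). wav n r j) c f"
    by (rule exI[where x = "\<lambda>(r, j). coef n f r j"])
next
  fix c assume "null_family (\<R> \<times> {..n}) (c :: 'k \<times> nat \<Rightarrow> 'k)"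
  then obtain f where f: "f \<in> Cspace n"
    "norm_has_sum (Cnrm n) (\<R> \<times> {..n}) (\<lambda>(r, j). wav n r j) c f"
    by (rule null_family_summable)
  have "c i = coef n f (fst i) (snd i)" if "i \<in> \<R> \<times> {..n}" for i
    using expansion_unique[OF f, of "fst i" "snd i"] that by auto
  then have "Cnrm n f = (SUP i\<in>\<R> \<times> {..n}. ennreal (lf_abs (c i)))"
    unfolding Cnorm_eq_SUP_coef[OF f(1)] by (intro SUP_cong) auto
  with f show "\<exists>f\<in>Cspace n. norm_has_sum (Cnrm n) (\<R> \<times> {..n}) (\<lambda>(r, j). wav n r j) c f \<and>
      Cnrm n f = (SUP i\<in>\<R> \<times> {..n}. ennreal (lf_abs (c i)))"
    by blast
qed


subsection \<open>One more derivative\<close>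

lemma coef_div_gam:
  "r \<in> \<R>p \<Longrightarrow> coef n f r j * inverse (\<gamma> r) = psi (n - j) (Dq j f) r (pr r)"
  using gam_nonzero[of r] by (simp add: coef_def fin_exp_plus_iff)

text \<open>The limit of \<open>psi\<close> is the derivative of order \<open>n + 1 - j\<close> of
  \<open>Dq j f\<close>; composing the derivatives produces the factor \<open>Suc n choose j\<close>
  of the criterion.\<close>

lemma coef_div_gam_tendsto:
  assumes f: "f \<in> Cspace (Suc n)" and a: "a \<in> \<O>" and j: "j \<le> n"
  shows "((\<lambda>r. coef n f r j * inverse (\<gamma> r)) \<longlongrightarrow> of_nat (Suc n choose j) * Dq (Suc n) f a) (atp a)"
proof -
  have "Dq j f \<in> Cspace (Suc (n - j))"
    using Dq_in_Cspace[OF f, of j] j by (simp add: Suc_diff_le)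
  from psi_tendsto[OF this a]
  have lim: "((\<lambda>r. psi (n - j) (Dq j f) r (pr r)) \<longlongrightarrow> of_nat (Suc n choose j) * Dq (Suc n) f a) (atp a)"
    using Dq_Dq[OF f, of "Suc (n - j)" j a] a j by simp
  have "\<forall>\<^sub>F r in atp a. psi (n - j) (Dq j f) r (pr r) = coef n f r j * inverse (\<gamma> r)"
    using eventually_fin_exp_plus[OF a] by eventually_elim (rule coef_div_gam[symmetric])
  from Lim_transform_eventually[OF lim this] show ?thesis .
qed

text \<open>Cut off outside \<open>\<O>\<close> so as to lie in \<open>Cspace\<close>. Its degree
  exceeds by one what Taylor polynomials of order \<open>n\<close> capture, which leaves
  coefficients proportional to \<open>\<gamma> r\<close>.\<close>

definition top_power :: "nat \<Rightarrow> 'k \<Rightarrow> 'k \<Rightarrow> 'k" where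
  "top_power n a x = (if x \<in> \<O> then (x - a) ^ Suc n else 0)"

lemma Phi_tendsto_top_power:
  assumes "y \<in> \<O>"
  shows "Phi_tendsto l (top_power n a) y (of_nat (Suc n choose l) * (y - a) ^ (Suc n - l))"
  by (rule Phi_tendsto_local[OF Phi_tendsto_power zero_less_one]) (simp add: top_power_def uball_def)

lemma top_power_Cspace: "top_power n a \<in> Cspace m"
proof (rule CspaceI)
  show "top_power n a x = 0" if "x \<notin> \<O>" for x
    using that by (simp add: top_power_def)
  show "\<exists>L. Phi_tendsto m (top_power n a) y L" if "y \<in> \<O>" for y
    using Phi_tendsto_top_power[OF that] by blast
qed

lemma Dq_top_power: "y \<in> \<O> \<Longrightarrow> Dq l (top_power n a) y = of_nat (Suc n choose l) * (y - a) ^ (Suc n - l)"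
  by (rule Dq_eqI[OF top_power_Cspace _ order_refl Phi_tendsto_top_power])

text \<open>The sum in \<open>coef_eq\<close> stops at \<open>l = n - j\<close>, while the exact
  Taylor formula for degree \<open>n + 1\<close> has one more term, with
  \<open>l = n + 1 - j\<close>; this term is what remains.\<close>

lemma coef_top_power:
  assumes r: "r \<in> \<R>p" and j: "j \<le> n"
  shows "coef n (top_power n a) r j = of_nat (Suc n choose j) * \<gamma> r"
proof -
  have k: "Suc n - j = Suc (n - j)" "Suc (n - j) + j = Suc n"
    using j by simp_all
  let ?t = "\<lambda>l. (r - pr r) ^ l * (of_nat ((l + j) choose j) *
    (of_nat (Suc n choose (l + j)) * (pr r - a) ^ (Suc n - (l + j))))"
  have 1: "sum ?t {..Suc (n - j)} = of_nat (Suc n choose j) * (r - a) ^ (Suc n - j)"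
    using Taylor_power[of j "Suc n" r "pr r" a] j unfolding k(1) by simp
  have 2: "sum ?t {..Suc (n - j)} = sum ?t {..n - j} + ?t (Suc (n - j))"
    by (rule sum.atMost_Suc)
  have 3: "?t (Suc (n - j)) = (r - pr r) ^ Suc (n - j) * of_nat (Suc n choose j)"
    unfolding k(2) by simp
  have arith: "x - u = v" if "s = x" "s = u + t" "t = v" for s t u v x :: 'k
    using that by (metis add_diff_cancel_left')
  have "of_nat (Suc n choose j) * (r - a) ^ (Suc n - j) - sum ?t {..n - j} =
      (r - pr r) ^ Suc (n - j) * of_nat (Suc n choose j)"
    by (rule arith[OF 1 2 3])
  then have "coef n (top_power n a) r j * \<gamma> r ^ (n - j) = (r - pr r) ^ Suc (n - j) * of_nat (Suc n choose j)"
    unfolding coef_eq[OF top_power_Cspace r j] Dq_top_power[OF fin_exp_plus_integers[OF r]]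
      Dq_top_power[OF pred_integers[OF r]] .
  also have "\<dots> = (of_nat (Suc n choose j) * \<gamma> r) * \<gamma> r ^ (n - j)"
    unfolding gam_plus[OF r] by (simp add: mult_ac)
  finally show ?thesis
    using gam_nonzero[of r] r by (simp add: fin_exp_plus_iff)
qed

text \<open>
  Subtracting \<open>L (x - a)\<^sup>n\<^sup>+\<^sup>1\<close> reduces to vanishing limits; then only the coefficients at points
  of length greater than \<open>m\<close> in the ball of radius \<open>\<bar>\<pi>\<bar>\<^sup>m\<close> about \<open>a\<close> contribute there, which excludes
  \<open>a\<close> itself for large \<open>m\<close>.
\<close>

lemma Cspace_Suc_if_coef_tendsto:
  assumes f: "f \<in> Cspace n"
    and lim: "\<And>a j. a \<in> \<O> \<Longrightarrow> j \<le> n \<Longrightarrow> \<exists>L L0.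
      ((\<lambda>r. coef n f r j * inverse (\<gamma> r)) \<longlongrightarrow> L) (atp a) \<and>
      ((\<lambda>r. coef n f r 0 * inverse (\<gamma> r)) \<longlongrightarrow> L0) (atp a) \<and>
      L = of_nat (Suc n choose j) * L0"
  shows "f \<in> Cspace (Suc n)"
proof (rule CspaceI)
  show "f x = 0" if "x \<notin> \<O>" for x by (rule Cspace_outside[OF f that])
  fix a :: 'k assume a: "a \<in> \<O>"
  obtain L0 where L0: "((\<lambda>r. coef n f r 0 * inverse (\<gamma> r)) \<longlongrightarrow> L0) (atp a)"
    using lim[OF a, of 0] by blast
  have limj: "((\<lambda>r. coef n f r j * inverse (\<gamma> r)) \<longlongrightarrow> of_nat (Suc n choose j) * L0) (atp a)"
    if j: "j \<le> n" for j
  proof -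
    obtain L L0' where L: "((\<lambda>r. coef n f r j * inverse (\<gamma> r)) \<longlongrightarrow> L) (atp a)"
      "((\<lambda>r. coef n f r 0 * inverse (\<gamma> r)) \<longlongrightarrow> L0') (atp a)"
      "L = of_nat (Suc n choose j) * L0'"
      using lim[OF a j] by blast
    \<comment> \<open>The hypothesis provides its own \<open>L0'\<close> for each \<open>j\<close>;
      uniqueness of limits makes it the same number for all of them.\<close>
    have "L0' = L0"
      by (rule tendsto_unique[OF at_within_fin_exp_plus_nontrivial[OF a] L(2) L0])
    then show ?thesis using L(1,3) by simp
  qed
  define g where "g x = f x + (- L0) * top_power n a x" for x
  have g: "g \<in> Cspace n"
    unfolding g_def[abs_def] by (intro Cspace_add[OF f] Cspace_cmult top_power_Cspace)
  have coef_g: "coef n g r j = (coef n f r j * inverse (\<gamma> r) - of_nat (Suc n choose j) * L0) * \<gamma> r"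
    if r: "r \<in> \<R>p" and j: "j \<le> n" for r j
  proof -
    have rR: "r \<in> \<R>" using r by (simp add: fin_exp_plus_iff)
    have "coef n g r j = coef n f r j + (- L0) * (of_nat (Suc n choose j) * \<gamma> r)"
      unfolding g_def[abs_def] coef_lincomb[OF f top_power_Cspace rR j] coef_top_power[OF r j] ..
    moreover have "u + (- L0) * (v * h) = (u * inverse h - v * L0) * h" if "h \<noteq> 0" for u v h :: 'k
      using that by (simp add: field_simps)
    ultimately show ?thesis
      using gam_nonzero[OF rR] by simp
  qed
  have "Phi_tendsto (Suc n) f a L0"
    unfolding Phi_tendsto_def
  proof (intro allI impI)
    fix e :: real assume e: "0 < e"
    have "\<forall>\<^sub>F r in atp a. \<forall>j\<in>{..n}. lf_abs (coef n f r j * inverse (\<gamma> r) - of_nat (Suc n choose j) * L0) \<le> e"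
      by (rule eventually_ball_finite) (use limj e in \<open>simp_all add: tendsto_lf_abs_iff\<close>)
    then obtain d where d: "0 < d" "\<And>r j. r \<in> \<R>p \<Longrightarrow> r \<noteq> a \<Longrightarrow> dist r a < d \<Longrightarrow> j \<le> n \<Longrightarrow>
        lf_abs (coef n f r j * inverse (\<gamma> r) - of_nat (Suc n choose j) * L0) \<le> e"
      unfolding eventually_at by auto
    obtain N where N: "\<And>m. m \<ge> N \<Longrightarrow> \<rho> ^ m \<le> d / 2"
      using uniformizer_power_small[OF unif, of "d / 2"] d(1) by auto
    \<comment> \<open>\<open>N\<close> brings the ball inside the radius \<open>d\<close>, while
      \<open>lg a\<close> bars \<open>r = a\<close>, where limits over punctured neighbourhoods say
      nothing.\<close>
    define m where "m = max N (lg a)"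
    have "lf_abs (coef n g r j) \<le> e * lf_abs (\<gamma> r)"
      if r: "r \<in> \<R>p" "r \<in> uball a (\<rho> ^ m)" "m < lg r" and j: "j \<le> n" for r j
    proof -
      have "r \<noteq> a" using r(3) by (auto simp: m_def)
      moreover have "lf_abs (r - a) \<le> d / 2"
        using r(2) N[of m] by (auto simp: uball_def m_def)
      then have "dist r a < d" using d(1) by (simp add: dist_lf_abs)
      ultimately show ?thesis
        unfolding coef_g[OF r(1) j] lf_abs_mult
        using d(2)[OF r(1) _ _ j] by (intro mult_right_mono) simp_all
    qed
    from Phi_le_near[OF g less_imp_le[OF e] this]
    have Phi_g: "lf_abs (Phi g xs) \<le> e" if "xs \<in> dlists (Suc n) (uball a (\<rho> ^ m))" for xs
      using that by blast
    have "lf_abs (Phi f xs - L0) \<le> e" if xs: "xs \<in> dlists (Suc n) (uball a (\<rho> ^ m))" for xs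
    proof -
      have "Phi (top_power n a) xs = Phi (\<lambda>x. (x - a) ^ Suc n) xs"
        using xs by (intro Phi_cong) (auto simp: top_power_def dlists_def uball_def)
      also have "\<dots> = 1"
        using xs by (intro Phi_power_top) (auto simp: dlists_def)
      finally have "Phi g xs = Phi f xs - L0"
        unfolding g_def[abs_def] Phi_add Phi_cmult by simp
      then show ?thesis using Phi_g[OF xs] by simp
    qed
    then show "\<exists>d>0. \<forall>xs\<in>dlists (Suc n) (uball a d). lf_abs (Phi f xs - L0) \<le> e"
      using rho(1) by (intro exI[of _ "\<rho> ^ m"]) simp
  qed
  then show "\<exists>L. Phi_tendsto (Suc n) f a L" ..
qed

lemma Cspace_Suc_iff:
  assumes f: "f \<in> Cspace n"
  shows "f \<in> Cspace (Suc n) \<longleftrightarrow> (\<forall>a\<in>\<O>. \<forall>j\<le>n. \<exists>L L0.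
      ((\<lambda>r. coef n f r j * inverse (\<gamma> r)) \<longlongrightarrow> L) (atp a) \<and>
      ((\<lambda>r. coef n f r 0 * inverse (\<gamma> r)) \<longlongrightarrow> L0) (atp a) \<and>
      L = of_nat (Suc n choose j) * L0)" (is "_ \<longleftrightarrow> ?R")
proof
  assume f': "f \<in> Cspace (Suc n)"
  show ?R
  proof (intro ballI allI impI)
    fix a :: 'k and j assume a: "a \<in> \<O>" and j: "j \<le> n"
    show "\<exists>L L0. ((\<lambda>r. coef n f r j * inverse (\<gamma> r)) \<longlongrightarrow> L) (atp a) \<and>
      ((\<lambda>r. coef n f r 0 * inverse (\<gamma> r)) \<longlongrightarrow> L0) (atp a) \<and>
      L = of_nat (Suc n choose j) * L0"
      using coef_div_gam_tendsto[OF f' a j] coef_div_gam_tendsto[OF f' a, of 0]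
      by (intro exI[of _ "of_nat (Suc n choose j) * Dq (Suc n) f a"] exI[of _ "Dq (Suc n) f a"]) simp
  qed
next
  assume ?R
  then show "f \<in> Cspace (Suc n)"
    by (intro Cspace_Suc_if_coef_tendsto[OF f]) blast
qed

text \<open>An identity for arbitrary \<open>f\<close>: by the formula for \<open>coef\<close>,
  division by \<open>\<gamma> r\<close> leaves precisely the quantities in the norm of order
  \<open>n + 1\<close>, with \<open>\<gamma> 0 = 1\<close> covering the values at 0.\<close>

lemma Cnorm_Suc_eq_SUP:
  "Cnrm (Suc n) f = (SUP (r, j)\<in>\<R> \<times> {..n}. ennreal (lf_abs (coef n f r j * inverse (\<gamma> r))))"
proof -
  have 0: "coef n f 0 j * inverse (\<gamma> 0) = Dq j f 0" for j
    by (simp add: coef_def)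
  have "(\<lambda>(r, j). ennreal (lf_abs (coef n f r j * inverse (\<gamma> r)))) ` (\<R> \<times> {..n}) =
      {ennreal (lf_abs (coef n f 0 j * inverse (\<gamma> 0))) | j. j \<le> n} \<union>
      {ennreal (lf_abs (coef n f r j * inverse (\<gamma> r))) | r j. r \<in> \<R>p \<and> j \<le> n}"
    (is "?l = ?A \<union> ?B")
  proof (intro equalityI subsetI)
    fix y assume "y \<in> ?l"
    then obtain r j where "r \<in> \<R>" "j \<le> n" "y = ennreal (lf_abs (coef n f r j * inverse (\<gamma> r)))"
      by auto
    then show "y \<in> ?A \<union> ?B"
      by (cases "r = 0") (auto simp: fin_exp_plus_iff)
  next
    fix y assume "y \<in> ?A \<union> ?B"
    then obtain r j where "r \<in> \<R>" "j \<le> n" "y = ennreal (lf_abs (coef n f r j * inverse (\<gamma> r)))"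
      using zero_in_fin_exp fin_exp_plus_iff by blast
    then show "y \<in> ?l" by force
  qed
  also have "?A = {ennreal (lf_abs (Dq j f 0)) | j. j \<le> n}"
    unfolding 0 ..
  also have "?B = {ennreal (lf_abs (psi (n - j) (Dq j f) r (pr r))) | r j. r \<in> \<R>p \<and> j \<le> n}"
    using coef_div_gam[of _ n f] by (intro Collect_cong) (metis (no_types, lifting))
  finally show ?thesis
    by (simp add: Cnorm_def)
qed

end

theorem theorem1p7:
  fixes \<pi> :: "'k::local_field" and T :: "'k set" and n :: nat
  assumes "uniformizer \<pi>" and "residue_reps T"
    and "CHAR('k) > 0 \<Longrightarrow> n \<le> CHAR('k) - 1"
  shows
    "orthonormal_basis (Cspace n) (Cnorm \<pi> T n) (fin_exp \<pi> T \<times> {..n})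
       (\<lambda>(r, j). wavelet \<pi> T n r j)
     \<and>
     (\<forall>f\<in>Cspace n. \<forall>b. wavelet_expansion \<pi> T n f b \<longrightarrow>
       (\<forall>j\<le>n. b 0 j = Dq j f 0 \<and>
         (\<forall>r\<in>fin_exp_plus \<pi> T. b r j = gam \<pi> T r * psi (n - j) (Dq j f) r (pred \<pi> T r))))
     \<and>
     (\<forall>f\<in>Cspace n. \<forall>b. wavelet_expansion \<pi> T n f b \<longrightarrow>
       (f \<in> Cspace (n + 1) \<longleftrightarrow>
         (\<forall>a\<in>\<O>. \<forall>j\<le>n. \<exists>L L0.
            ((\<lambda>r. b r j * inverse (gam \<pi> T r)) \<longlongrightarrow> L) (at a within fin_exp_plus \<pi> T) \<and>
            ((\<lambda>r. b r 0 * inverse (gam \<pi> T r)) \<longlongrightarrow> L0) (at a within fin_exp_plus \<pi> T) \<and>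
            L = of_nat ((n + 1) choose j) * L0)))
     \<and>
     (\<forall>f\<in>Cspace (n + 1). \<forall>b. wavelet_expansion \<pi> T n f b \<longrightarrow>
       Cnorm \<pi> T (n + 1) f =
         (SUP (r, j)\<in>fin_exp \<pi> T \<times> {..n}. ennreal (lf_abs (b r j * inverse (gam \<pi> T r)))) \<and>
       Cnorm \<pi> T (n + 1) f < \<infinity>)
     \<and>
     is_norm (Cspace (n + 1)) (Cnorm \<pi> T (n + 1))
     \<and>
     is_Banach (Cspace (n + 1)) (Cnorm \<pi> T (n + 1))"
proof -
  interpret wavelet_setup \<pi> T
    using assms(1,2) by unfold_locales
  have pR: "r \<in> \<R>" if "r \<in> \<R>p" for r
    using that by (simp add: fin_exp_plus_iff)
  show ?thesis
  proof (intro conjI)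
    show "\<forall>f\<in>Cspace n. \<forall>b. wavelet_expansion \<pi> T n f b \<longrightarrow>
       (\<forall>j\<le>n. b 0 j = Dq j f 0 \<and> (\<forall>r\<in>\<R>p. b r j = \<gamma> r * psi (n - j) (Dq j f) r (pr r)))"
    proof (intro ballI allI impI)
      fix f :: "'k \<Rightarrow> 'k" and b j
      assume f: "f \<in> Cspace n" "wavelet_expansion \<pi> T n f b" and j: "j \<le> n"
      show "b 0 j = Dq j f 0 \<and> (\<forall>r\<in>\<R>p. b r j = \<gamma> r * psi (n - j) (Dq j f) r (pr r))"
      proof (intro conjI ballI)
        show "b 0 j = Dq j f 0"
          using wavelet_expansion_unique[OF f zero_in_fin_exp j] by (simp add: coef_def)
        fix r assume r: "r \<in> \<R>p"
        then show "b r j = \<gamma> r * psi (n - j) (Dq j f) r (pr r)"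
          using wavelet_expansion_unique[OF f pR[OF r] j] by (simp add: coef_def fin_exp_plus_iff)
      qed
    qed
    show "\<forall>f\<in>Cspace n. \<forall>b. wavelet_expansion \<pi> T n f b \<longrightarrow>
       (f \<in> Cspace (n + 1) \<longleftrightarrow>
         (\<forall>a\<in>\<O>. \<forall>j\<le>n. \<exists>L L0.
            ((\<lambda>r. b r j * inverse (\<gamma> r)) \<longlongrightarrow> L) (atp a) \<and>
            ((\<lambda>r. b r 0 * inverse (\<gamma> r)) \<longlongrightarrow> L0) (atp a) \<and>
            L = of_nat ((n + 1) choose j) * L0))"
    proof (intro ballI allI impI)
      fix f :: "'k \<Rightarrow> 'k" and b
      assume f: "f \<in> Cspace n" "wavelet_expansion \<pi> T n f b"
      \<comment> \<open>The limits see only \<open>r\<close> in \<open>fin_exp_plus\<close>, where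
        any expansion of \<open>f\<close> has the coefficients \<open>coef\<close>, so the criterion
        carries over to \<open>b\<close>.\<close>
      have eq: "((\<lambda>r. b r j * inverse (\<gamma> r)) \<longlongrightarrow> L) (atp a) \<longleftrightarrow>
          ((\<lambda>r. coef n f r j * inverse (\<gamma> r)) \<longlongrightarrow> L) (atp a)" if "a \<in> \<O>" "j \<le> n" for a j L
      proof (rule tendsto_cong)
        show "\<forall>\<^sub>F r in atp a. b r j * inverse (\<gamma> r) = coef n f r j * inverse (\<gamma> r)"
          using eventually_fin_exp_plus[OF that(1)]
          by eventually_elim (simp add: wavelet_expansion_unique[OF f pR that(2)])
      qed
      show "f \<in> Cspace (n + 1) \<longleftrightarrow>
         (\<forall>a\<in>\<O>. \<forall>j\<le>n. \<exists>L L0.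
            ((\<lambda>r. b r j * inverse (\<gamma> r)) \<longlongrightarrow> L) (atp a) \<and>
            ((\<lambda>r. b r 0 * inverse (\<gamma> r)) \<longlongrightarrow> L0) (atp a) \<and>
            L = of_nat ((n + 1) choose j) * L0)"
        using Cspace_Suc_iff[OF f(1)] by (simp only: eq le0 Suc_eq_plus1 cong: ball_cong imp_cong)
    qed
    show "\<forall>f\<in>Cspace (n + 1). \<forall>b. wavelet_expansion \<pi> T n f b \<longrightarrow>
       Cnrm (n + 1) f =
         (SUP (r, j)\<in>\<R> \<times> {..n}. ennreal (lf_abs (b r j * inverse (\<gamma> r)))) \<and>
       Cnrm (n + 1) f < \<infinity>"
    proof (intro ballI allI impI conjI)
      fix f :: "'k \<Rightarrow> 'k" and b
      assume f: "f \<in> Cspace (n + 1)" "wavelet_expansion \<pi> T n f b"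
      have f': "f \<in> Cspace n"
        using f(1) Cspace_mono[of n "n + 1"] by auto
      have "(SUP (r, j)\<in>\<R> \<times> {..n}. ennreal (lf_abs (coef n f r j * inverse (\<gamma> r)))) =
          (SUP (r, j)\<in>\<R> \<times> {..n}. ennreal (lf_abs (b r j * inverse (\<gamma> r))))"
        by (intro SUP_cong refl) (auto simp: wavelet_expansion_unique[OF f' f(2)])
      then show "Cnrm (n + 1) f = (SUP (r, j)\<in>\<R> \<times> {..n}. ennreal (lf_abs (b r j * inverse (\<gamma> r))))"
        using Cnorm_Suc_eq_SUP[of n f] by simp
      show "Cnrm (n + 1) f < \<infinity>"
        by (rule Cnorm_finite[OF f(1)])
    qed
  qed (rule orthonormal_basis_wavelets is_norm_Cnorm is_Banach_Cnorm)+
qed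

end
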